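(* Expanding Ricci breathers on compact Riemannian manifolds must be Einstein. That is: let $M$ be a closed connected manifold and $\mathbf{g}(t)$, $t\in[t_1,t_2]$ with $t_1<t_2$, a solution to the Ricci flow $\frac{\partial}{\partial t}\mathbf{g}_{ij}=-2R_{ij}$ on $M$ such that $\mathbf{g}(t_2)=\alpha\,\Phi^*\mathbf{g}(t_1)$ for some constant $\alpha>1$ and some diffeomorphism $\Phi$ of $M$. Then $\mathbf{g}(t)$ is an Einstein metric.
   Context: A metric $\mathbf{g}(t)$ evolving by the Ricci flow is called a breather if for some $t_1<t_2$ and $\alpha>0$ the metrics $\alpha\mathbf{g}(t_1)$ and $\mathbf{g}(t_2)$ differ only by a diffeomorphism; the cases $\alpha=1$, $\alpha<1$, $\alpha>1$ correspond to steady, shrinking and expanding breathers, respectively. A metric $\mathbf{g}$ is Einstein if its Ricci tensor satisfies $R_{ij}=c\,\mathbf{g}_{ij}$ for some constant $c$. *)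

theory Defs
  imports "HOL-Analysis.Analysis"
begin

section \<open>Smooth functions\<close>

text \<open>
  Derivatives are taken within \<open>S\<close>, so that one definition covers open sets as well as
  space-time domains \<open>{a..b} \<times> V\<close> with \<open>a < b\<close> and \<open>V\<close> open, where the time derivatives at the
  two ends are one-sided. On these sets derivatives within \<open>S\<close> are unique.
\<close>

primrec Ck_on :: "nat \<Rightarrow> 'a::euclidean_space set \<Rightarrow> ('a \<Rightarrow> 'b::real_normed_vector) \<Rightarrow> bool" where
  "Ck_on 0 S f \<longleftrightarrow> continuous_on S f"
| "Ck_on (Suc k) S f \<longleftrightarrow>
     (\<exists>f'. (\<forall>x\<in>S. (f has_derivative f' x) (at x within S)) \<and> (\<forall>v. Ck_on k S (\<lambda>x. f' x v)))"

definition smooth_on :: "'a::euclidean_space set \<Rightarrow> ('a \<Rightarrow> 'b::real_normed_vector) \<Rightarrow> bool" where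
  "smooth_on S f \<longleftrightarrow> (\<forall>k. Ck_on k S f)"


section \<open>Smooth manifolds and smooth maps\<close>

text \<open>A chart is a pair of its domain and its coordinate map; the values of the coordinate map
  outside the domain are irrelevant.\<close>

type_synonym ('a, 'n) chart = "'a set \<times> ('a \<Rightarrow> real^'n)"

definition chart_on :: "'a topology \<Rightarrow> ('a, 'n::finite) chart \<Rightarrow> bool" where
  "chart_on M = (\<lambda>(U, \<phi>). openin M U \<and> open (\<phi> ` U) \<and>
     homeomorphic_map (subtopology M U) (top_of_set (\<phi> ` U)) \<phi>)"

definition coord_image :: "('a, 'n::finite) chart \<Rightarrow> (real^'n) set" where
  "coord_image = (\<lambda>(U, \<phi>). \<phi> ` U)"

text \<open>The coordinate expression of a map \<open>F\<close>, and the open set on which it makes sense.\<close>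

definition coord_rep ::
  "('a, 'n::finite) chart \<Rightarrow> ('a, 'n) chart \<Rightarrow> ('a \<Rightarrow> 'a) \<Rightarrow> real^'n \<Rightarrow> real^'n" where
  "coord_rep = (\<lambda>(U, \<phi>) (V, \<psi>) F. \<psi> \<circ> F \<circ> inv_into U \<phi>)"

definition coord_rep_dom ::
  "('a, 'n::finite) chart \<Rightarrow> ('a, 'n) chart \<Rightarrow> ('a \<Rightarrow> 'a) \<Rightarrow> (real^'n) set" where
  "coord_rep_dom = (\<lambda>(U, \<phi>) (V, \<psi>) F. \<phi> ` {p \<in> U. F p \<in> V})"

text \<open>A smooth atlas, not necessarily maximal. Every notion below depends only on the smooth
  structure that the atlas generates. For \<open>F = id\<close> the coordinate expressions are the
  transition maps.\<close>

definition smooth_atlas :: "'a topology \<Rightarrow> ('a, 'n::finite) chart set \<Rightarrow> bool" where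
  "smooth_atlas M A \<longleftrightarrow>
     (\<forall>c\<in>A. chart_on M c) \<and> (\<Union>c\<in>A. fst c) = topspace M \<and>
     (\<forall>c\<in>A. \<forall>d\<in>A. smooth_on (coord_rep_dom c d id) (coord_rep c d id))"

definition smooth_manifold :: "'a topology \<Rightarrow> ('a, 'n::finite) chart set \<Rightarrow> bool" where
  "smooth_manifold M A \<longleftrightarrow> Hausdorff_space M \<and> second_countable M \<and> smooth_atlas M A"

definition smooth_map :: "'a topology \<Rightarrow> ('a, 'n::finite) chart set \<Rightarrow> ('a \<Rightarrow> 'a) \<Rightarrow> bool" where
  "smooth_map M A F \<longleftrightarrow> continuous_map M M F \<and>
     (\<forall>c\<in>A. \<forall>d\<in>A. smooth_on (coord_rep_dom c d F) (coord_rep c d F))"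

definition diffeomorphism :: "'a topology \<Rightarrow> ('a, 'n::finite) chart set \<Rightarrow> ('a \<Rightarrow> 'a) \<Rightarrow> bool" where
  "diffeomorphism M A F \<longleftrightarrow>
     (\<exists>G. homeomorphic_maps M M F G \<and> smooth_map M A F \<and> smooth_map M A G)"


section \<open>Riemannian metrics\<close>

text \<open>
  A covariant tensor field of rank two is given by its components in each chart:
  \<open>T c x $ i $ j\<close> is the component \<open>T\<^sub>i\<^sub>j\<close> in the chart \<open>c\<close> at the point with coordinates \<open>x\<close>.
  It is constrained only for \<open>c\<close> in the atlas and \<open>x\<close> in \<open>coord_image c\<close>.
\<close>

type_synonym ('a, 'n) tensor2 = "('a, 'n) chart \<Rightarrow> real^'n \<Rightarrow> real^'n^'n"

text \<open>\<open>S = F\<^sup>* T\<close>: in coordinates, \<open>S\<^sub>i\<^sub>j(x) = \<Sum>\<^sub>k\<^sub>l \<partial>\<^sub>i F\<^sub>k(x) \<partial>\<^sub>j F\<^sub>l(x) T\<^sub>k\<^sub>l(F(x))\<close>.\<close>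

definition is_pullback ::
  "('a, 'n::finite) chart set \<Rightarrow> ('a \<Rightarrow> 'a) \<Rightarrow> ('a, 'n) tensor2 \<Rightarrow> ('a, 'n) tensor2 \<Rightarrow> bool" where
  "is_pullback A F T S \<longleftrightarrow>
     (\<forall>c\<in>A. \<forall>d\<in>A. \<forall>x\<in>coord_rep_dom c d F.
        let J = jacobian (coord_rep c d F) (at x)
        in S c x = transpose J ** T d (coord_rep c d F x) ** J)"

text \<open>For \<open>F = id\<close> this is the transformation law of the components under a change of chart.\<close>

definition tensor_field :: "('a, 'n::finite) chart set \<Rightarrow> ('a, 'n) tensor2 \<Rightarrow> bool" where
  "tensor_field A T \<longleftrightarrow> is_pullback A id T T"

definition riemannian_metric :: "('a, 'n::finite) chart set \<Rightarrow> ('a, 'n) tensor2 \<Rightarrow> bool" where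
  "riemannian_metric A g \<longleftrightarrow> tensor_field A g \<and>
     (\<forall>c\<in>A. smooth_on (coord_image c) (g c) \<and>
       (\<forall>x\<in>coord_image c. transpose (g c x) = g c x \<and> (\<forall>v. v \<noteq> 0 \<longrightarrow> v \<bullet> (g c x *v v) > 0)))"


section \<open>Curvature\<close>

definition partial :: "'n::finite \<Rightarrow> (real^'n \<Rightarrow> real) \<Rightarrow> real^'n \<Rightarrow> real" where
  "partial i f x = frechet_derivative f (at x) (axis i 1)"

text \<open>\<open>christoffel h k i j\<close> is the Christoffel symbol \<open>\<Gamma>\<^sup>k\<^sub>i\<^sub>j\<close> of the metric with components \<open>h\<close>.\<close>

definition christoffel ::
  "(real^'n \<Rightarrow> real^'n^'n) \<Rightarrow> 'n::finite \<Rightarrow> 'n \<Rightarrow> 'n \<Rightarrow> real^'n \<Rightarrow> real" where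
  "christoffel h k i j x = (\<Sum>l\<in>UNIV. matrix_inv (h x) $ k $ l *
     (partial i (\<lambda>y. h y $ j $ l) x + partial j (\<lambda>y. h y $ i $ l) x
        - partial l (\<lambda>y. h y $ i $ j) x)) / 2"

text \<open>\<open>riemann_curv h l i j k\<close> is the \<open>l\<close>-th component of \<open>R(\<partial>\<^sub>i, \<partial>\<^sub>j) \<partial>\<^sub>k\<close>, with
  \<open>R(X, Y) = \<nabla>\<^sub>X \<nabla>\<^sub>Y - \<nabla>\<^sub>Y \<nabla>\<^sub>X - \<nabla>\<^sub>[\<^sub>X\<^sub>,\<^sub>Y\<^sub>]\<close>.\<close>

definition riemann_curv ::
  "(real^'n \<Rightarrow> real^'n^'n) \<Rightarrow> 'n::finite \<Rightarrow> 'n \<Rightarrow> 'n \<Rightarrow> 'n \<Rightarrow> real^'n \<Rightarrow> real" where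
  "riemann_curv h l i j k x =
     partial i (christoffel h l j k) x - partial j (christoffel h l i k) x
     + (\<Sum>m\<in>UNIV. christoffel h l i m x * christoffel h m j k x
                - christoffel h l j m x * christoffel h m i k x)"

text \<open>\<open>R\<^sub>j\<^sub>k\<close> is the trace of \<open>X \<mapsto> R(X, \<partial>\<^sub>j) \<partial>\<^sub>k\<close>; with this sign round spheres have positive
  Ricci curvature.\<close>

definition ricci :: "(real^'n \<Rightarrow> real^'n^'n) \<Rightarrow> real^'n \<Rightarrow> real^'n^'n::finite" where
  "ricci h x = (\<chi> j k. \<Sum>i\<in>UNIV. riemann_curv h i i j k x)"

definition einstein_metric :: "('a, 'n::finite) chart set \<Rightarrow> ('a, 'n) tensor2 \<Rightarrow> bool" where
  "einstein_metric A g \<longleftrightarrow> riemannian_metric A g \<and>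
     (\<exists>k::real. \<forall>c\<in>A. \<forall>x\<in>coord_image c. ricci (g c) x = k *\<^sub>R g c x)"


section \<open>Ricci flow\<close>

text \<open>A solution is a family of metrics that is smooth on the closed space-time \<open>M \<times> [a,b]\<close>;
  at the end points the time derivative is one-sided.\<close>

definition ricci_flow ::
  "('a, 'n::finite) chart set \<Rightarrow> real \<Rightarrow> real \<Rightarrow> (real \<Rightarrow> ('a, 'n) tensor2) \<Rightarrow> bool" where
  "ricci_flow A a b g \<longleftrightarrow>
     (\<forall>t\<in>{a..b}. riemannian_metric A (g t)) \<and>
     (\<forall>c\<in>A. smooth_on ({a..b} \<times> coord_image c) (\<lambda>(t, x). g t c x)) \<and>
     (\<forall>c\<in>A. \<forall>x\<in>coord_image c. \<forall>t\<in>{a..b}.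
        ((\<lambda>s. g s c x) has_vector_derivative (-2) *\<^sub>R ricci (g t c) x) (at t within {a..b}))"

end

theory Submission
  imports Defs
begin

text \<open>Write \<open>R\<close> for the scalar curvature, \<open>n\<close> for the dimension, and let \<open>s\<^sub>0 \<le> 0\<close> be the smaller of \<open>0\<close> and
the minimum of \<open>R\<close> at time \<open>t1\<close>. The theorem follows from playing a lower bound for \<open>R\<close> against
the total volume.

Along the flow \<open>\<partial>\<^sub>t R = \<Delta> R + 2 |Ric|\<^sup>2 \<ge> \<Delta> R + (2/n) R\<^sup>2\<close>. By the maximum principle \<open>R\<close> stays above
the solution \<open>s(t) = s\<^sub>0 / (1 - (2/n) s\<^sub>0 (t - t1))\<close> of \<open>s' = (2/n) s\<^sup>2\<close> (\<open>sc_ge_barrier\<close>). Since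
\<open>\<partial>\<^sub>t log det g = -2 R\<close>, this bounds the growth of the volume element:
\<open>det g(t2) \<le> q\<^sup>n det g(t1)\<close> with \<open>q = 1 - (2/n) s\<^sub>0 (t2 - t1)\<close> (\<open>det_growth\<close>).

For a breather, \<open>R\<close> at time \<open>t2\<close> is \<open>R / \<alpha>\<close> at time \<open>t1\<close>, moved by \<open>\<Phi>\<close>. If \<open>s\<^sub>0 < 0\<close>, the lower bound at
the minimum says \<open>s\<^sub>0 / q \<le> s\<^sub>0 / \<alpha>\<close>, so \<open>q \<le> \<alpha>\<close>; if \<open>s\<^sub>0 = 0\<close>, then \<open>q = 1 < \<alpha>\<close>. But also
\<open>det g(t2) = \<alpha>\<^sup>n (det D\<Phi>)\<^sup>2 (det g(t1) \<circ> \<Phi>)\<close> in coordinates. So \<open>\<Phi>\<close> increases the volume of \<open>g(t1)\<close> nowhere. As \<open>\<Phi>\<close> is a bijection of a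
manifold of finite volume, it preserves volume everywhere (\<open>volume_rigidity\<close>), and all inequalities
above are equalities. Hence \<open>R = s\<close> on the whole space-time, and
\<open>s' = \<partial>\<^sub>t R \<ge> 2 |Ric|\<^sup>2 \<ge> (2/n) R\<^sup>2 = s'\<close> leaves only \<open>Ric = (R/n) g\<close> with \<open>R\<close> constant in space
(\<open>einstein_if_barrier\<close>).

The curvature identities are proved in coordinates, but with matrices instead of indices. The
Christoffel symbols form matrices \<open>\<Gamma>\<^sub>i = (\<Gamma>\<^sup>k\<^sub>i\<^sub>j)\<^sub>k\<^sub>j\<close>, and the curvature is
\<open>R\<^sub>i\<^sub>j = \<partial>\<^sub>i \<Gamma>\<^sub>j - \<partial>\<^sub>j \<Gamma>\<^sub>i + [\<Gamma>\<^sub>i, \<Gamma>\<^sub>j]\<close>. The second Bianchi identity is then a cancellation of products of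
matrices (\<open>second_bianchi\<close>), its double trace gives the contracted identity (\<open>contracted_bianchi\<close>),
and that identity is what turns \<open>\<partial>\<^sub>t R\<close> into \<open>\<Delta> R + 2 |Ric|\<^sup>2\<close> (\<open>scal_evolution_critical\<close>). A change
of coordinates acts on \<open>\<Gamma>\<^sub>i\<close> as a gauge transformation by the Jacobian matrix, which gives the
naturality of the Ricci tensor (\<open>ric_pullback\<close>). Volumes are computed by cutting the manifold into
finitely many disjoint Borel pieces, each inside one chart.\<close>

section \<open>Calculus of smooth functions on open sets\<close>

text \<open>The derivative in a fixed direction, as an operator on functions. All calculus below is done with
these operators on an open set; there they are commuting derivations of the smooth functions, and
this is the only structure that the curvature identities use.\<close>

definition ddir :: "'z::euclidean_space \<Rightarrow> ('z \<Rightarrow> 'b::real_normed_vector) \<Rightarrow> 'z \<Rightarrow> 'b" where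
  "ddir v f z = frechet_derivative f (at z) v"

lemma ddir_eqI: "(f has_derivative f') (at z) \<Longrightarrow> ddir v f z = f' v"
  unfolding ddir_def using frechet_derivative_at by metis

lemma has_derivative_ddir:
  "f differentiable (at z) \<Longrightarrow> (f has_derivative (\<lambda>v. ddir v f z)) (at z)"
  unfolding ddir_def by (simp add: frechet_derivative_works[symmetric])

lemma ddir_cong:
  assumes "open S" "z \<in> S" "\<And>y. y \<in> S \<Longrightarrow> f y = g y"
  shows "ddir v f z = ddir v g z"
proof -
  have "(f has_derivative D) (at z) \<longleftrightarrow> (g has_derivative D) (at z)" for D
    using assms has_derivative_transform_within_open[of f D z UNIV S g]
      has_derivative_transform_within_open[of g D z UNIV S f] by auto
  then show ?thesis unfolding ddir_def frechet_derivative_def by simp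
qed

lemma Ck_on_cong:
  assumes "\<And>x. x \<in> S \<Longrightarrow> f x = g x"
  shows "Ck_on k S f \<longleftrightarrow> Ck_on k S g"
proof (cases k)
  case 0
  then show ?thesis using assms by (simp cong: continuous_on_cong)
next
  case (Suc m)
  have "(f has_derivative D) (at x within S) \<longleftrightarrow> (g has_derivative D) (at x within S)"
    if "x \<in> S" for x D
    using assms that has_derivative_transform[of x S g f D] has_derivative_transform[of x S f g D] by auto
  then show ?thesis using Suc by simp
qed

lemma Ck_on_SucD: "Ck_on (Suc k) S f \<Longrightarrow> Ck_on k S f"
proof (induction k arbitrary: f)
  case 0
  then show ?case
    by (auto intro: has_derivative_continuous_on)
next
  case (Suc k)
  then obtain f' where "\<forall>x\<in>S. (f has_derivative f' x) (at x within S)"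
    "\<forall>v. Ck_on (Suc k) S (\<lambda>x. f' x v)" by auto
  with Suc.IH show ?case by (metis Ck_on.simps(2))
qed

lemma Ck_on_subset: "Ck_on k S f \<Longrightarrow> T \<subseteq> S \<Longrightarrow> Ck_on k T f"
proof (induction k arbitrary: f)
  case 0
  then show ?case by (auto intro: continuous_on_subset)
next
  case (Suc k)
  then obtain f' where "\<forall>x\<in>S. (f has_derivative f' x) (at x within S)"
    "\<forall>v. Ck_on k S (\<lambda>x. f' x v)" by auto
  with Suc show ?case
    by (auto intro!: exI[of _ f'] intro: has_derivative_subset)
qed

text \<open>On an open set the derivative is unique, so the existential in the definition of \<open>Ck_on\<close> can be
replaced by \<open>ddir\<close>. This makes induction on the order of differentiability usable for composition.\<close>

lemma Ck_on_Suc_open: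
  assumes "open S"
  shows "Ck_on (Suc k) S f \<longleftrightarrow> (\<forall>x\<in>S. f differentiable (at x)) \<and> (\<forall>v. Ck_on k S (ddir v f))"
proof
  assume "Ck_on (Suc k) S f"
  then obtain f' where f': "\<forall>x\<in>S. (f has_derivative f' x) (at x within S)"
    "\<forall>v. Ck_on k S (\<lambda>x. f' x v)" by auto
  have d: "(f has_derivative f' x) (at x)" if "x \<in> S" for x
    using f'(1) that assms by (metis at_within_open)
  have "Ck_on k S (ddir v f)" for v
    using Ck_on_cong[of S "ddir v f" "\<lambda>x. f' x v" k] ddir_eqI[OF d] f'(2) by blast
  with d show "(\<forall>x\<in>S. f differentiable (at x)) \<and> (\<forall>v. Ck_on k S (ddir v f))"
    by (auto simp: differentiable_def)
next
  assume "(\<forall>x\<in>S. f differentiable (at x)) \<and> (\<forall>v. Ck_on k S (ddir v f))"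
  then show "Ck_on (Suc k) S f"
    by (auto intro!: exI[of _ "\<lambda>x v. ddir v f x"]
        intro: has_derivative_at_withinI has_derivative_ddir)
qed

declare Ck_on.simps(2)[simp del]

lemma smooth_on_cong: "(\<And>x. x \<in> S \<Longrightarrow> f x = g x) \<Longrightarrow> smooth_on S f \<longleftrightarrow> smooth_on S g"
  unfolding smooth_on_def using Ck_on_cong by metis

lemma smooth_on_subset: "smooth_on S f \<Longrightarrow> T \<subseteq> S \<Longrightarrow> smooth_on T f"
  unfolding smooth_on_def using Ck_on_subset by blast

lemma smooth_on_differentiable:
  "smooth_on S f \<Longrightarrow> open S \<Longrightarrow> x \<in> S \<Longrightarrow> f differentiable (at x)"
  unfolding smooth_on_def using Ck_on_Suc_open by metis

lemma smooth_on_continuous: "smooth_on S f \<Longrightarrow> continuous_on S f"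
  unfolding smooth_on_def by (metis Ck_on.simps(1))

lemma smooth_on_ddir: "smooth_on S f \<Longrightarrow> open S \<Longrightarrow> smooth_on S (ddir v f)"
  unfolding smooth_on_def using Ck_on_Suc_open by metis

lemma Ck_on_const: "Ck_on k S (\<lambda>x. c)"
  by (induction k arbitrary: c) (auto simp: Ck_on.simps intro!: exI[of _ "\<lambda>x v. 0"])

lemma Ck_on_bounded_linear:
  assumes "bounded_linear L"
  shows "Ck_on k S f \<Longrightarrow> Ck_on k S (\<lambda>x. L (f x))"
proof (induction k arbitrary: f)
  case 0
  then show ?case using assms by (auto intro: bounded_linear.continuous_on)
next
  case (Suc k)
  then obtain f' where f': "\<forall>x\<in>S. (f has_derivative f' x) (at x within S)"
    "\<forall>v. Ck_on k S (\<lambda>x. f' x v)" by (auto simp: Ck_on.simps)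
  show ?case unfolding Ck_on.simps
    using f' Suc.IH
    by (auto intro!: exI[of _ "\<lambda>x v. L (f' x v)"] bounded_linear.has_derivative[OF assms])
qed

lemma Ck_on_add: "Ck_on k S f \<Longrightarrow> Ck_on k S g \<Longrightarrow> Ck_on k S (\<lambda>x. f x + g x)"
proof (induction k arbitrary: f g)
  case 0
  then show ?case by (auto intro: continuous_on_add)
next
  case (Suc k)
  then obtain f' g' where f': "\<forall>x\<in>S. (f has_derivative f' x) (at x within S)"
    "\<forall>v. Ck_on k S (\<lambda>x. f' x v)"
    and g': "\<forall>x\<in>S. (g has_derivative g' x) (at x within S)"
    "\<forall>v. Ck_on k S (\<lambda>x. g' x v)" by (auto simp: Ck_on.simps)
  show ?case unfolding Ck_on.simps
    using f' g' Suc.IH by (intro exI[of _ "\<lambda>x v. f' x v + g' x v"]) (auto intro: has_derivative_add)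
qed

lemma Ck_on_bilinear:
  assumes "bounded_bilinear h"
  shows "Ck_on k S f \<Longrightarrow> Ck_on k S g \<Longrightarrow> Ck_on k S (\<lambda>x. h (f x) (g x))"
proof (induction k arbitrary: f g)
  case 0
  then show ?case using assms by (auto intro: bounded_bilinear.continuous_on)
next
  case (Suc k)
  then obtain f' g' where f': "\<forall>x\<in>S. (f has_derivative f' x) (at x within S)"
    "\<forall>v. Ck_on k S (\<lambda>x. f' x v)"
    and g': "\<forall>x\<in>S. (g has_derivative g' x) (at x within S)"
    "\<forall>v. Ck_on k S (\<lambda>x. g' x v)" by (auto simp: Ck_on.simps)
  have "Ck_on k S f" "Ck_on k S g" using Suc.prems Ck_on_SucD by auto
  then show ?case unfolding Ck_on.simps
    using f' g' Suc.IH
    by (intro exI[of _ "\<lambda>x v. h (f x) (g' x v) + h (f' x v) (g x)"])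
      (auto intro!: bounded_bilinear.FDERIV[OF assms] Ck_on_add)
qed

lemma Ck_on_inverse:
  fixes f :: "'z::euclidean_space \<Rightarrow> real"
  assumes "\<And>x. x \<in> S \<Longrightarrow> f x \<noteq> 0"
  shows "Ck_on k S f \<Longrightarrow> Ck_on k S (\<lambda>x. inverse (f x))"
proof (induction k)
  case 0
  then show ?case using assms by (auto intro: continuous_on_inverse)
next
  case (Suc k)
  then obtain f' where f': "\<forall>x\<in>S. (f has_derivative f' x) (at x within S)"
    "\<forall>v. Ck_on k S (\<lambda>x. f' x v)" by (auto simp: Ck_on.simps)
  have i: "Ck_on k S (\<lambda>x. inverse (f x))" using Suc Ck_on_SucD by auto
  have "Ck_on k S (\<lambda>x. - (inverse (f x) * f' x v * inverse (f x)))" for v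
    using f'(2) i
    by (intro Ck_on_bounded_linear[OF bounded_linear_minus[OF bounded_linear_ident]] Ck_on_bilinear[OF bounded_bilinear_mult]) auto
  then show ?case unfolding Ck_on.simps
    using f' assms
    by (intro exI[of _ "\<lambda>x v. - (inverse (f x) * f' x v * inverse (f x))"])
      (auto intro!: has_derivative_inverse)
qed

lemma Ck_on_sum: "(\<And>i. i \<in> I \<Longrightarrow> Ck_on k S (f i)) \<Longrightarrow> Ck_on k S (\<lambda>x. \<Sum>i\<in>I. f i x)"
  by (induction I rule: infinite_finite_induct) (auto intro: Ck_on_const Ck_on_add)

lemma smooth_on_const: "smooth_on S (\<lambda>x. c)"
  unfolding smooth_on_def by (auto intro: Ck_on_const)

lemma smooth_on_bounded_linear: "bounded_linear L \<Longrightarrow> smooth_on S f \<Longrightarrow> smooth_on S (\<lambda>x. L (f x))"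
  unfolding smooth_on_def by (auto intro: Ck_on_bounded_linear)

lemma smooth_on_add: "smooth_on S f \<Longrightarrow> smooth_on S g \<Longrightarrow> smooth_on S (\<lambda>x. f x + g x)"
  unfolding smooth_on_def by (auto intro: Ck_on_add)

lemma smooth_on_sum: "(\<And>i. i \<in> I \<Longrightarrow> smooth_on S (f i)) \<Longrightarrow> smooth_on S (\<lambda>x. \<Sum>i\<in>I. f i x)"
  unfolding smooth_on_def by (auto intro: Ck_on_sum)

lemma smooth_on_bilinear:
  "bounded_bilinear h \<Longrightarrow> smooth_on S f \<Longrightarrow> smooth_on S g \<Longrightarrow> smooth_on S (\<lambda>x. h (f x) (g x))"
  unfolding smooth_on_def by (auto intro: Ck_on_bilinear)

lemmas smooth_on_mult = smooth_on_bilinear[OF bounded_bilinear_mult]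
lemmas smooth_on_scaleR = smooth_on_bilinear[OF bounded_bilinear_scaleR]

lemma smooth_on_minus: "smooth_on S f \<Longrightarrow> smooth_on S (\<lambda>x. - f x)"
  by (rule smooth_on_bounded_linear[OF bounded_linear_minus[OF bounded_linear_ident]])

lemma smooth_on_diff: "smooth_on S f \<Longrightarrow> smooth_on S g \<Longrightarrow> smooth_on S (\<lambda>x. f x - g x)"
  using smooth_on_add[OF _ smooth_on_minus] by fastforce

lemma smooth_on_inverse:
  fixes f :: "'z::euclidean_space \<Rightarrow> real"
  shows "(\<And>x. x \<in> S \<Longrightarrow> f x \<noteq> 0) \<Longrightarrow> smooth_on S f \<Longrightarrow> smooth_on S (\<lambda>x. inverse (f x))"
  unfolding smooth_on_def by (auto intro: Ck_on_inverse)

lemma smooth_on_prod: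
  fixes f :: "'i \<Rightarrow> 'z::euclidean_space \<Rightarrow> real"
  shows "(\<And>i. i \<in> I \<Longrightarrow> smooth_on S (f i)) \<Longrightarrow> smooth_on S (\<lambda>x. \<Prod>i\<in>I. f i x)"
  by (induction I rule: infinite_finite_induct) (auto intro: smooth_on_const smooth_on_mult)

lemma ddir_compose:
  assumes "F differentiable (at x)" "f differentiable (at (F x))"
  shows "ddir v (\<lambda>y. f (F y)) x = ddir (ddir v F x) f (F x)"
  by (rule ddir_eqI) (use has_derivative_compose[OF has_derivative_ddir[OF assms(1)]
    has_derivative_ddir[OF assms(2)]] in auto)

lemma ddir_linear:
  assumes "f differentiable (at x)"
  shows "linear (\<lambda>v. ddir v f x)"
  using has_derivative_linear[OF has_derivative_ddir[OF assms]] .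

lemma ddir_in_basis:
  assumes "f differentiable (at x)"
  shows "ddir v f x = (\<Sum>b\<in>Basis. (v \<bullet> b) *\<^sub>R ddir b f x)"
proof -
  have "ddir (\<Sum>b\<in>Basis. (v \<bullet> b) *\<^sub>R b) f x = (\<Sum>b\<in>Basis. (v \<bullet> b) *\<^sub>R ddir b f x)"
    using linear_sum[OF ddir_linear[OF assms], of "\<lambda>b. (v \<bullet> b) *\<^sub>R b" Basis]
      linear_cmul[OF ddir_linear[OF assms]] by simp
  then show ?thesis by (simp add: euclidean_representation)
qed

lemma Ck_on_compose:
  assumes "open S" "open T" "F ` S \<subseteq> T" "\<And>k. Ck_on k S F"
  shows "Ck_on k T f \<Longrightarrow> Ck_on k S (\<lambda>x. f (F x))"
proof (induction k arbitrary: f)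
  case 0
  have "continuous_on S F" using assms(4)[of 0] by simp
  then show ?case using 0 assms(3)
    by (metis Ck_on.simps(1) continuous_on_compose2)
next
  case (Suc k)
  have dF: "F differentiable (at x)" if "x \<in> S" for x
    using assms(4)[of 1] that assms(1) by (simp add: Ck_on_Suc_open)
  have df: "f differentiable (at y)" if "y \<in> T" for y
    using Suc.prems that assms(2) by (simp add: Ck_on_Suc_open)
  have "ddir v (\<lambda>x. f (F x)) x = (\<Sum>b\<in>Basis. (ddir v F x \<bullet> b) *\<^sub>R ddir b f (F x))" if "x \<in> S" for x v
    using ddir_compose[OF dF df, of x v] ddir_in_basis[OF df, of "F x" "ddir v F x"] that assms(3) by auto
  moreover have "Ck_on k S (\<lambda>x. \<Sum>b\<in>Basis. (ddir v F x \<bullet> b) *\<^sub>R ddir b f (F x))" for v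
  proof (intro Ck_on_sum Ck_on_bilinear[OF bounded_bilinear_scaleR])
    show "Ck_on k S (\<lambda>x. ddir v F x \<bullet> b)" for b
      using assms(4)[of "Suc k"] assms(1)
      by (intro Ck_on_bounded_linear[OF bounded_linear_inner_left]) (simp add: Ck_on_Suc_open)
    show "Ck_on k S (\<lambda>x. ddir b f (F x))" for b
      using Suc assms(2) by (simp add: Ck_on_Suc_open)
  qed
  ultimately have "Ck_on k S (ddir v (\<lambda>x. f (F x)))" for v
    using Ck_on_cong by (metis (no_types, lifting))
  moreover have "(\<lambda>x. f (F x)) differentiable (at x)" if "x \<in> S" for x
    using differentiable_chain_at[OF dF[OF that] df] that assms(3) by (auto simp: o_def)
  ultimately show ?case using assms(1) by (simp add: Ck_on_Suc_open)
qed

lemma smooth_on_compose: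
  "open S \<Longrightarrow> open T \<Longrightarrow> F ` S \<subseteq> T \<Longrightarrow> smooth_on S F \<Longrightarrow> smooth_on T f \<Longrightarrow> smooth_on S (\<lambda>x. f (F x))"
  unfolding smooth_on_def using Ck_on_compose by blast

lemma ddir_bounded_linear:
  assumes "bounded_linear L" "f differentiable (at z)"
  shows "ddir v (\<lambda>y. L (f y)) z = L (ddir v f z)"
  by (rule ddir_eqI) (use bounded_linear.has_derivative[OF assms(1) has_derivative_ddir[OF assms(2)]] in auto)

lemma ddir_bilinear:
  assumes "bounded_bilinear h" "f differentiable (at z)" "g differentiable (at z)"
  shows "ddir v (\<lambda>y. h (f y) (g y)) z = h (ddir v f z) (g z) + h (f z) (ddir v g z)"
  using ddir_eqI[OF bounded_bilinear.FDERIV[OF assms(1) has_derivative_ddir[OF assms(2)]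
    has_derivative_ddir[OF assms(3)]]] by (simp add: add.commute)

lemma ddir_add:
  "f differentiable (at z) \<Longrightarrow> g differentiable (at z) \<Longrightarrow>
   ddir v (\<lambda>y. f y + g y) z = ddir v f z + ddir v g z"
  using ddir_eqI[OF has_derivative_add[OF has_derivative_ddir has_derivative_ddir]] .

lemma ddir_diff:
  "f differentiable (at z) \<Longrightarrow> g differentiable (at z) \<Longrightarrow>
   ddir v (\<lambda>y. f y - g y) z = ddir v f z - ddir v g z"
  using ddir_eqI[OF has_derivative_diff[OF has_derivative_ddir has_derivative_ddir]] .

lemma ddir_sum:
  "(\<And>i. i \<in> I \<Longrightarrow> f i differentiable (at z)) \<Longrightarrow>
   ddir v (\<lambda>y. \<Sum>i\<in>I. f i y) z = (\<Sum>i\<in>I. ddir v (f i) z)"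
  by (rule ddir_eqI, rule has_derivative_sum) (auto intro: has_derivative_ddir)

lemma ddir_const: "ddir v (\<lambda>y. c) z = 0"
  by (rule ddir_eqI) (rule has_derivative_const)

lemma ddir_line:
  fixes f :: "'z::euclidean_space \<Rightarrow> real"
  assumes "f differentiable (at (a + s *\<^sub>R v))"
  shows "((\<lambda>s. f (a + s *\<^sub>R v)) has_real_derivative ddir v f (a + s *\<^sub>R v)) (at s)"
proof -
  have "((\<lambda>s. a + s *\<^sub>R v) has_derivative (\<lambda>s. s *\<^sub>R v)) (at s)"
    by (auto intro!: derivative_eq_intros)
  from has_derivative_compose[OF this has_derivative_ddir[OF assms]]
  have "((\<lambda>s. f (a + s *\<^sub>R v)) has_derivative (\<lambda>x. ddir (x *\<^sub>R v) f (a + s *\<^sub>R v))) (at s)" .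
  moreover have "ddir (x *\<^sub>R v) f (a + s *\<^sub>R v) = ddir v f (a + s *\<^sub>R v) * x" for x
    using linear_cmul[OF ddir_linear[OF assms], of x v] by simp
  ultimately show ?thesis by (simp add: has_field_derivative_def)
qed

text \<open>Two applications of the mean value theorem to the second difference over a parallelogram. The
second difference is symmetric in \<open>v\<close> and \<open>w\<close>, so shrinking the parallelogram yields the symmetry
of second derivatives.\<close>

lemma second_difference_mvt:
  fixes f :: "'z::euclidean_space \<Rightarrow> real"
  assumes S: "smooth_on S f" "open S" and h: "h > 0"
    and box: "\<And>s t. 0 \<le> s \<Longrightarrow> s \<le> h \<Longrightarrow> 0 \<le> t \<Longrightarrow> t \<le> h \<Longrightarrow> z + s *\<^sub>R v + t *\<^sub>R w \<in> S"
  shows "\<exists>s t. 0 \<le> s \<and> s \<le> h \<and> 0 \<le> t \<and> t \<le> h \<and>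
    f (z + h *\<^sub>R v + h *\<^sub>R w) - f (z + h *\<^sub>R v) - f (z + h *\<^sub>R w) + f z
      = h * h * ddir w (ddir v f) (z + s *\<^sub>R v + t *\<^sub>R w)"
proof -
  define p where "p = (\<lambda>s. f (z + h *\<^sub>R w + s *\<^sub>R v) - f (z + s *\<^sub>R v))"
  have d1: "(p has_real_derivative ddir v f (z + h *\<^sub>R w + s *\<^sub>R v) - ddir v f (z + s *\<^sub>R v)) (at s)"
    if "0 \<le> s" "s \<le> h" for s
    unfolding p_def
    by (intro DERIV_diff ddir_line smooth_on_differentiable[OF S])
      (use box[of s h] box[of s 0] that h in \<open>auto simp: algebra_simps\<close>)
  obtain s where s: "0 < s" "s < h"
    "p h - p 0 = (h - 0) * (ddir v f (z + h *\<^sub>R w + s *\<^sub>R v) - ddir v f (z + s *\<^sub>R v))"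
    using MVT2[OF h d1] by auto
  define q where "q = (\<lambda>t. ddir v f (z + s *\<^sub>R v + t *\<^sub>R w))"
  have d2: "(q has_real_derivative ddir w (ddir v f) (z + s *\<^sub>R v + t *\<^sub>R w)) (at t)"
    if "0 \<le> t" "t \<le> h" for t
    unfolding q_def
    by (intro ddir_line smooth_on_differentiable[OF smooth_on_ddir[OF S]])
      (use box[of s t] that h s S in auto)
  obtain t where t: "0 < t" "t < h"
    "q h - q 0 = (h - 0) * ddir w (ddir v f) (z + s *\<^sub>R v + t *\<^sub>R w)"
    using MVT2[OF h d2] by auto
  have "p h - p 0 = h * (q h - q 0)"
    unfolding s(3) q_def by (simp add: algebra_simps)
  with s t show ?thesis unfolding p_def
    by (intro exI[of _ s] exI[of _ t]) (auto simp: algebra_simps)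
qed

lemma ddir_commute_real:
  fixes f :: "'z::euclidean_space \<Rightarrow> real"
  assumes S: "smooth_on S f" "open S" and z: "z \<in> S"
  shows "ddir v (ddir w f) z = ddir w (ddir v f) z"
proof (rule ccontr)
  assume ne: "ddir v (ddir w f) z \<noteq> ddir w (ddir v f) z"
  define e where "e = \<bar>ddir v (ddir w f) z - ddir w (ddir v f) z\<bar> / 2"
  have e: "e > 0" using ne by (simp add: e_def)
  have c: "continuous_on S (ddir v (ddir w f))" "continuous_on S (ddir w (ddir v f))"
    using smooth_on_continuous[OF smooth_on_ddir[OF smooth_on_ddir[OF S] S(2)]] by auto
  obtain d1 where d1: "d1 > 0" "\<And>y. y \<in> S \<Longrightarrow> dist y z < d1 \<Longrightarrow>
      dist (ddir v (ddir w f) y) (ddir v (ddir w f) z) < e"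
    using c(1) e z unfolding continuous_on_iff by metis
  obtain d2 where d2: "d2 > 0" "\<And>y. y \<in> S \<Longrightarrow> dist y z < d2 \<Longrightarrow>
      dist (ddir w (ddir v f) y) (ddir w (ddir v f) z) < e"
    using c(2) e z unfolding continuous_on_iff by metis
  obtain d3 where d3: "d3 > 0" "ball z d3 \<subseteq> S" using S(2) z open_contains_ball by metis
  define d where "d = min d1 (min d2 d3)"
  have d: "d > 0" using d1 d2 d3 by (simp add: d_def)
  define h where "h = d / (2 * (norm v + norm w + 1))"
  have nv: "norm v + norm w + 1 > 0" by (smt (verit) norm_ge_zero)
  have h: "h > 0" using d nv by (simp add: h_def)
  have near: "dist (z + s *\<^sub>R v + t *\<^sub>R w) z < d" if "0 \<le> s" "s \<le> h" "0 \<le> t" "t \<le> h" for s t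
  proof -
    have "dist (z + s *\<^sub>R v + t *\<^sub>R w) z = norm (s *\<^sub>R v + t *\<^sub>R w)"
      by (simp add: dist_norm algebra_simps)
    also have "\<dots> \<le> s * norm v + t * norm w"
      using norm_triangle_ineq[of "s *\<^sub>R v" "t *\<^sub>R w"] that by simp
    also have "\<dots> \<le> h * norm v + h * norm w"
      using that by (intro add_mono mult_right_mono) auto
    also have "\<dots> \<le> h * (norm v + norm w + 1)" using h by (simp add: algebra_simps)
    also have "\<dots> = d / 2" using nv by (simp add: h_def field_simps)
    finally show ?thesis using d by simp
  qed
  have inS: "z + s *\<^sub>R v + t *\<^sub>R w \<in> S" if "0 \<le> s" "s \<le> h" "0 \<le> t" "t \<le> h" for s t
    using near[OF that] d3 by (auto simp: d_def dist_commute)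
  have inS': "z + s *\<^sub>R w + t *\<^sub>R v \<in> S" if "0 \<le> s" "s \<le> h" "0 \<le> t" "t \<le> h" for s t
    using inS[of t s] that by (simp add: algebra_simps)
  obtain s t where st: "0 \<le> s" "s \<le> h" "0 \<le> t" "t \<le> h"
    "f (z + h *\<^sub>R v + h *\<^sub>R w) - f (z + h *\<^sub>R v) - f (z + h *\<^sub>R w) + f z
      = h * h * ddir w (ddir v f) (z + s *\<^sub>R v + t *\<^sub>R w)"
    using second_difference_mvt[OF S h inS] by blast
  obtain s' t' where st': "0 \<le> s'" "s' \<le> h" "0 \<le> t'" "t' \<le> h"
    "f (z + h *\<^sub>R w + h *\<^sub>R v) - f (z + h *\<^sub>R w) - f (z + h *\<^sub>R v) + f z
      = h * h * ddir v (ddir w f) (z + s' *\<^sub>R w + t' *\<^sub>R v)"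
    using second_difference_mvt[OF S h inS'] by blast
  have "h * h * ddir w (ddir v f) (z + s *\<^sub>R v + t *\<^sub>R w) = h * h * ddir v (ddir w f) (z + s' *\<^sub>R w + t' *\<^sub>R v)"
    using st(5) st'(5) by (simp add: algebra_simps)
  then have eq: "ddir w (ddir v f) (z + s *\<^sub>R v + t *\<^sub>R w) = ddir v (ddir w f) (z + t' *\<^sub>R v + s' *\<^sub>R w)"
    using h by (simp add: algebra_simps)
  have "dist (ddir w (ddir v f) (z + s *\<^sub>R v + t *\<^sub>R w)) (ddir w (ddir v f) z) < e"
    using d2(2) inS near st by (auto simp: d_def)
  moreover have "dist (ddir v (ddir w f) (z + t' *\<^sub>R v + s' *\<^sub>R w)) (ddir v (ddir w f) z) < e"
    using d1(2) inS near st' by (auto simp: d_def)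
  ultimately show False using eq unfolding e_def dist_real_def by (auto simp: abs_if split: if_splits)
qed

lemma ddir_commute:
  fixes f :: "'z::euclidean_space \<Rightarrow> 'b::euclidean_space"
  assumes S: "smooth_on S f" "open S" and z: "z \<in> S"
  shows "ddir v (ddir w f) z = ddir w (ddir v f) z"
proof (rule euclidean_eqI)
  fix b :: 'b assume "b \<in> Basis"
  have sm: "smooth_on S (\<lambda>y. f y \<bullet> b)" by (rule smooth_on_bounded_linear[OF bounded_linear_inner_left S(1)])
  have 1: "ddir w (\<lambda>y. f y \<bullet> b) y = ddir w f y \<bullet> b" if "y \<in> S" for y w
    using ddir_bounded_linear[OF bounded_linear_inner_left smooth_on_differentiable[OF S that]] .
  have "ddir v (ddir w (\<lambda>y. f y \<bullet> b)) z = ddir v (ddir w f) z \<bullet> b" for v w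
  proof -
    have "ddir v (ddir w (\<lambda>y. f y \<bullet> b)) z = ddir v (\<lambda>y. ddir w f y \<bullet> b) z"
      using 1 by (intro ddir_cong[OF S(2) z]) auto
    also have "\<dots> = ddir v (ddir w f) z \<bullet> b"
      using ddir_bounded_linear[OF bounded_linear_inner_left smooth_on_differentiable[OF smooth_on_ddir[OF S] S(2) z]] .
    finally show ?thesis .
  qed
  then show "ddir v (ddir w f) z \<bullet> b = ddir w (ddir v f) z \<bullet> b"
    using ddir_commute_real[OF sm S(2) z] by metis
qed

section \<open>Matrix-valued functions\<close>

lemma matrix_scaleR_mult [simp]:
  "(c *\<^sub>R A) ** B = c *\<^sub>R (A ** B :: real^'n^'m)"
  "A ** (c *\<^sub>R B) = c *\<^sub>R (A ** B :: real^'n^'m)"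
  by (simp_all add: vec_eq_iff matrix_matrix_mult_def sum_distrib_left mult_ac)

lemma matrix_minus_mult [simp]:
  "(- A) ** B = - (A ** B :: real^'n^'m)" "A ** (- B) = - (A ** B :: real^'n^'m)"
  by (simp_all add: vec_eq_iff matrix_matrix_mult_def sum_negf)

lemma matrix_diff_ldistrib: "A ** (B - C) = A ** B - (A ** C :: real^'n^'m)"
  by (simp add: vec_eq_iff matrix_matrix_mult_def algebra_simps sum_subtractf)

lemma matrix_diff_rdistrib: "(A - B) ** C = A ** C - (B ** C :: real^'n^'m)"
  by (simp add: vec_eq_iff matrix_matrix_mult_def algebra_simps sum_subtractf)

lemma matrix_add_rdistrib': "(A + B) ** C = A ** C + (B ** C :: real^'n^'m)"
  by (simp add: vec_eq_iff matrix_matrix_mult_def algebra_simps sum.distrib)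

lemma matrix_zero_mult [simp]: "0 ** A = (0 :: real^'n^'m)" "A ** 0 = (0 :: real^'n^'m)"
  by (simp_all add: vec_eq_iff matrix_matrix_mult_def)

lemma matrix_sum_lmult: "(\<Sum>i\<in>I. f i) ** A = (\<Sum>i\<in>I. f i ** A :: real^'n^'m)"
  by (induction I rule: infinite_finite_induct) (auto simp: matrix_add_rdistrib')

lemma matrix_sum_rmult: "A ** (\<Sum>i\<in>I. f i) = (\<Sum>i\<in>I. A ** f i :: real^'n^'m)"
  by (induction I rule: infinite_finite_induct) (auto simp: matrix_add_ldistrib)

lemma transpose_linear [simp]:
  "transpose (A + B) = transpose A + (transpose B :: real^'n^'m)"
  "transpose (A - B) = transpose A - (transpose B :: real^'n^'m)"
  "transpose (- A) = - (transpose A :: real^'n^'m)"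
  "transpose (c *\<^sub>R A) = c *\<^sub>R (transpose A :: real^'n^'m)"
  "transpose (0 :: real^'m^'n) = 0"
  by (simp_all add: vec_eq_iff transpose_def)

lemmas matrix_simps = matrix_add_ldistrib matrix_add_rdistrib' matrix_diff_ldistrib
  matrix_diff_rdistrib matrix_mul_assoc

lemma bounded_bilinear_matrix_mult: "bounded_bilinear ((**) :: real^'n^'m \<Rightarrow> real^'k^'n \<Rightarrow> real^'k^'m)"
  unfolding bilinear_conv_bounded_bilinear[symmetric] bilinear_def
  by (auto intro!: linearI simp: matrix_add_ldistrib matrix_add_rdistrib' matrix_scaleR_mult)

lemma bounded_linear_transpose: "bounded_linear (transpose :: real^'n^'m \<Rightarrow> real^'m^'n)"
  unfolding linear_conv_bounded_linear[symmetric] by (auto intro!: linearI)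

lemma bounded_linear_trace: "bounded_linear (trace :: real^'n^'n \<Rightarrow> real)"
  unfolding linear_conv_bounded_linear[symmetric]
  by (auto intro!: linearI simp: trace_def sum.distrib sum_distrib_left)

lemma bounded_linear_entry: "bounded_linear (\<lambda>A :: real^'n^'m. A $ i $ j)"
  unfolding linear_conv_bounded_linear[symmetric] by (auto intro!: linearI)

lemma trace_scaleR [simp]: "trace (c *\<^sub>R A :: real^'n^'n) = c * trace A"
  by (simp add: trace_def sum_distrib_left)

lemma trace_minus [simp]: "trace (- A :: real^'n^'n) = - trace A"
  by (simp add: trace_def sum_negf)

lemma trace_transpose: "trace (transpose A :: real^'n^'n) = trace A"
  by (simp add: trace_def transpose_def)

lemma matrix_inv_unique:
  assumes "B ** A = mat 1" shows "matrix_inv A = (B :: real^'n^'n)"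
proof -
  have ab: "A ** B = mat 1" using assms matrix_left_right_inverse by blast
  then have "A ** matrix_inv A = mat 1 \<and> matrix_inv A ** A = mat 1"
    unfolding matrix_inv_def using assms
    by (intro someI[of "\<lambda>X. A ** X = mat 1 \<and> X ** A = mat 1" B] conjI)
  then show ?thesis using assms by (metis matrix_mul_assoc matrix_mul_lid matrix_mul_rid)
qed

lemma matrix_inv_mult:
  fixes A :: "real^'n^'n"
  assumes "invertible A"
  shows "matrix_inv A ** A = mat 1" "A ** matrix_inv A = mat 1"
  using assms matrix_inv_unique unfolding invertible_def by metis+

lemma transpose_matrix_inv:
  fixes A :: "real^'n^'n"
  assumes "invertible A" "transpose A = A"
  shows "transpose (matrix_inv A) = matrix_inv A"
proof -
  have "transpose (matrix_inv A) ** A = mat 1"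
    using arg_cong[OF matrix_inv_mult(2)[OF assms(1)], of transpose]
    by (simp add: matrix_transpose_mul assms(2) transpose_mat)
  from matrix_inv_unique[OF this] show ?thesis by simp
qed

lemmas smooth_on_matrix_mult = smooth_on_bilinear[OF bounded_bilinear_matrix_mult]
lemmas smooth_on_transpose = smooth_on_bounded_linear[OF bounded_linear_transpose]
lemmas smooth_on_trace = smooth_on_bounded_linear[OF bounded_linear_trace]
lemmas smooth_on_entry = smooth_on_bounded_linear[OF bounded_linear_entry]

lemma smooth_on_matrixI:
  fixes f :: "'z::euclidean_space \<Rightarrow> 'm::finite \<Rightarrow> 'n::finite \<Rightarrow> real"
  assumes "\<And>i j. smooth_on S (\<lambda>z. f z i j)"
  shows "smooth_on S (\<lambda>z. \<chi> i j. f z i j)"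
proof -
  have "(\<chi> i j. f z i j) = (\<Sum>i\<in>UNIV. \<Sum>j\<in>UNIV. f z i j *\<^sub>R axis i (axis j 1))" for z
  proof -
    have "(\<Sum>i\<in>UNIV. \<Sum>j\<in>UNIV. f z i j *\<^sub>R axis i (axis j 1)) $ a $ b
        = (\<Sum>i\<in>UNIV. if i = a then \<Sum>j\<in>UNIV. if j = b then f z i j else 0 else 0)" for a b
      unfolding sum_component by (rule sum.cong) (auto simp: axis_def intro!: sum.cong simp del: sum.delta sum.delta')
    then have "(\<Sum>i\<in>UNIV. \<Sum>j\<in>UNIV. f z i j *\<^sub>R axis i (axis j 1)) $ a $ b = f z a b" for a b
      by (simp only: sum.delta[OF finite] UNIV_I if_True)
    then show ?thesis by (simp only: vec_eq_iff vec_lambda_beta simp_thms)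
  qed
  then show ?thesis
    using assms by (auto intro!: smooth_on_sum smooth_on_scaleR smooth_on_const)
qed

lemma smooth_on_det:
  fixes M :: "'z::euclidean_space \<Rightarrow> real^'n^'n"
  assumes "smooth_on S M"
  shows "smooth_on S (\<lambda>z. det (M z))"
  unfolding det_def
  by (intro smooth_on_sum smooth_on_mult smooth_on_const smooth_on_prod smooth_on_entry assms)

text \<open>Cramer's rule writes each entry of the inverse as a quotient of determinants, hence as a polynomial
in the entries divided by a determinant that does not vanish.\<close>

lemma smooth_on_matrix_inv:
  fixes M :: "'z::euclidean_space \<Rightarrow> real^'n^'n"
  assumes M: "smooth_on S M" and inv: "\<And>z. z \<in> S \<Longrightarrow> invertible (M z)"
  shows "smooth_on S (\<lambda>z. matrix_inv (M z))"
proof -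
  have d: "det (M z) \<noteq> 0" if "z \<in> S" for z using inv[OF that] invertible_det_nz by blast
  let ?N = "\<lambda>z k l. (\<chi> i j. if j = k then (axis l 1 :: real^'n) $ i else M z $ i $ j)"
  have eq: "matrix_inv (M z) = (\<chi> k l. det (?N z k l) * inverse (det (M z)))" if "z \<in> S" for z
  proof -
    have "M z *v (matrix_inv (M z) *v axis l 1) = axis l 1" for l
      by (simp add: matrix_vector_mul_assoc matrix_inv_mult inv that)
    then have "matrix_inv (M z) *v axis l 1 = (\<chi> k. det (?N z k l) / det (M z))" for l
      using cramer[OF d[OF that]] by blast
    moreover have "(matrix_inv (M z) *v axis l 1) $ k = matrix_inv (M z) $ k $ l" for k l
      by (simp add: matrix_vector_mult_basis column_def)
    ultimately show ?thesis by (simp add: vec_eq_iff divide_inverse)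
  qed
  have sm: "smooth_on S (\<lambda>z. \<chi> k l. det (?N z k l) * inverse (det (M z)))"
  proof (intro smooth_on_matrixI smooth_on_mult smooth_on_det smooth_on_inverse M d)
    fix k l i j
    show "smooth_on S (\<lambda>z. if j = k then (axis l 1 :: real^'n) $ i else M z $ i $ j)"
      by (cases "j = k") (auto intro: smooth_on_const smooth_on_entry M)
  qed
  show ?thesis
    by (rule iffD2[OF smooth_on_cong sm]) (rule eq)
qed

lemma ddir_matrix_mult:
  "f differentiable (at z) \<Longrightarrow> g differentiable (at z) \<Longrightarrow>
   ddir v (\<lambda>y. f y ** g y :: real^'n^'m) z = ddir v f z ** g z + f z ** ddir v g z"
  by (rule ddir_bilinear[OF bounded_bilinear_matrix_mult])

lemma ddir_matrix_inv:
  fixes M :: "'z::euclidean_space \<Rightarrow> real^'n^'n"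
  assumes "smooth_on S M" "open S" and inv: "\<And>z. z \<in> S \<Longrightarrow> invertible (M z)" and z: "z \<in> S"
  shows "ddir v (\<lambda>y. matrix_inv (M y)) z = - (matrix_inv (M z) ** ddir v M z ** matrix_inv (M z))"
proof -
  let ?I = "\<lambda>y. matrix_inv (M y)"
  have d: "M differentiable (at z)" "?I differentiable (at z)"
    using smooth_on_differentiable assms smooth_on_matrix_inv by blast+
  have "ddir v (\<lambda>y. ?I y ** M y) z = ddir v (\<lambda>y. mat 1 :: real^'n^'n) z"
    using assms(2) z by (rule ddir_cong) (auto simp: matrix_inv_mult inv)
  then have "ddir v ?I z ** M z + ?I z ** ddir v M z = 0"
    using ddir_matrix_mult[OF d(2) d(1)] by (simp add: ddir_const)
  then have "ddir v ?I z ** M z = - (?I z ** ddir v M z)"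
    by (simp add: eq_neg_iff_add_eq_0)
  then have "(ddir v ?I z ** M z) ** ?I z = - (?I z ** ddir v M z) ** ?I z" by simp
  then show ?thesis
    by (simp add: matrix_mul_assoc[symmetric] matrix_inv_mult inv z)
qed

text \<open>In the Leibniz formula every permutation other than the identity moves at least two indices, so
its term vanishes to second order at the unit matrix. The identity contributes the trace.\<close>

lemma det_has_derivative_at_mat_1:
  "(det has_derivative trace) (at (mat 1 :: real^'n^'n))"
proof -
  let ?P = "{p. p permutes (UNIV :: 'n set)}"
  have "((\<lambda>X :: real^'n^'n. \<Sum>p\<in>?P. of_int (sign p) * (\<Prod>i\<in>UNIV. X $ i $ p i)) has_derivative
     (\<lambda>H. \<Sum>p\<in>?P. of_int (sign p) * (\<Sum>i\<in>UNIV. H $ i $ p i * (\<Prod>j\<in>UNIV - {i}. (mat 1 :: real^'n^'n) $ j $ p j)))) (at (mat 1))"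
    by (intro has_derivative_sum has_derivative_mult_right has_derivative_prod
        bounded_linear_imp_has_derivative[OF bounded_linear_entry])
  moreover have "(\<Sum>p\<in>?P. of_int (sign p) * (\<Sum>i\<in>UNIV. H $ i $ p i * (\<Prod>j\<in>UNIV - {i}. (mat 1 :: real^'n^'n) $ j $ p j)))
      = trace H" for H :: "real^'n^'n"
  proof -
    have z: "(\<Prod>j\<in>UNIV - {i}. (mat 1 :: real^'n^'n) $ j $ p j) = (if p = id then 1 else 0)"
      if "p permutes UNIV" for p and i :: 'n
    proof (cases "p = id")
      case True
      then show ?thesis by (simp add: mat_def)
    next
      case False
      have "\<exists>j. j \<noteq> i \<and> p j \<noteq> j"
      proof (rule ccontr)
        assume a: "\<not> (\<exists>j. j \<noteq> i \<and> p j \<noteq> j)"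
        then have "p i = i" using that by (metis permutes_def)
        with a have "p = id" by (auto simp: fun_eq_iff)
        with False show False by simp
      qed
      then obtain j where "j \<noteq> i" "p j \<noteq> j" by auto
      then show ?thesis using False
        by (auto simp: mat_def intro!: prod_zero bexI[of _ j])
    qed
    have "(\<Sum>p\<in>?P. of_int (sign p) * (\<Sum>i\<in>UNIV. H $ i $ p i * (\<Prod>j\<in>UNIV - {i}. (mat 1 :: real^'n^'n) $ j $ p j)))
        = (\<Sum>p\<in>?P. if p = id then trace H else 0)"
      by (rule sum.cong) (auto simp: z trace_def sign_id)
    also have "\<dots> = trace H" by (simp add: sum.delta permutes_id)
    finally show ?thesis .
  qed
  ultimately show ?thesis unfolding det_def[abs_def] by simp
qed

text \<open>Jacobi's formula, reduced to the unit matrix by \<open>det X = det A * det (A^(-1) X)\<close>.\<close>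

lemma det_has_derivative:
  fixes A :: "real^'n^'n"
  assumes "invertible A"
  shows "(det has_derivative (\<lambda>H. det A * trace (matrix_inv A ** H))) (at A)"
proof -
  have 1: "((\<lambda>X. matrix_inv A ** X) has_derivative (\<lambda>H. matrix_inv A ** H)) (at A)"
    by (intro bounded_linear_imp_has_derivative bounded_bilinear.bounded_linear_right[OF bounded_bilinear_matrix_mult])
  have 2: "(det has_derivative trace) (at (matrix_inv A ** A))"
    using det_has_derivative_at_mat_1 matrix_inv_mult[OF assms] by simp
  have "((\<lambda>X. det A * det (matrix_inv A ** X)) has_derivative (\<lambda>H. det A * trace (matrix_inv A ** H))) (at A)"
    by (rule has_derivative_mult_right[OF has_derivative_compose[OF 1 2]])
  moreover have "det A * det (matrix_inv A ** X) = det X" for X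
    using matrix_inv_mult(2)[OF assms] by (metis det_mul det_I mult_1 mult.assoc)
  ultimately show ?thesis by simp
qed

section \<open>Positive definite matrices\<close>

definition pos_def :: "real^'n^'n \<Rightarrow> bool" where
  "pos_def G \<longleftrightarrow> transpose G = G \<and> (\<forall>v. v \<noteq> 0 \<longrightarrow> v \<bullet> (G *v v) > 0)"

lemma dot_matrix_sym: "transpose G = G \<Longrightarrow> u \<bullet> (G *v v) = v \<bullet> (G *v (u :: real^'n))"
  by (metis dot_lmul_matrix inner_commute transpose_matrix_vector)

text \<open>Gram-Schmidt for the inner product given by \<open>G\<close>: as long as fewer than \<open>n\<close> vectors have been
found, some vector lies outside their span, and its component orthogonal to them can be normalized.
The columns of \<open>B\<close> are the resulting basis.\<close>

lemma pos_def_orthonormal_basis: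
  fixes G :: "real^'n^'n"
  assumes G: "pos_def G"
  obtains B :: "real^'n^'n" where "transpose B ** G ** B = mat 1"
proof -
  have "\<exists>b :: 'n \<Rightarrow> real^'n. \<forall>i\<in>I. \<forall>j\<in>I. b i \<bullet> (G *v b j) = (if i = j then 1 else 0)" for I
  proof (induction I rule: finite_induct[OF finite])
    case 1
    then show ?case by simp
  next
    case (2 k I)
    then obtain b :: "'n \<Rightarrow> real^'n" where b: "\<And>i j. i \<in> I \<Longrightarrow> j \<in> I \<Longrightarrow> b i \<bullet> (G *v b j) = (if i = j then 1 else 0)"
      by metis
    have "card I < CARD('n)"
      using 2 by (metis UNIV_I card_mono card_seteq finite not_less subset_UNIV)
    then have "dim (b ` I) < DIM(real^'n)"
      using dim_le_card'[of "b ` I"] card_image_le[of I b] by simp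
    then have "span (b ` I) \<noteq> UNIV" by (metis dim_UNIV dim_span nat_neq_iff)
    then obtain v where v: "v \<notin> span (b ` I)" by auto
    define w where "w = v - (\<Sum>j\<in>I. (b j \<bullet> (G *v v)) *\<^sub>R b j)"
    have "(\<Sum>j\<in>I. (b j \<bullet> (G *v v)) *\<^sub>R b j) \<in> span (b ` I)"
      by (intro span_sum span_scale span_base) auto
    then have "w \<noteq> 0" using v unfolding w_def by auto
    then have pos: "w \<bullet> (G *v w) > 0" using G by (simp add: pos_def_def)
    have orth: "b i \<bullet> (G *v w) = 0" if "i \<in> I" for i
    proof -
      have "b i \<bullet> (G *v w) = b i \<bullet> (G *v v) - (\<Sum>j\<in>I. (b j \<bullet> (G *v v)) * (b i \<bullet> (G *v b j)))"
        unfolding w_def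
        by (simp add: matrix_vector_mult_diff_distrib inner_diff_right linear_sum[OF matrix_vector_mul_linear]
            inner_sum_right matrix_vector_mult_scaleR)
      also have "(\<Sum>j\<in>I. (b j \<bullet> (G *v v)) * (b i \<bullet> (G *v b j))) = (\<Sum>j\<in>I. if j = i then b j \<bullet> (G *v v) else 0)"
        by (rule sum.cong) (auto simp: b that)
      finally show ?thesis using that by (simp add: sum.delta)
    qed
    define b' where "b' = b(k := (1 / sqrt (w \<bullet> (G *v w))) *\<^sub>R w)"
    have "b' i \<bullet> (G *v b' j) = (if i = j then 1 else 0)" if "i \<in> insert k I" "j \<in> insert k I" for i j
      using that b orth 2(2) pos dot_matrix_sym[of G w "b i"] dot_matrix_sym[of G w "b j"] G
      by (auto simp: b'_def matrix_vector_mult_scaleR pos_def_def field_simps)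
    then show ?case by blast
  qed
  from this[of UNIV] obtain b :: "'n \<Rightarrow> real^'n" where
    b: "\<And>i j. b i \<bullet> (G *v b j) = (if i = j then 1 else 0)" by auto
  let ?B = "\<chi> r c. b c $ r"
  have "(transpose ?B ** G ** ?B) $ i $ j = b i \<bullet> (G *v b j)" for i j
    unfolding matrix_mul_assoc[symmetric]
    by (simp add: matrix_matrix_mult_def transpose_def matrix_vector_mult_def inner_vec_def)
  then have "transpose ?B ** G ** ?B = mat 1"
    by (simp add: vec_eq_iff b mat_def)
  then show ?thesis by (rule that)
qed

lemma pos_def_det_pos: "pos_def (G :: real^'n^'n) \<Longrightarrow> det G > 0"
proof -
  assume "pos_def G"
  then obtain B :: "real^'n^'n" where "transpose B ** G ** B = mat 1" using pos_def_orthonormal_basis by blast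
  then have "det (transpose B ** G ** B) = 1" by simp
  then have "det B * det B * det G = 1" by (simp add: det_mul det_transpose mult_ac)
  moreover have "det B * det B \<ge> 0" by simp
  ultimately show ?thesis
    by (smt (verit) mult_nonneg_nonpos)
qed

lemma pos_def_invertible: "pos_def (G :: real^'n^'n) \<Longrightarrow> invertible G"
  using pos_def_det_pos invertible_det_nz by fastforce

lemma orthonormal_basis_inverse:
  fixes B G :: "real^'n^'n"
  assumes "transpose B ** G ** B = mat 1"
  shows "matrix_inv G = B ** transpose B" "B ** (transpose B ** G) = mat 1"
proof -
  show *: "B ** (transpose B ** G) = mat 1"
    using assms matrix_left_right_inverse by blast
  then show "matrix_inv G = B ** transpose B"
    by (intro matrix_inv_unique) (simp add: matrix_mul_assoc)
qed

text \<open>In an orthonormal basis \<open>B\<close> of \<open>G\<close> the trace becomes the sum of the squared entries of the symmetric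
matrix \<open>transpose B ** S ** B\<close>.\<close>

lemma trace_square_nonneg:
  fixes S G :: "real^'n^'n"
  assumes "pos_def G" "transpose S = S"
  shows "0 \<le> trace (S ** matrix_inv G ** S ** matrix_inv G)"
    and "trace (S ** matrix_inv G ** S ** matrix_inv G) = 0 \<Longrightarrow> S = 0"
proof -
  obtain B :: "real^'n^'n" where B: "transpose B ** G ** B = mat 1" using pos_def_orthonormal_basis[OF assms(1)] by blast
  note i = orthonormal_basis_inverse[OF B]
  define Q where "Q = transpose B ** S ** B"
  have Qt: "transpose Q = Q" by (simp add: Q_def matrix_transpose_mul assms(2) matrix_mul_assoc)
  have "trace (S ** matrix_inv G ** S ** matrix_inv G) = trace ((S ** B ** transpose B ** S ** B) ** transpose B)"
    by (simp add: i matrix_mul_assoc)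
  also have "\<dots> = trace (transpose B ** (S ** B ** transpose B ** S ** B))" by (rule trace_mul_sym)
  also have "\<dots> = trace (transpose Q ** Q)" by (simp add: Qt) (simp add: Q_def matrix_mul_assoc)
  also have "\<dots> = (\<Sum>i\<in>UNIV. \<Sum>j\<in>UNIV. (Q $ j $ i)\<^sup>2)"
    by (simp add: trace_def matrix_matrix_mult_def transpose_def power2_eq_square)
  finally have eq: "trace (S ** matrix_inv G ** S ** matrix_inv G) = (\<Sum>i\<in>UNIV. \<Sum>j\<in>UNIV. (Q $ j $ i)\<^sup>2)" .
  show "0 \<le> trace (S ** matrix_inv G ** S ** matrix_inv G)"
    unfolding eq by (intro sum_nonneg) auto
  assume "trace (S ** matrix_inv G ** S ** matrix_inv G) = 0"
  then have "Q = 0" unfolding eq by (simp add: sum_nonneg_eq_0_iff sum_nonneg vec_eq_iff)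
  then have "transpose (transpose B ** G) ** Q ** (transpose B ** G) = 0" by simp
  moreover have "transpose (transpose B ** G) ** transpose B = mat 1"
    using i(2) by (metis matrix_transpose_mul transpose_mat)
  ultimately show "S = 0"
    using i(2) unfolding Q_def by (metis matrix_mul_assoc matrix_mul_lid matrix_mul_rid)
qed

text \<open>Apply the previous lemma to the trace-free part of \<open>S\<close>. With \<open>S = Ric\<close> this is
\<open>|Ric|\<^sup>2 \<ge> R\<^sup>2 / n\<close>, with equality only when \<open>Ric\<close> is a multiple of the metric.\<close>

lemma trace_square_ge:
  fixes S G :: "real^'n^'n"
  assumes G: "pos_def G" and S: "transpose S = S"
  defines "T \<equiv> trace (S ** matrix_inv G ** S ** matrix_inv G)" and "r \<equiv> trace (S ** matrix_inv G)"
  shows "r\<^sup>2 / CARD('n) \<le> T" and "T = r\<^sup>2 / CARD('n) \<Longrightarrow> S = (r / CARD('n)) *\<^sub>R G"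
proof -
  let ?n = "real CARD('n)" and ?H = "matrix_inv G"
  have n: "?n > 0" by simp
  have GH: "G ** ?H = mat 1" using matrix_inv_mult[OF pos_def_invertible[OF G]] by simp
  define Q where "Q = S - (r / ?n) *\<^sub>R G"
  have Q: "transpose Q = Q" using G S by (simp add: Q_def pos_def_def)
  have QH: "Q ** ?H = S ** ?H - (r / ?n) *\<^sub>R mat 1"
    by (simp add: Q_def matrix_diff_rdistrib GH)
  have "Q ** ?H ** Q ** ?H = (Q ** ?H) ** (Q ** ?H)" by (simp add: matrix_mul_assoc)
  also have "\<dots> = (S ** ?H - (r / ?n) *\<^sub>R mat 1) ** (S ** ?H - (r / ?n) *\<^sub>R mat 1)"
    unfolding QH ..
  also have "(S ** ?H - (r / ?n) *\<^sub>R mat 1) ** (S ** ?H - (r / ?n) *\<^sub>R mat 1)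
     = S ** ?H ** S ** ?H - (2 * r / ?n) *\<^sub>R (S ** ?H) + ((r / ?n)\<^sup>2) *\<^sub>R mat 1"
    by (simp add: matrix_simps algebra_simps power2_eq_square flip: scaleR_add_left)
  finally have "trace (Q ** ?H ** Q ** ?H) = T - (2 * r / ?n) * r + (r / ?n)\<^sup>2 * ?n"
    by (simp add: trace_add trace_sub T_def r_def trace_I)
  also have "\<dots> = T - r\<^sup>2 / ?n" using n by (simp add: power2_eq_square field_simps)
  finally have eq: "trace (Q ** ?H ** Q ** ?H) = T - r\<^sup>2 / ?n" .
  then show "r\<^sup>2 / ?n \<le> T" using trace_square_nonneg(1)[OF G Q] by simp
  assume "T = r\<^sup>2 / ?n"
  then have "Q = 0" using eq trace_square_nonneg(2)[OF G Q] by simp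
  then show "S = (r / ?n) *\<^sub>R G" by (simp add: Q_def)
qed

section \<open>The Levi-Civita connection in matrix form\<close>

text \<open>The Christoffel symbols with the upper index lowered, \<open>\<Gamma>\<^sub>l\<^sub>i\<^sub>j\<close>, as a matrix in \<open>l\<close> and \<open>j\<close>. The vectors
\<open>e i\<close> play the role of the coordinate vector fields. They need not span the space: for a flow they are
the spatial directions in space-time, so that one theory covers a fixed metric and a family of
metrics depending on time.\<close>

definition conn_lower :: "('n::finite \<Rightarrow> 'z::euclidean_space) \<Rightarrow> ('z \<Rightarrow> real^'n^'n) \<Rightarrow> 'n \<Rightarrow> 'z \<Rightarrow> real^'n^'n" where
  "conn_lower e G i z = (\<chi> l j. (ddir (e i) G z $ j $ l + ddir (e j) G z $ i $ l - ddir (e l) G z $ i $ j) / 2)"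

definition conn :: "('n::finite \<Rightarrow> 'z::euclidean_space) \<Rightarrow> ('z \<Rightarrow> real^'n^'n) \<Rightarrow> 'n \<Rightarrow> 'z \<Rightarrow> real^'n^'n" where
  "conn e G i z = matrix_inv (G z) ** conn_lower e G i z"

text \<open>The curvature of an arbitrary matrix-valued connection form. Leaving \<open>\<Gamma>\<close> free allows a gauge
transformation to be stated (\<open>gauge_curvature\<close>).\<close>

definition conn_curv :: "('n::finite \<Rightarrow> 'z::euclidean_space) \<Rightarrow> ('n \<Rightarrow> 'z \<Rightarrow> real^'n^'n) \<Rightarrow> 'n \<Rightarrow> 'n \<Rightarrow> 'z \<Rightarrow> real^'n^'n" where
  "conn_curv e \<Gamma> i j z = ddir (e i) (\<Gamma> j) z - ddir (e j) (\<Gamma> i) z + \<Gamma> i z ** \<Gamma> j z - \<Gamma> j z ** \<Gamma> i z"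

definition ric :: "('n::finite \<Rightarrow> 'z::euclidean_space) \<Rightarrow> ('z \<Rightarrow> real^'n^'n) \<Rightarrow> 'z \<Rightarrow> real^'n^'n" where
  "ric e G z = (\<chi> j k. \<Sum>i\<in>UNIV. conn_curv e (conn e G) i j z $ i $ k)"

definition scal :: "('n::finite \<Rightarrow> 'z::euclidean_space) \<Rightarrow> ('z \<Rightarrow> real^'n^'n) \<Rightarrow> 'z \<Rightarrow> real" where
  "scal e G z = trace (ric e G z ** matrix_inv (G z))"

locale metric_frame =
  fixes W :: "'z::euclidean_space set" and e :: "'n::finite \<Rightarrow> 'z" and G :: "'z \<Rightarrow> real^'n^'n"
  assumes open_W: "open W" and smooth_G: "smooth_on W G" and pos_G: "\<And>z. z \<in> W \<Longrightarrow> pos_def (G z)"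
begin

abbreviation "H z \<equiv> matrix_inv (G z)"
abbreviation "\<Gamma> \<equiv> conn e G"
abbreviation "R \<equiv> conn_curv e \<Gamma>"
abbreviation "Ric \<equiv> ric e G"
text \<open>The curvature with its last index raised. In this form it is skew both in the form indices \<open>i\<close>, \<open>j\<close>
and as a matrix, and this is what makes the double trace of the Bianchi identity collapse. Its
trace \<open>P\<close> is the Ricci endomorphism.\<close>

definition "S i j z = R i j z ** H z"
definition "P z = Ric z ** H z"

lemma inv_G: "z \<in> W \<Longrightarrow> invertible (G z)"
  using pos_G pos_def_invertible by blast

lemma HG: "z \<in> W \<Longrightarrow> H z ** G z = mat 1" "z \<in> W \<Longrightarrow> G z ** H z = mat 1"
  using matrix_inv_mult inv_G by blast+

lemma sym_G: "z \<in> W \<Longrightarrow> transpose (G z) = G z"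
  using pos_G unfolding pos_def_def by blast

lemma sym_H: "z \<in> W \<Longrightarrow> transpose (H z) = H z"
  using transpose_matrix_inv inv_G sym_G by blast

lemma smooth_ddir: "smooth_on W f \<Longrightarrow> smooth_on W (ddir v f)"
  using smooth_on_ddir open_W by blast

lemma differentiable: "smooth_on W f \<Longrightarrow> z \<in> W \<Longrightarrow> f differentiable (at z)"
  using smooth_on_differentiable open_W by blast

lemma smooth_H: "smooth_on W H"
  using smooth_on_matrix_inv smooth_G inv_G by blast

lemma smooth_conn: "smooth_on W (\<Gamma> i)"
  unfolding conn_def[abs_def] conn_lower_def divide_inverse
  by (intro smooth_on_matrix_mult smooth_H smooth_on_matrixI smooth_on_mult smooth_on_const
      smooth_on_add smooth_on_diff smooth_on_entry smooth_ddir smooth_G)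

lemma smooth_curv: "smooth_on W (R i j)"
  unfolding conn_curv_def[abs_def]
  by (intro smooth_on_matrix_mult smooth_on_add smooth_on_diff smooth_ddir smooth_conn)

lemma smooth_ric: "smooth_on W Ric"
  unfolding ric_def[abs_def]
  by (intro smooth_on_matrixI smooth_on_sum smooth_on_entry smooth_curv)

lemma smooth_S: "smooth_on W (S i j)"
  unfolding S_def[abs_def] by (intro smooth_on_matrix_mult smooth_curv smooth_H)

lemma smooth_P: "smooth_on W P"
  unfolding P_def[abs_def] by (intro smooth_on_matrix_mult smooth_ric smooth_H)

lemma smooth_scal: "smooth_on W (scal e G)"
  unfolding scal_def[abs_def] by (intro smooth_on_trace smooth_on_matrix_mult smooth_ric smooth_H)

lemma D_mult: "smooth_on W f \<Longrightarrow> smooth_on W g \<Longrightarrow> z \<in> W \<Longrightarrow>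
   ddir v (\<lambda>y. f y ** g y :: real^'k^'m) z = ddir v f z ** g z + f z ** ddir v g z"
  by (intro ddir_matrix_mult differentiable)

lemma D_add: "smooth_on W f \<Longrightarrow> smooth_on W g \<Longrightarrow> z \<in> W \<Longrightarrow>
   ddir v (\<lambda>y. f y + g y) z = ddir v f z + ddir v g z"
  by (intro ddir_add differentiable)

lemma D_diff: "smooth_on W f \<Longrightarrow> smooth_on W g \<Longrightarrow> z \<in> W \<Longrightarrow>
   ddir v (\<lambda>y. f y - g y) z = ddir v f z - ddir v g z"
  by (intro ddir_diff differentiable)

lemma D_transpose: "smooth_on W f \<Longrightarrow> z \<in> W \<Longrightarrow>
   ddir v (\<lambda>y. transpose (f y :: real^'k^'m)) z = transpose (ddir v f z)"
  by (intro ddir_bounded_linear bounded_linear_transpose differentiable)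

lemma D_entry: "smooth_on W f \<Longrightarrow> z \<in> W \<Longrightarrow>
   ddir v (\<lambda>y. (f y :: real^'k^'m) $ i $ j) z = ddir v f z $ i $ j"
  using ddir_bounded_linear[OF bounded_linear_entry differentiable] .

lemma D_trace: "smooth_on W f \<Longrightarrow> z \<in> W \<Longrightarrow>
   ddir v (\<lambda>y. trace (f y :: real^'k^'k)) z = trace (ddir v f z)"
  by (intro ddir_bounded_linear bounded_linear_trace differentiable)

lemma D_sum: "(\<And>i. i \<in> I \<Longrightarrow> smooth_on W (f i)) \<Longrightarrow> z \<in> W \<Longrightarrow>
   ddir v (\<lambda>y. \<Sum>i\<in>I. f i y) z = (\<Sum>i\<in>I. ddir v (f i) z)"
  by (intro ddir_sum differentiable)

lemma D_cong: "z \<in> W \<Longrightarrow> (\<And>y. y \<in> W \<Longrightarrow> f y = g y) \<Longrightarrow> ddir v f z = ddir v g z"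
  using ddir_cong[OF open_W] by blast

lemma D_commute: "smooth_on W (f :: 'z \<Rightarrow> 'b::euclidean_space) \<Longrightarrow> z \<in> W \<Longrightarrow>
   ddir v (ddir w f) z = ddir w (ddir v f) z"
  using ddir_commute open_W by blast

lemma sym_DG: "z \<in> W \<Longrightarrow> transpose (ddir v G z) = ddir v G z"
  using D_transpose[OF smooth_G, of z v] D_cong[of z "\<lambda>y. transpose (G y)" G v] sym_G by simp

lemma sym_DG_entry: "z \<in> W \<Longrightarrow> ddir v G z $ i $ j = ddir v G z $ j $ i"
  using sym_DG[of z v] by (simp add: vec_eq_iff transpose_def)

lemma G_conn: "z \<in> W \<Longrightarrow> G z ** \<Gamma> i z = conn_lower e G i z"
  by (simp add: conn_def matrix_mul_assoc HG)

lemma conn_G: "z \<in> W \<Longrightarrow> transpose (\<Gamma> i z) ** G z = transpose (conn_lower e G i z)"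
  using arg_cong[OF G_conn, of z transpose i] by (simp add: matrix_transpose_mul sym_G)

lemma metric_compatible:
  assumes z: "z \<in> W"
  shows "ddir (e i) G z = transpose (\<Gamma> i z) ** G z + G z ** \<Gamma> i z"
proof -
  have "transpose (conn_lower e G i z) + conn_lower e G i z = ddir (e i) G z"
    using sym_DG_entry[OF z] by (simp add: vec_eq_iff conn_lower_def transpose_def field_simps)
  then show ?thesis using conn_G[OF z] G_conn[OF z] by simp
qed

lemma torsion_free: "z \<in> W \<Longrightarrow> \<Gamma> i z $ k $ j = \<Gamma> j z $ k $ i"
proof -
  assume z: "z \<in> W"
  have "conn_lower e G i z $ l $ j = conn_lower e G j z $ l $ i" for l
    using sym_DG_entry[OF z, of "e l" i j] by (simp add: conn_lower_def)
  then show ?thesis by (simp add: conn_def matrix_matrix_mult_def)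
qed

lemma D_H:
  assumes z: "z \<in> W"
  shows "ddir (e m) H z = - (H z ** transpose (\<Gamma> m z)) - \<Gamma> m z ** H z"
proof -
  have "ddir (e m) H z = - (H z ** ddir (e m) G z ** H z)"
    using ddir_matrix_inv[OF smooth_G open_W inv_G z] .
  also have "H z ** ddir (e m) G z ** H z
      = H z ** transpose (\<Gamma> m z) ** (G z ** H z) + (H z ** G z) ** \<Gamma> m z ** H z"
    by (simp add: metric_compatible[OF z] matrix_simps)
  finally show ?thesis by (simp add: HG z)
qed

text \<open>Differentiate metric compatibility once more and antisymmetrize; the second derivatives of \<open>G\<close> cancel.\<close>

lemma curv_skew:
  assumes z: "z \<in> W"
  shows "G z ** R i j z = - (transpose (R i j z) ** G z)"
proof -
  have DD: "ddir (e i) (ddir (e j) G) z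
     = transpose (ddir (e i) (\<Gamma> j) z) ** G z + transpose (\<Gamma> j z) ** ddir (e i) G z
       + (ddir (e i) G z ** \<Gamma> j z + G z ** ddir (e i) (\<Gamma> j) z)" for i j
  proof -
    have "ddir (e i) (ddir (e j) G) z = ddir (e i) (\<lambda>y. transpose (\<Gamma> j y) ** G y + G y ** \<Gamma> j y) z"
      using metric_compatible by (intro D_cong[OF z]) auto
    also have "\<dots> = transpose (ddir (e i) (\<Gamma> j) z) ** G z + transpose (\<Gamma> j z) ** ddir (e i) G z
       + (ddir (e i) G z ** \<Gamma> j z + G z ** ddir (e i) (\<Gamma> j) z)"
      using z by (simp add: D_add D_mult D_transpose smooth_on_matrix_mult smooth_on_transpose smooth_conn smooth_G)
    finally show ?thesis .
  qed
  have "ddir (e i) (ddir (e j) G) z = ddir (e j) (ddir (e i) G) z"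
    by (rule D_commute[OF smooth_G z])
  then show ?thesis
    unfolding DD metric_compatible[OF z] conn_curv_def
    by (simp add: matrix_simps matrix_transpose_mul algebra_simps)
qed

lemma curv_swap: "R j i z = - R i j z"
  by (simp add: conn_curv_def)

lemma S_swap: "S j i z $ a $ b = - S i j z $ a $ b"
  by (simp add: S_def curv_swap[of j i])

lemma S_transpose:
  assumes z: "z \<in> W"
  shows "transpose (S i j z) = - S i j z"
proof -
  have "H z ** (G z ** R i j z) ** H z = - (H z ** (transpose (R i j z) ** G z) ** H z)"
    unfolding curv_skew[OF z] by simp
  then have "(H z ** G z) ** R i j z ** H z = - (H z ** transpose (R i j z) ** (G z ** H z))"
    by (simp add: matrix_mul_assoc)
  then have "R i j z ** H z = - (H z ** transpose (R i j z))" by (simp add: HG z)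
  also have "H z ** transpose (R i j z) = transpose (R i j z ** H z)"
    by (simp add: matrix_transpose_mul sym_H z)
  finally have "S i j z = - transpose (S i j z)" unfolding S_def .
  then show ?thesis by (metis add.inverse_inverse)
qed

lemma S_skew:
  assumes z: "z \<in> W"
  shows "S i j z $ b $ a = - S i j z $ a $ b"
  using arg_cong[OF S_transpose[OF z, of i j], of "\<lambda>A. A $ a $ b"] unfolding transpose_def by simp

text \<open>After the second derivatives of \<open>\<Gamma>\<close> cancel in pairs, what remains is the Jacobi identity for
commutators of matrices.\<close>

lemma second_bianchi:
  assumes z: "z \<in> W"
  shows "(ddir (e m) (R i j) z + \<Gamma> m z ** R i j z - R i j z ** \<Gamma> m z)
   + (ddir (e i) (R j m) z + \<Gamma> i z ** R j m z - R j m z ** \<Gamma> i z)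
   + (ddir (e j) (R m i) z + \<Gamma> j z ** R m i z - R m i z ** \<Gamma> j z) = 0"
proof -
  have D: "ddir (e m) (R i j) z = ddir (e m) (ddir (e i) (\<Gamma> j)) z - ddir (e m) (ddir (e j) (\<Gamma> i)) z
     + (ddir (e m) (\<Gamma> i) z ** \<Gamma> j z + \<Gamma> i z ** ddir (e m) (\<Gamma> j) z)
     - (ddir (e m) (\<Gamma> j) z ** \<Gamma> i z + \<Gamma> j z ** ddir (e m) (\<Gamma> i) z)" for i j m
    unfolding conn_curv_def[abs_def] using z
    by (simp add: D_add D_diff D_mult smooth_on_add smooth_on_diff smooth_on_matrix_mult smooth_conn smooth_ddir)
  have C: "ddir (e m) (ddir (e i) (\<Gamma> j)) z = ddir (e i) (ddir (e m) (\<Gamma> j)) z" for i j m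
    by (rule D_commute[OF smooth_conn z])
  show ?thesis
    unfolding D C[of m i j] C[of i j m] C[of j m i] conn_curv_def
    by (simp add: matrix_simps algebra_simps)
qed

text \<open>The covariant derivative of \<open>S i j\<close> in its two upper indices only. The correction terms for the form
indices are left out: \<open>\<Gamma>\<close> is torsion-free, so they cancel in the cyclic sum over \<open>m\<close>, \<open>i\<close>, \<open>j\<close>.\<close>

definition "DS m i j z = ddir (e m) (S i j) z + \<Gamma> m z ** S i j z + S i j z ** transpose (\<Gamma> m z)"

lemma DS_eq:
  assumes z: "z \<in> W"
  shows "DS m i j z = (ddir (e m) (R i j) z + \<Gamma> m z ** R i j z - R i j z ** \<Gamma> m z) ** H z"
  unfolding DS_def S_def[abs_def] D_mult[OF smooth_curv smooth_H z] D_H[OF z]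
  by (simp add: matrix_simps algebra_simps)

lemma DS_cyclic: "z \<in> W \<Longrightarrow> DS m i j z + DS i j m z + DS j m i z = 0"
  using second_bianchi[of z m i j] by (simp add: DS_eq flip: matrix_add_rdistrib')

lemma D_uminus: "smooth_on W f \<Longrightarrow> z \<in> W \<Longrightarrow> ddir v (\<lambda>y. - f y) z = - ddir v f z"
  by (intro ddir_bounded_linear bounded_linear_minus bounded_linear_ident differentiable)

lemma D_S_swap:
  assumes z: "z \<in> W"
  shows "ddir v (S j i) z = - ddir v (S i j) z"
proof -
  have "S j i = (\<lambda>y. - S i j y)" by (simp add: S_def fun_eq_iff curv_swap[of j i])
  then show ?thesis using D_uminus[OF smooth_S z, of v i j] by simp
qed

lemma D_S_skew:
  assumes z: "z \<in> W"
  shows "transpose (ddir v (S i j) z) = - ddir v (S i j) z"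
proof -
  have "transpose (ddir v (S i j) z) = ddir v (\<lambda>y. transpose (S i j y)) z"
    by (rule D_transpose[OF smooth_S z, symmetric])
  also have "\<dots> = ddir v (\<lambda>y. - S i j y) z"
    by (rule D_cong[OF z]) (rule S_transpose)
  finally show ?thesis by (simp only: D_uminus[OF smooth_S z])
qed

lemma D_S_skew_entry: "z \<in> W \<Longrightarrow> ddir v (S i j) z $ b $ a = - ddir v (S i j) z $ a $ b"
  using arg_cong[OF D_S_skew[of z v i j], of "\<lambda>A. A $ a $ b"] unfolding transpose_def by simp

lemma P_eq: "P z $ j $ b = (\<Sum>i\<in>UNIV. S i j z $ i $ b)"
proof -
  have "P z $ j $ b = (\<Sum>k\<in>UNIV. \<Sum>i\<in>UNIV. R i j z $ i $ k * H z $ k $ b)"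
    by (simp add: P_def ric_def matrix_matrix_mult_def sum_distrib_right)
  also have "\<dots> = (\<Sum>i\<in>UNIV. S i j z $ i $ b)"
    by (subst sum.swap) (simp add: S_def matrix_matrix_mult_def)
  finally show ?thesis .
qed

lemma P_eq': "z \<in> W \<Longrightarrow> P z $ j $ b = (\<Sum>i\<in>UNIV. S j i z $ b $ i)"
  unfolding P_eq by (rule sum.cong[OF refl]) (metis S_swap S_skew add.inverse_inverse)

lemma scal_eq: "scal e G z = (\<Sum>j\<in>UNIV. P z $ j $ j)"
  by (simp add: scal_def P_def trace_def)

lemma D_P:
  assumes z: "z \<in> W"
  shows "ddir v P z $ j $ b = (\<Sum>i\<in>UNIV. ddir v (S i j) z $ i $ b)"
proof -
  have "ddir v P z $ j $ b = ddir v (\<lambda>y. P y $ j $ b) z" by (rule D_entry[OF smooth_P z, symmetric])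
  also have "\<dots> = (\<Sum>i\<in>UNIV. ddir v (\<lambda>y. S i j y $ i $ b) z)"
    unfolding P_eq by (rule D_sum[OF smooth_on_entry[OF smooth_S] z])
  finally show ?thesis by (simp only: D_entry[OF smooth_S z])
qed

lemma D_scal:
  assumes z: "z \<in> W"
  shows "ddir v (scal e G) z = (\<Sum>j\<in>UNIV. ddir v P z $ j $ j)"
proof -
  have "ddir v (scal e G) z = (\<Sum>j\<in>UNIV. ddir v (\<lambda>y. P y $ j $ j) z)"
    unfolding scal_eq[abs_def] by (rule D_sum[OF smooth_on_entry[OF smooth_P] z])
  then show ?thesis by (simp only: D_entry[OF smooth_P z])
qed

text \<open>Trace the cyclic identity for \<open>DS\<close> over both pairs of indices. The three terms of the cyclic sum give
the derivative of the scalar curvature and twice the divergence of \<open>P\<close>; one of the connection terms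
pairs the symmetric \<open>\<Gamma>\<close> with the skew \<open>S\<close> and disappears.\<close>

lemma contracted_bianchi:
  assumes z: "z \<in> W"
  shows "ddir (e m) (scal e G) z + 2 * (\<Sum>i\<in>UNIV. \<Sum>k\<in>UNIV. \<Gamma> m z $ i $ k * P z $ i $ k)
    = 2 * (\<Sum>i\<in>UNIV. ddir (e i) P z $ m $ i) + 2 * (\<Sum>i\<in>UNIV. \<Sum>k\<in>UNIV. \<Gamma> i z $ i $ k * P z $ m $ k)"
proof -
  let ?s = "\<lambda>f. \<Sum>i\<in>UNIV. \<Sum>j\<in>(UNIV::'n set). f i j"
  have cyc: "?s (\<lambda>i j. DS m i j z $ i $ j) + ?s (\<lambda>i j. DS i j m z $ i $ j) + ?s (\<lambda>i j. DS j m i z $ i $ j) = 0"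
    using DS_cyclic[OF z, of m] by (simp add: vec_eq_iff flip: sum.distrib)
  \<comment> \<open>\<open>S\<close> is skew both in the form indices and as a matrix, so the last two traces agree.\<close>
  have "DS j m i z $ i $ j = DS j i m z $ j $ i" for i j
  proof -
    have sw: "S m i z = - S i m z" by (simp add: S_def curv_swap[of m i])
    have "DS j m i z = transpose (DS j i m z)"
      by (simp add: DS_def sw matrix_transpose_mul S_transpose[OF z] D_S_skew[OF z] D_S_swap[OF z, of "e j" m i])
    then show ?thesis by (simp add: transpose_def)
  qed
  then have "?s (\<lambda>i j. DS j m i z $ i $ j) = ?s (\<lambda>i j. DS j i m z $ j $ i)" by simp
  also have "\<dots> = ?s (\<lambda>i j. DS i j m z $ i $ j)" by (rule sum.swap)
  finally have cyc': "?s (\<lambda>i j. DS m i j z $ i $ j) + 2 * ?s (\<lambda>i j. DS i j m z $ i $ j) = 0"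
    using cyc by simp
  let ?A = "?s (\<lambda>i k. \<Gamma> m z $ i $ k * P z $ i $ k)"
  have 1: "?s (\<lambda>i j. DS m i j z $ i $ j) = ddir (e m) (scal e G) z + 2 * ?A"
  proof -
    have "?s (\<lambda>i j. (\<Gamma> m z ** S i j z) $ i $ j) = (\<Sum>i\<in>UNIV. \<Sum>j\<in>UNIV. \<Sum>k\<in>UNIV. \<Gamma> m z $ i $ k * S i j z $ k $ j)"
      by (simp add: matrix_matrix_mult_def)
    also have "\<dots> = (\<Sum>i\<in>UNIV. \<Sum>k\<in>UNIV. \<Sum>j\<in>UNIV. \<Gamma> m z $ i $ k * S i j z $ k $ j)"
      by (intro sum.cong refl sum.swap)
    also have "\<dots> = ?A" by (simp add: P_eq'[OF z] sum_distrib_left)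
    finally have a: "?s (\<lambda>i j. (\<Gamma> m z ** S i j z) $ i $ j) = ?A" .
    have "?s (\<lambda>i j. (S i j z ** transpose (\<Gamma> m z)) $ i $ j) = (\<Sum>j\<in>UNIV. \<Sum>i\<in>UNIV. \<Sum>k\<in>UNIV. \<Gamma> m z $ j $ k * S i j z $ i $ k)"
      by (subst sum.swap) (simp add: matrix_matrix_mult_def transpose_def mult.commute)
    also have "\<dots> = (\<Sum>j\<in>UNIV. \<Sum>k\<in>UNIV. \<Sum>i\<in>UNIV. \<Gamma> m z $ j $ k * S i j z $ i $ k)"
      by (intro sum.cong refl sum.swap)
    also have "\<dots> = ?A" by (simp add: P_eq sum_distrib_left)
    finally have b: "?s (\<lambda>i j. (S i j z ** transpose (\<Gamma> m z)) $ i $ j) = ?A" .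
    have "?s (\<lambda>i j. ddir (e m) (S i j) z $ i $ j) = ddir (e m) (scal e G) z"
      unfolding D_scal[OF z] D_P[OF z] by (rule sum.swap)
    with a b show ?thesis by (simp add: DS_def sum.distrib)
  qed
  have 2: "?s (\<lambda>i j. DS i j m z $ i $ j) = - (\<Sum>i\<in>UNIV. ddir (e i) P z $ m $ i)
       - ?s (\<lambda>i k. \<Gamma> i z $ i $ k * P z $ m $ k)"
  proof -
    have "?s (\<lambda>i j. (\<Gamma> i z ** S j m z) $ i $ j) = (\<Sum>i\<in>UNIV. \<Sum>j\<in>UNIV. \<Sum>k\<in>UNIV. \<Gamma> i z $ i $ k * S j m z $ k $ j)"
      by (simp add: matrix_matrix_mult_def)
    also have "\<dots> = (\<Sum>i\<in>UNIV. \<Sum>k\<in>UNIV. \<Sum>j\<in>UNIV. \<Gamma> i z $ i $ k * S j m z $ k $ j)"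
      by (intro sum.cong refl sum.swap)
    also have "\<dots> = - ?s (\<lambda>i k. \<Gamma> i z $ i $ k * P z $ m $ k)"
      by (simp add: P_eq'[OF z] S_swap[of _ m] sum_distrib_left sum_negf)
    finally have a: "?s (\<lambda>i j. (\<Gamma> i z ** S j m z) $ i $ j) = - ?s (\<lambda>i k. \<Gamma> i z $ i $ k * P z $ m $ k)" .
    let ?B = "\<Sum>j\<in>UNIV. ?s (\<lambda>i k. S j m z $ i $ k * \<Gamma> i z $ j $ k)"
    have "?B = (\<Sum>j\<in>UNIV. ?s (\<lambda>k i. S j m z $ i $ k * \<Gamma> i z $ j $ k))"
      by (intro sum.cong refl sum.swap)
    also have "\<dots> = (\<Sum>j\<in>UNIV. ?s (\<lambda>i k. S j m z $ k $ i * \<Gamma> i z $ j $ k))"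
      by (simp add: torsion_free[OF z])
    also have "\<dots> = (\<Sum>j\<in>UNIV. ?s (\<lambda>i k. - (S j m z $ i $ k * \<Gamma> i z $ j $ k)))"
      by (intro sum.cong refl) (metis S_skew[OF z] mult_minus_left)
    also have "\<dots> = - ?B" by (simp add: sum_negf)
    finally have "?B = 0" by simp
    moreover have "?s (\<lambda>i j. (S j m z ** transpose (\<Gamma> i z)) $ i $ j) = ?B"
      by (subst sum.swap) (simp add: matrix_matrix_mult_def transpose_def)
    ultimately have b: "?s (\<lambda>i j. (S j m z ** transpose (\<Gamma> i z)) $ i $ j) = 0" by simp
    have "?s (\<lambda>i j. ddir (e i) (S j m) z $ i $ j) = (\<Sum>i\<in>UNIV. - ddir (e i) P z $ m $ i)"
      unfolding D_P[OF z] sum_negf[symmetric] by (intro sum.cong refl) (rule D_S_skew_entry[OF z])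
    with a b show ?thesis by (simp add: DS_def sum.distrib sum_negf)
  qed
  show ?thesis using cyc' unfolding 1 2 by (simp add: algebra_simps)
qed

end

section \<open>Evolution of the scalar curvature\<close>

text \<open>The direction \<open>\<tau>\<close> is time. It commutes with the spatial derivatives since all are directional
derivatives along constant vectors.\<close>

locale flow_frame = metric_frame +
  fixes \<tau>
  assumes flow: "\<And>z. z \<in> W \<Longrightarrow> ddir \<tau> G z = (-2) *\<^sub>R ric e G z"
begin

text \<open>The time derivative of the connection, and the same with the last index raised. Unlike \<open>\<Gamma>\<close> itself
it is a tensor; only its two traces \<open>X\<close> and \<open>Y\<close> below enter the evolution of the scalar curvature.\<close>

definition "C i z = ddir \<tau> (\<Gamma> i) z"
definition "T i z = C i z ** H z"

text \<open>The flow equation makes \<open>Ric\<close> a multiple of the time derivative of the symmetric matrix \<open>G\<close>.\<close>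

lemma sym_Ric: "z \<in> W \<Longrightarrow> transpose (Ric z) = Ric z"
  using sym_DG[of z \<tau>] flow[of z] by simp

lemma sym_Ric_entry: "z \<in> W \<Longrightarrow> Ric z $ i $ j = Ric z $ j $ i"
  using arg_cong[OF sym_Ric, of z "\<lambda>A. A $ j $ i"] unfolding transpose_def by simp

lemma smooth_C: "smooth_on W (C i)"
  unfolding C_def[abs_def] by (intro smooth_ddir smooth_conn)

lemma smooth_T: "smooth_on W (T i)"
  unfolding T_def[abs_def] by (intro smooth_on_matrix_mult smooth_C smooth_H)

lemma Dt_H:
  assumes z: "z \<in> W"
  shows "ddir \<tau> H z = 2 *\<^sub>R (H z ** Ric z ** H z)"
  using ddir_matrix_inv[OF smooth_G open_W inv_G z, of \<tau>] by (simp add: flow[OF z])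

lemma C_torsion_free:
  assumes z: "z \<in> W"
  shows "C i z $ k $ j = C j z $ k $ i"
proof -
  have "ddir \<tau> (\<lambda>y. \<Gamma> i y $ k $ j) z = ddir \<tau> (\<lambda>y. \<Gamma> j y $ k $ i) z"
    by (rule D_cong[OF z]) (rule torsion_free)
  then show ?thesis by (simp only: D_entry[OF smooth_conn z] C_def)
qed

lemma Dt_DG:
  assumes z: "z \<in> W"
  shows "ddir \<tau> (ddir v G) z = (-2) *\<^sub>R ddir v Ric z"
proof -
  have "ddir \<tau> (ddir v G) z = ddir v (ddir \<tau> G) z" by (rule D_commute[OF smooth_G z])
  also have "\<dots> = ddir v (\<lambda>y. (-2) *\<^sub>R Ric y) z" by (rule D_cong[OF z]) (rule flow)
  also have "\<dots> = (-2) *\<^sub>R ddir v Ric z"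
    by (rule ddir_bounded_linear[OF bounded_linear_scaleR_right differentiable[OF smooth_ric z]])
  finally show ?thesis .
qed

lemma G_C:
  assumes z: "z \<in> W"
  shows "(G z ** C i z) $ l $ j = 2 * (Ric z ** \<Gamma> i z) $ l $ j
    - (ddir (e i) Ric z $ j $ l + ddir (e j) Ric z $ i $ l - ddir (e l) Ric z $ i $ j)"
proof -
  let ?f = "\<lambda>y. ddir (e i) G y $ j $ l + ddir (e j) G y $ i $ l - ddir (e l) G y $ i $ j"
  have sm: "smooth_on W (\<lambda>y. ddir v G y $ a $ b)" for v a b
    by (intro smooth_on_entry smooth_ddir smooth_G)
  have "(ddir \<tau> (\<lambda>y. G y ** \<Gamma> i y) z) $ l $ j = ddir \<tau> (\<lambda>y. (G y ** \<Gamma> i y) $ l $ j) z"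
    by (rule D_entry[symmetric, OF smooth_on_matrix_mult[OF smooth_G smooth_conn] z])
  also have "\<dots> = ddir \<tau> (\<lambda>y. (1/2) *\<^sub>R ?f y) z"
    by (rule D_cong[OF z]) (simp add: G_conn conn_lower_def)
  also have "\<dots> = (1/2) *\<^sub>R ddir \<tau> ?f z"
    by (intro ddir_bounded_linear[OF bounded_linear_scaleR_right] differentiable[OF _ z] smooth_on_add smooth_on_diff sm)
  also have "\<dots> = - (ddir (e i) Ric z $ j $ l + ddir (e j) Ric z $ i $ l - ddir (e l) Ric z $ i $ j)"
    by (simp add: D_diff D_add smooth_on_add sm z D_entry smooth_ddir smooth_G Dt_DG)
  finally have 1: "(ddir \<tau> (\<lambda>y. G y ** \<Gamma> i y) z) $ l $ j
     = - (ddir (e i) Ric z $ j $ l + ddir (e j) Ric z $ i $ l - ddir (e l) Ric z $ i $ j)" .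
  have "ddir \<tau> (\<lambda>y. G y ** \<Gamma> i y) z = (-2) *\<^sub>R (Ric z ** \<Gamma> i z) + G z ** C i z"
    by (simp add: D_mult[OF smooth_G smooth_conn z] flow[OF z] C_def)
  with 1 show ?thesis by simp
qed

lemma trace_conn:
  assumes z: "z \<in> W"
  shows "trace (\<Gamma> l z) = trace (H z ** ddir (e l) G z) / 2"
proof -
  have "H z ** ddir (e l) G z = H z ** (transpose (\<Gamma> l z) ** G z) + \<Gamma> l z"
    by (simp add: metric_compatible[OF z] matrix_add_ldistrib matrix_mul_assoc HG[OF z])
  moreover have "trace (H z ** (transpose (\<Gamma> l z) ** G z)) = trace (transpose (\<Gamma> l z) ** (G z ** H z))"
    by (subst trace_mul_sym) (simp add: matrix_mul_assoc)
  ultimately show ?thesis by (simp add: HG[OF z] trace_add trace_transpose)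
qed

lemma D_scal_trace:
  assumes z: "z \<in> W"
  shows "ddir v (scal e G) z = trace (H z ** ddir v Ric z) - trace (H z ** Ric z ** H z ** ddir v G z)"
proof -
  have "ddir v (scal e G) z = trace (ddir v Ric z ** H z + Ric z ** ddir v H z)"
    unfolding scal_def[abs_def]
    by (simp add: D_trace[OF smooth_on_matrix_mult[OF smooth_ric smooth_H] z] D_mult[OF smooth_ric smooth_H z])
  also have "ddir v H z = - (H z ** ddir v G z ** H z)"
    using ddir_matrix_inv[OF smooth_G open_W inv_G z] .
  finally have "ddir v (scal e G) z = trace (ddir v Ric z ** H z) - trace ((Ric z ** H z ** ddir v G z) ** H z)"
    by (simp add: trace_add trace_sub matrix_mul_assoc)
  moreover have "trace ((Ric z ** H z ** ddir v G z) ** H z) = trace (H z ** (Ric z ** H z ** ddir v G z))"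
    by (rule trace_mul_sym)
  ultimately show ?thesis by (simp add: matrix_mul_assoc trace_mul_sym[of "ddir v Ric z"])
qed

text \<open>By torsion-freeness the sum is the time derivative of \<open>trace (\<Gamma> l)\<close>, and \<open>trace (\<Gamma> l)\<close> is the derivative
of \<open>log (sqrt (det G))\<close>, which has time derivative \<open>- R\<close>.\<close>

lemma trace_C:
  assumes z: "z \<in> W"
  shows "(\<Sum>i\<in>UNIV. C i z $ i $ l) = - ddir (e l) (scal e G) z"
proof -
  have "(\<Sum>i\<in>UNIV. C i z $ i $ l) = trace (C l z)"
    unfolding trace_def by (simp add: C_torsion_free[OF z, of _ _ l])
  also have "\<dots> = ddir \<tau> (\<lambda>y. trace (\<Gamma> l y)) z"
    unfolding C_def by (rule D_trace[OF smooth_conn z, symmetric])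
  also have "\<dots> = ddir \<tau> (\<lambda>y. (1/2) *\<^sub>R trace (H y ** ddir (e l) G y)) z"
    by (rule D_cong[OF z]) (simp add: trace_conn)
  also have "\<dots> = (1/2) *\<^sub>R ddir \<tau> (\<lambda>y. trace (H y ** ddir (e l) G y)) z"
    by (intro ddir_bounded_linear[OF bounded_linear_scaleR_right] differentiable[OF _ z]
        smooth_on_trace smooth_on_matrix_mult smooth_H smooth_ddir smooth_G)
  also have "ddir \<tau> (\<lambda>y. trace (H y ** ddir (e l) G y)) z
      = trace (ddir \<tau> H z ** ddir (e l) G z + H z ** ddir \<tau> (ddir (e l) G) z)"
    by (simp add: D_trace[OF smooth_on_matrix_mult[OF smooth_H smooth_ddir[OF smooth_G]] z]
        D_mult[OF smooth_H smooth_ddir[OF smooth_G] z])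
  also have "\<dots> = 2 * trace (H z ** Ric z ** H z ** ddir (e l) G z) - 2 * trace (H z ** ddir (e l) Ric z)"
    by (simp add: Dt_H[OF z] Dt_DG[OF z] trace_add trace_sub)
  finally show ?thesis by (simp add: D_scal_trace[OF z])
qed

definition "X i z = (\<Sum>j\<in>UNIV. T j z $ i $ j)"
definition "Y j z = (\<Sum>i\<in>UNIV. T i z $ i $ j)"

lemma Y_eq:
  assumes z: "z \<in> W"
  shows "Y j z = - (\<Sum>l\<in>UNIV. ddir (e l) (scal e G) z * H z $ l $ j)"
proof -
  have "Y j z = (\<Sum>l\<in>UNIV. \<Sum>i\<in>UNIV. C i z $ i $ l * H z $ l $ j)"
    unfolding Y_def T_def matrix_matrix_mult_def vec_lambda_beta by (rule sum.swap)
  also have "\<dots> = (\<Sum>l\<in>UNIV. - ddir (e l) (scal e G) z * H z $ l $ j)"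
    unfolding sum_distrib_right[symmetric] trace_C[OF z] by simp
  finally show ?thesis by (simp add: sum_negf)
qed

text \<open>Lowering the index, \<open>X\<close> becomes \<open>\<nabla> R\<close> minus twice the divergence of \<open>Ric\<close>, which is zero by the
contracted Bianchi identity.\<close>

lemma X_eq_0:
  assumes z: "z \<in> W"
  shows "X i z = 0"
proof -
  let ?s = "\<lambda>f. \<Sum>i\<in>UNIV. \<Sum>j\<in>(UNIV::'b set). f i j"
  have sH: "H z $ a $ b = H z $ b $ a" for a b
    using arg_cong[OF sym_H[OF z], of "\<lambda>A. A $ b $ a"] unfolding transpose_def by simp
  have sDRic: "ddir v Ric z $ a $ b = ddir v Ric z $ b $ a" for v a b
  proof -
    have "ddir v (\<lambda>y. Ric y $ a $ b) z = ddir v (\<lambda>y. Ric y $ b $ a) z"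
      by (rule D_cong[OF z]) (rule sym_Ric_entry)
    then show ?thesis by (simp only: D_entry[OF smooth_ric z])
  qed
  let ?U = "\<lambda>m. ?s (\<lambda>i a. H z $ a $ i * ddir (e i) Ric z $ m $ a)"
  let ?V = "\<lambda>m. ?s (\<lambda>i b. (Ric z ** \<Gamma> i z) $ m $ b * H z $ b $ i)"
  let ?E = "\<lambda>m. ?s (\<lambda>j l. H z $ l $ j * ddir (e m) Ric z $ j $ l)"
  \<comment> \<open>The three sums are the contractions of \<open>Ric\<close> with \<open>\<Gamma>\<close> and of the two traces of \<open>\<partial> Ric\<close>.\<close>
  have lower: "(\<Sum>i\<in>UNIV. G z $ m $ i * X i z) = 2 * ?V m - 2 * ?U m + ?E m" for m
  proof -
    have "(\<Sum>i\<in>UNIV. G z $ m $ i * X i z) = (\<Sum>i\<in>UNIV. \<Sum>j\<in>UNIV. G z $ m $ i * T j z $ i $ j)"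
      by (simp add: X_def sum_distrib_left)
    also have "\<dots> = (\<Sum>j\<in>UNIV. (G z ** T j z) $ m $ j)"
      by (subst sum.swap) (simp add: matrix_matrix_mult_def)
    also have "\<dots> = ?s (\<lambda>j l. (G z ** C j z) $ m $ l * H z $ l $ j)"
      unfolding T_def matrix_mul_assoc by (simp add: matrix_matrix_mult_def[of _ "H z"])
    also have "\<dots> = ?s (\<lambda>j l. 2 * ((Ric z ** \<Gamma> j z) $ m $ l * H z $ l $ j)
        - (H z $ l $ j * ddir (e j) Ric z $ m $ l + H z $ j $ l * ddir (e l) Ric z $ m $ j - H z $ l $ j * ddir (e m) Ric z $ j $ l))"
      unfolding G_C[OF z]
      by (intro sum.cong refl) (simp only: sDRic[of _ _ m] sH, simp add: algebra_simps sH)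
    also have "\<dots> = 2 * ?V m - (?U m + ?s (\<lambda>j l. H z $ j $ l * ddir (e l) Ric z $ m $ j) - ?E m)"
      by (simp add: sum_subtractf sum.distrib sum_distrib_left)
    also have "?s (\<lambda>j l. H z $ j $ l * ddir (e l) Ric z $ m $ j) = ?U m" by (rule sum.swap)
    finally show ?thesis by simp
  qed
  have zero: "2 * ?V m - 2 * ?U m + ?E m = 0" for m
  proof -
    let ?A = "?s (\<lambda>i k. \<Gamma> m z $ i $ k * P z $ i $ k)"
    have ds: "ddir (e m) (scal e G) z = ?E m - 2 * ?A"
    proof -
      have "trace (H z ** ddir (e m) Ric z) = ?E m"
        by (subst trace_mul_sym) (simp add: trace_def matrix_matrix_mult_def mult.commute)
      moreover have "trace (H z ** Ric z ** H z ** ddir (e m) G z) = 2 * ?A"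
      proof -
        have "H z ** Ric z ** H z ** ddir (e m) G z
          = H z ** (Ric z ** H z ** transpose (\<Gamma> m z) ** G z) + H z ** Ric z ** (H z ** G z) ** \<Gamma> m z"
          by (simp add: metric_compatible[OF z] matrix_simps)
        moreover have "trace (H z ** (Ric z ** H z ** transpose (\<Gamma> m z) ** G z)) = trace (P z ** transpose (\<Gamma> m z))"
          by (subst trace_mul_sym) (simp add: matrix_mul_assoc[symmetric] HG[OF z] P_def)
        moreover have "trace (H z ** Ric z ** (H z ** G z) ** \<Gamma> m z) = trace (P z ** transpose (\<Gamma> m z))"
        proof -
          have "transpose (P z ** transpose (\<Gamma> m z)) = \<Gamma> m z ** (H z ** Ric z)"
            by (simp add: P_def matrix_transpose_mul sym_H[OF z] sym_Ric[OF z])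
          then have "trace (P z ** transpose (\<Gamma> m z)) = trace (\<Gamma> m z ** (H z ** Ric z))"
            by (metis trace_transpose)
          then show ?thesis using trace_mul_sym[of "\<Gamma> m z" "H z ** Ric z"] by (simp add: HG[OF z])
        qed
        moreover have "trace (P z ** transpose (\<Gamma> m z)) = ?A"
          by (simp add: trace_def matrix_matrix_mult_def transpose_def mult.commute)
        ultimately show ?thesis by (simp add: trace_add)
      qed
      ultimately show ?thesis by (simp add: D_scal_trace[OF z])
    qed
    let ?Q = "?s (\<lambda>i k. \<Gamma> i z $ i $ k * P z $ m $ k)"
    have dP: "(\<Sum>i\<in>UNIV. ddir (e i) P z $ m $ i) = ?U m - ?V m - ?Q"
    proof -
      have "ddir (e i) P z = ddir (e i) Ric z ** H z - P z ** transpose (\<Gamma> i z) - Ric z ** \<Gamma> i z ** H z" for i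
        unfolding P_def[abs_def] D_mult[OF smooth_ric smooth_H z] D_H[OF z]
        by (simp add: matrix_simps algebra_simps)
      moreover have "(\<Sum>i\<in>UNIV. (ddir (e i) Ric z ** H z) $ m $ i) = ?U m"
        by (simp add: matrix_matrix_mult_def mult.commute)
      moreover have "(\<Sum>i\<in>UNIV. (P z ** transpose (\<Gamma> i z)) $ m $ i) = ?Q"
        by (simp add: matrix_matrix_mult_def transpose_def mult.commute)
      moreover have "(\<Sum>i\<in>UNIV. (Ric z ** \<Gamma> i z ** H z) $ m $ i) = ?V m"
        by (simp add: matrix_matrix_mult_def[of _ "H z"])
      ultimately show ?thesis by (simp add: sum_subtractf)
    qed
    show ?thesis using contracted_bianchi[OF z, of m] unfolding ds dP by (simp add: algebra_simps)
  qed
  have "G z *v (\<chi> i. X i z) = 0"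
    using lower zero by (simp add: vec_eq_iff matrix_vector_mult_def)
  then have "(H z ** G z) *v (\<chi> i. X i z) = 0"
    by (simp flip: matrix_vector_mul_assoc)
  then show ?thesis by (simp add: HG[OF z] vec_eq_iff)
qed

text \<open>Differentiating the trace of \<open>S\<close> in time, the variation of the metric gives \<open>2 |Ric|\<^sup>2\<close> and the
variation of the connection gives the divergence of \<open>X - Y\<close>. Here \<open>X = 0\<close> and \<open>Y\<close> is minus the
gradient of \<open>R\<close>, so the divergence is the Laplacian. At a critical point only its second-order part
survives; such points suffice for the maximum principle.\<close>

lemma scal_evolution_critical:
  assumes z: "z \<in> W" and crit: "\<And>l. ddir (e l) (scal e G) z = 0"
  shows "ddir \<tau> (scal e G) z = (\<Sum>j\<in>UNIV. \<Sum>l\<in>UNIV. ddir (e j) (ddir (e l) (scal e G)) z * H z $ l $ j)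
    + 2 * trace (Ric z ** H z ** Ric z ** H z)"
proof -
  let ?s = "\<lambda>f. \<Sum>i\<in>UNIV. \<Sum>j\<in>(UNIV::'b set). f i j"
  define L where "L i j = ddir (e i) (T j) z + T j z ** transpose (\<Gamma> i z) + \<Gamma> i z ** T j z" for i j
  have DtR: "ddir \<tau> (R i j) z ** H z = L i j - L j i" for i j
  proof -
    have a: "ddir \<tau> (R i j) z = ddir \<tau> (ddir (e i) (\<Gamma> j)) z - ddir \<tau> (ddir (e j) (\<Gamma> i)) z
       + (C i z ** \<Gamma> j z + \<Gamma> i z ** C j z) - (C j z ** \<Gamma> i z + \<Gamma> j z ** C i z)"
      unfolding conn_curv_def[abs_def] C_def using z
      by (simp add: D_add D_diff D_mult smooth_on_add smooth_on_diff smooth_on_matrix_mult smooth_conn smooth_ddir)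
    have b: "ddir \<tau> (ddir (e i) (\<Gamma> j)) z = ddir (e i) (C j) z" for i j
      unfolding C_def[abs_def] by (rule D_commute[OF smooth_conn z])
    have c: "L i j = (ddir (e i) (C j) z + \<Gamma> i z ** C j z - C j z ** \<Gamma> i z) ** H z" for i j
      unfolding L_def T_def[abs_def] D_mult[OF smooth_C smooth_H z] D_H[OF z]
      by (simp add: matrix_simps algebra_simps)
    show ?thesis unfolding a b c by (simp add: matrix_simps algebra_simps)
  qed
  let ?Q = "\<Sum>j\<in>UNIV. ?s (\<lambda>i k. T j z $ i $ k * \<Gamma> i z $ j $ k)"
  have DX: "(\<Sum>j\<in>UNIV. ddir (e i) (T j) z $ i $ j) = 0" for i
  proof -
    have "(\<Sum>j\<in>UNIV. ddir (e i) (T j) z $ i $ j) = ddir (e i) (X i) z"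
      unfolding X_def[abs_def] D_sum[OF smooth_on_entry[OF smooth_T] z] D_entry[OF smooth_T z] ..
    also have "\<dots> = ddir (e i) (\<lambda>y. 0) z" by (rule D_cong[OF z]) (rule X_eq_0)
    finally show ?thesis by (simp add: ddir_const)
  qed
  have 1: "?s (\<lambda>i j. L i j $ i $ j) = ?Q"
  proof -
    have "?s (\<lambda>i j. (\<Gamma> i z ** T j z) $ i $ j) = (\<Sum>i\<in>UNIV. \<Sum>j\<in>UNIV. \<Sum>k\<in>UNIV. \<Gamma> i z $ i $ k * T j z $ k $ j)"
      by (simp add: matrix_matrix_mult_def)
    also have "\<dots> = (\<Sum>i\<in>UNIV. \<Sum>k\<in>UNIV. \<Sum>j\<in>UNIV. \<Gamma> i z $ i $ k * T j z $ k $ j)"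
      by (intro sum.cong refl sum.swap)
    also have "\<dots> = 0" using X_eq_0[OF z] by (simp add: X_def flip: sum_distrib_left)
    finally have a: "?s (\<lambda>i j. (\<Gamma> i z ** T j z) $ i $ j) = 0" .
    have b: "?s (\<lambda>i j. (T j z ** transpose (\<Gamma> i z)) $ i $ j) = ?Q"
      by (subst sum.swap) (simp add: matrix_matrix_mult_def transpose_def)
    from a b show ?thesis unfolding L_def by (simp add: sum.distrib DX)
  qed
  have DY: "(\<Sum>i\<in>UNIV. ddir (e j) (T i) z $ i $ j) = - (\<Sum>l\<in>UNIV. ddir (e j) (ddir (e l) (scal e G)) z * H z $ l $ j)" for j
  proof -
    have "(\<Sum>i\<in>UNIV. ddir (e j) (T i) z $ i $ j) = ddir (e j) (Y j) z"
      unfolding Y_def[abs_def] D_sum[OF smooth_on_entry[OF smooth_T] z] D_entry[OF smooth_T z] ..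
    also have "\<dots> = ddir (e j) (\<lambda>y. - (\<Sum>l\<in>UNIV. ddir (e l) (scal e G) y * H y $ l $ j)) z"
      by (rule D_cong[OF z]) (rule Y_eq)
    also have "\<dots> = - (\<Sum>l\<in>UNIV. ddir (e j) (\<lambda>y. ddir (e l) (scal e G) y * H y $ l $ j) z)"
      by (subst D_uminus[OF smooth_on_sum z], intro smooth_on_mult smooth_ddir smooth_scal smooth_on_entry smooth_H)
        (subst D_sum[OF _ z], auto intro!: smooth_on_mult smooth_ddir smooth_scal smooth_on_entry smooth_H)
    also have "\<dots> = - (\<Sum>l\<in>UNIV. ddir (e j) (ddir (e l) (scal e G)) z * H z $ l $ j)"
      by (subst ddir_bilinear[OF bounded_bilinear_mult differentiable[OF smooth_ddir[OF smooth_scal] z]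
        differentiable[OF smooth_on_entry[OF smooth_H] z]]) (simp add: crit)
    finally show ?thesis .
  qed
  have 2: "?s (\<lambda>i j. L j i $ i $ j) = - ?s (\<lambda>j l. ddir (e j) (ddir (e l) (scal e G)) z * H z $ l $ j) + ?Q"
  proof -
    have "?s (\<lambda>i j. (T i z ** transpose (\<Gamma> j z)) $ i $ j) = (\<Sum>j\<in>UNIV. \<Sum>i\<in>UNIV. \<Sum>k\<in>UNIV. \<Gamma> j z $ j $ k * T i z $ i $ k)"
      by (subst sum.swap) (simp add: matrix_matrix_mult_def transpose_def mult.commute)
    also have "\<dots> = (\<Sum>j\<in>UNIV. \<Sum>k\<in>UNIV. \<Sum>i\<in>UNIV. \<Gamma> j z $ j $ k * T i z $ i $ k)"
      by (intro sum.cong refl sum.swap)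
    also have "\<dots> = (\<Sum>j\<in>UNIV. \<Sum>k\<in>UNIV. \<Gamma> j z $ j $ k * Y k z)"
      by (simp add: Y_def sum_distrib_left)
    also have "\<dots> = 0" by (simp add: Y_eq[OF z] crit)
    finally have a: "?s (\<lambda>i j. (T i z ** transpose (\<Gamma> j z)) $ i $ j) = 0" .
    have "?s (\<lambda>i j. (\<Gamma> j z ** T i z) $ i $ j) = (\<Sum>i\<in>UNIV. \<Sum>j\<in>UNIV. \<Sum>k\<in>UNIV. T i z $ k $ j * \<Gamma> k z $ i $ j)"
      by (simp add: matrix_matrix_mult_def torsion_free[OF z, of _ _ _] mult.commute)
    also have "\<dots> = ?Q" by (intro sum.cong refl sum.swap)
    finally have b: "?s (\<lambda>i j. (\<Gamma> j z ** T i z) $ i $ j) = ?Q" .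
    have "?s (\<lambda>i j. ddir (e j) (T i) z $ i $ j) = - ?s (\<lambda>j l. ddir (e j) (ddir (e l) (scal e G)) z * H z $ l $ j)"
      unfolding sum_negf[symmetric] by (subst sum.swap) (simp add: DY sum_negf)
    with a b show ?thesis unfolding L_def by (simp add: sum.distrib)
  qed
  have DtS: "ddir \<tau> (S i j) z = L i j - L j i + 2 *\<^sub>R (R i j z ** (H z ** Ric z ** H z))" for i j
    unfolding S_def[abs_def] D_mult[OF smooth_curv smooth_H z] by (simp add: DtR Dt_H[OF z])
  have 3: "?s (\<lambda>i j. (R i j z ** B) $ i $ j) = trace (Ric z ** B)" for B
  proof -
    have "trace (Ric z ** B) = (\<Sum>j\<in>UNIV. \<Sum>k\<in>UNIV. \<Sum>i\<in>UNIV. R i j z $ i $ k * B $ k $ j)"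
      by (simp add: trace_def matrix_matrix_mult_def ric_def sum_distrib_right)
    also have "\<dots> = (\<Sum>j\<in>UNIV. \<Sum>i\<in>UNIV. \<Sum>k\<in>UNIV. R i j z $ i $ k * B $ k $ j)"
      by (intro sum.cong refl sum.swap)
    also have "\<dots> = (\<Sum>j\<in>UNIV. \<Sum>i\<in>UNIV. (R i j z ** B) $ i $ j)"
      by (simp add: matrix_matrix_mult_def)
    also have "\<dots> = ?s (\<lambda>i j. (R i j z ** B) $ i $ j)" by (rule sum.swap)
    finally show ?thesis by simp
  qed
  have "ddir \<tau> (scal e G) z = ?s (\<lambda>j i. ddir \<tau> (S i j) z $ i $ j)"
    by (simp only: D_scal[OF z] D_P[OF z])
  also have "\<dots> = ?s (\<lambda>i j. ddir \<tau> (S i j) z $ i $ j)" by (rule sum.swap)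
  also have "\<dots> = ?s (\<lambda>i j. L i j $ i $ j) - ?s (\<lambda>i j. L j i $ i $ j)
      + 2 * ?s (\<lambda>i j. (R i j z ** (H z ** Ric z ** H z)) $ i $ j)"
    by (simp add: DtS sum.distrib sum_subtractf sum_distrib_left)
  finally show ?thesis unfolding 1 2 3 by (simp add: matrix_mul_assoc)
qed

end

section \<open>Naturality of the Ricci curvature\<close>

context metric_frame
begin

text \<open>A metric torsion-free connection is determined by the Koszul formula.\<close>

lemma conn_unique:
  assumes z: "z \<in> W"
    and compat: "\<And>i. ddir (e i) G z = transpose (\<omega> i) ** G z + G z ** \<omega> i"
    and tors: "\<And>i j k. \<omega> i $ k $ j = \<omega> j $ k $ i"
  shows "\<Gamma> i z = \<omega> i"
proof -
  define N where "N i = G z ** \<omega> i" for i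
  have N: "N i $ l $ j = N j $ l $ i" for i j l
    by (simp add: N_def matrix_matrix_mult_def tors[of i _ j])
  have "ddir (e i) G z = transpose (N i) + N i" for i
    by (simp add: compat N_def matrix_transpose_mul sym_G[OF z])
  then have D: "ddir (e i) G z $ l $ j = N i $ j $ l + N i $ l $ j" for i l j
    by (simp add: transpose_def)
  have "conn_lower e G i z $ l $ j = N i $ l $ j" for l j
    unfolding conn_lower_def vec_lambda_beta D
    using N[of j l i] N[of i j l] N[of j i l] by simp
  then have "conn_lower e G i z = N i" by (simp add: vec_eq_iff)
  then show ?thesis by (simp add: conn_def N_def matrix_mul_assoc HG[OF z])
qed

text \<open>Two connections related by a gauge transformation \<open>J\<close> have conjugate curvatures: differentiate the
relation, substitute it back for the first derivatives of \<open>J\<close> and antisymmetrize.\<close>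

lemma gauge_curvature:
  assumes J: "smooth_on W J" and \<omega>: "\<And>i. smooth_on W (\<omega> i)" and A: "\<And>i. smooth_on W (A i)"
    and eq: "\<And>i z. z \<in> W \<Longrightarrow> J z ** \<omega> i z = ddir (e i) J z + A i z ** J z"
    and z: "z \<in> W"
  shows "(J z :: real^'n^'n) ** conn_curv e \<omega> i j z = conn_curv e A i j z ** J z"
proof -
  have DJ: "ddir (e i) J z = J z ** \<omega> i z - A i z ** J z" for i
    using eq[OF z] by (simp add: algebra_simps)
  have k: "(J z ** \<omega> i z - A i z ** J z) ** \<omega> j z + J z ** ddir (e i) (\<omega> j) z
     = ddir (e i) (ddir (e j) J) z + (ddir (e i) (A j) z ** J z + A j z ** (J z ** \<omega> i z - A i z ** J z))" for i j
  proof -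
    have "ddir (e i) (\<lambda>y. J y ** \<omega> j y) z = ddir (e i) (\<lambda>y. ddir (e j) J y + A j y ** J y) z"
      by (rule D_cong[OF z]) (rule eq)
    then show ?thesis
      using z by (simp add: D_add D_mult smooth_on_matrix_mult J \<omega> A smooth_ddir DJ)
  qed
  have s: "ddir (e i) (ddir (e j) J) z = ddir (e j) (ddir (e i) J) z" by (rule D_commute[OF J z])
  show ?thesis using k[of i j] k[of j i] unfolding s conn_curv_def
    by (simp add: matrix_simps algebra_simps)
qed

lemma matrix_inv_scaled: "c \<noteq> 0 \<Longrightarrow> z \<in> W \<Longrightarrow> matrix_inv (c *\<^sub>R G z) = (1 / c) *\<^sub>R H z"
  by (rule matrix_inv_unique) (simp add: HG)

lemma ric_scaled:
  assumes c: "c > 0" and z: "z \<in> W"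
  shows "ric e (\<lambda>z. c *\<^sub>R G z) z = ric e G z"
proof -
  have eq: "conn e (\<lambda>z. c *\<^sub>R G z) i y = \<Gamma> i y" if y: "y \<in> W" for i y
  proof -
    have "ddir v (\<lambda>z. c *\<^sub>R G z) y = c *\<^sub>R ddir v G y" for v
      by (rule ddir_bounded_linear[OF bounded_linear_scaleR_right differentiable[OF smooth_G y]])
    then have "conn_lower e (\<lambda>z. c *\<^sub>R G z) i y = c *\<^sub>R conn_lower e G i y"
      by (simp add: conn_lower_def vec_eq_iff algebra_simps)
    then show ?thesis using c by (simp add: conn_def matrix_inv_scaled[OF _ y])
  qed
  have "ddir v (conn e (\<lambda>z. c *\<^sub>R G z) j) z = ddir v (\<Gamma> j) z" for v j
    by (rule D_cong[OF z]) (rule eq)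
  then have "conn_curv e (conn e (\<lambda>z. c *\<^sub>R G z)) i j z = R i j z" for i j
    unfolding conn_curv_def by (simp add: eq[OF z])
  then show ?thesis by (simp add: ric_def)
qed

lemma scal_scaled: "c > 0 \<Longrightarrow> z \<in> W \<Longrightarrow> scal e (\<lambda>z. c *\<^sub>R G z) z = scal e G z / c"
  by (simp add: scal_def ric_scaled matrix_inv_scaled)

end

lemma ddir_axis_expand:
  fixes f :: "real^'n \<Rightarrow> 'b::real_normed_vector"
  assumes "f differentiable (at x)"
  shows "ddir v f x = (\<Sum>p\<in>UNIV. v $ p *\<^sub>R ddir (axis p 1) f x)"
proof -
  have "v = (\<Sum>p\<in>UNIV. v $ p *\<^sub>R axis p 1)"
    using basis_expansion[of v] by (simp add: scalar_mult_eq_scaleR)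
  then have "ddir v f x = ddir (\<Sum>p\<in>UNIV. v $ p *\<^sub>R axis p 1) f x" by simp
  also have "\<dots> = (\<Sum>p\<in>UNIV. v $ p *\<^sub>R ddir (axis p 1) f x)"
    using linear_sum[OF ddir_linear[OF assms], of "\<lambda>p. v $ p *\<^sub>R axis p 1" UNIV]
      linear_cmul[OF ddir_linear[OF assms]] by simp
  finally show ?thesis .
qed

abbreviation coord_frame :: "'n::finite \<Rightarrow> real^'n" where
  "coord_frame i \<equiv> axis i 1"

lemma jacobian_entry:
  "jacobian F (at x) $ m $ k = ddir (coord_frame k) F x $ m"
  by (simp add: jacobian_def matrix_def ddir_def)

text \<open>The Jacobian of \<open>F\<close> is invertible because \<open>h\<close> is nondegenerate. Curvature only involves values and
derivatives at single points, so this pointwise relation is all that naturality is about.\<close>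

locale metric_pullback =
  h: metric_frame U coord_frame h + g: metric_frame V coord_frame g
  for U V :: "(real^'n::finite) set" and h g +
  fixes F :: "real^'n \<Rightarrow> real^'n"
  assumes smooth_F: "smooth_on U F" and maps: "F ` U \<subseteq> V"
    and pullback: "\<And>x. x \<in> U \<Longrightarrow> h x = transpose (jacobian F (at x)) ** g (F x) ** jacobian F (at x)"
begin

definition "J x = jacobian F (at x)"

lemma J_entry: "J x $ m $ k = ddir (coord_frame k) F x $ m"
  by (simp add: J_def jacobian_entry)

lemma J_eq: "J = (\<lambda>x. \<chi> m k. ddir (coord_frame k) F x $ m)"
  by (simp add: fun_eq_iff vec_eq_iff J_entry)

lemma F_in: "x \<in> U \<Longrightarrow> F x \<in> V" using maps by blast

lemma smooth_J: "smooth_on U J"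
  unfolding J_eq
  by (intro smooth_on_matrixI smooth_on_bounded_linear[OF bounded_linear_vec_nth] h.smooth_ddir smooth_F)

lemma h_eq: "x \<in> U \<Longrightarrow> h x = transpose (J x) ** g (F x) ** J x"
  by (simp add: J_def pullback)

lemma inv_J:
  assumes x: "x \<in> U"
  shows "invertible (J x)"
proof -
  have "det (h x) = det (J x) * det (g (F x)) * det (J x)"
    unfolding h_eq[OF x] by (simp add: det_mul det_transpose)
  moreover have "det (h x) > 0" using pos_def_det_pos h.pos_G x by blast
  ultimately show ?thesis by (auto simp: invertible_det_nz)
qed

lemma smooth_comp: "smooth_on V f \<Longrightarrow> smooth_on U (\<lambda>x. f (F x))"
  by (rule smooth_on_compose[OF h.open_W g.open_W maps smooth_F])

lemma D_comp:
  assumes f: "smooth_on V f" and x: "x \<in> U"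
  shows "ddir (coord_frame i) (\<lambda>x. f (F x)) x = (\<Sum>p\<in>UNIV. J x $ p $ i *\<^sub>R ddir (coord_frame p) f (F x))"
proof -
  have d: "f differentiable (at (F x))" using g.differentiable[OF f F_in[OF x]] .
  have "ddir (coord_frame i) (\<lambda>x. f (F x)) x = ddir (ddir (coord_frame i) F x) f (F x)"
    by (rule ddir_compose[OF h.differentiable[OF smooth_F x] d])
  then show ?thesis unfolding ddir_axis_expand[OF d, of "ddir (coord_frame i) F x"] J_entry .
qed

text \<open>The connection form of \<open>g\<close> pulled back by \<open>F\<close>, before the change of frame by \<open>J\<close>.\<close>

definition "A i x = (\<Sum>p\<in>UNIV. J x $ p $ i *\<^sub>R g.\<Gamma> p (F x))"

lemma smooth_A: "smooth_on U (A i)"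
  unfolding A_def[abs_def]
  by (intro smooth_on_sum smooth_on_scaleR smooth_on_entry smooth_J smooth_comp g.smooth_conn)

lemma DJ_sym:
  assumes x: "x \<in> U"
  shows "ddir (coord_frame i) J x $ m $ j = ddir (coord_frame j) J x $ m $ i"
proof -
  have "ddir (coord_frame i) J x $ m $ j = ddir (coord_frame i) (ddir (coord_frame j) F) x $ m" for i j
    unfolding h.D_entry[OF smooth_J x, symmetric] J_entry
    by (rule ddir_bounded_linear[OF bounded_linear_vec_nth h.differentiable[OF h.smooth_ddir[OF smooth_F] x]])
  then show ?thesis using h.D_commute[OF smooth_F x] by metis
qed

text \<open>The gauge transform of the pulled-back form is torsion-free, since the second derivatives of \<open>F\<close>
are symmetric, and compatible with \<open>h\<close>. So it is the Levi-Civita connection of \<open>h\<close>.\<close>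

lemma conn_pullback:
  assumes x: "x \<in> U"
  shows "J x ** h.\<Gamma> i x = ddir (coord_frame i) J x + A i x ** J x"
proof -
  define \<omega> where "\<omega> i = matrix_inv (J x) ** (ddir (coord_frame i) J x + A i x ** J x)" for i
  have J\<omega>: "J x ** \<omega> i = ddir (coord_frame i) J x + A i x ** J x" for i
    by (simp add: \<omega>_def matrix_mul_assoc matrix_inv_mult[OF inv_J[OF x]])
  have Dg: "ddir (coord_frame i) (\<lambda>x. g (F x)) x = transpose (A i x) ** g (F x) + g (F x) ** A i x" for i
  proof -
    have "transpose (A i x) = (\<Sum>p\<in>UNIV. J x $ p $ i *\<^sub>R transpose (g.\<Gamma> p (F x)))"
      unfolding A_def linear_sum[OF bounded_linear.linear[OF bounded_linear_transpose]] by simp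
    then have "transpose (A i x) ** g (F x) = (\<Sum>p\<in>UNIV. J x $ p $ i *\<^sub>R (transpose (g.\<Gamma> p (F x)) ** g (F x)))"
      by (simp add: matrix_sum_lmult)
    moreover have "g (F x) ** A i x = (\<Sum>p\<in>UNIV. J x $ p $ i *\<^sub>R (g (F x) ** g.\<Gamma> p (F x)))"
      by (simp add: A_def matrix_sum_rmult)
    ultimately show ?thesis
      unfolding D_comp[OF g.smooth_G x] g.metric_compatible[OF F_in[OF x]]
      by (simp add: scaleR_add_right sum.distrib)
  qed
  have "h.\<Gamma> i x = \<omega> i"
  proof (rule h.conn_unique[OF x])
    fix i
    have "ddir (coord_frame i) h x = ddir (coord_frame i) (\<lambda>x. transpose (J x) ** g (F x) ** J x) x"
      by (rule h.D_cong[OF x]) (rule h_eq)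
    also have "\<dots> = transpose (ddir (coord_frame i) J x + A i x ** J x) ** g (F x) ** J x
        + transpose (J x) ** g (F x) ** (ddir (coord_frame i) J x + A i x ** J x)"
      using x by (simp add: h.D_mult h.D_transpose smooth_on_matrix_mult smooth_on_transpose smooth_J
          smooth_comp g.smooth_G Dg matrix_simps matrix_transpose_mul algebra_simps)
    also have "\<dots> = transpose (\<omega> i) ** h x + h x ** \<omega> i"
      unfolding J\<omega>[symmetric] h_eq[OF x] by (simp add: matrix_transpose_mul matrix_mul_assoc)
    finally show "ddir (coord_frame i) h x = transpose (\<omega> i) ** h x + h x ** \<omega> i" .
  next
    fix i j k
    have AJ: "(A i x ** J x) $ m $ j = (\<Sum>q\<in>UNIV. \<Sum>p\<in>UNIV. J x $ p $ i * g.\<Gamma> p (F x) $ m $ q * J x $ q $ j)" for i j m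
      by (simp add: A_def matrix_matrix_mult_def sum_distrib_right)
    have "(A i x ** J x) $ m $ j = (A j x ** J x) $ m $ i" for m
      unfolding AJ by (subst sum.swap) (simp add: g.torsion_free[OF F_in[OF x]] mult_ac)
    then show "\<omega> i $ k $ j = \<omega> j $ k $ i"
      by (simp add: \<omega>_def matrix_matrix_mult_def[of "matrix_inv (J x)"] DJ_sym[OF x, of i _ j])
  qed
  then show ?thesis by (simp add: J\<omega>)
qed

lemma curv_A:
  assumes x: "x \<in> U"
  shows "conn_curv coord_frame A i j x = (\<Sum>p\<in>UNIV. \<Sum>q\<in>UNIV. (J x $ p $ i * J x $ q $ j) *\<^sub>R g.R p q (F x))"
proof -
  let ?G = "\<lambda>p. g.\<Gamma> p (F x)"
  let ?s = "\<lambda>f. \<Sum>p\<in>UNIV. \<Sum>q\<in>UNIV. (J x $ p $ i * J x $ q $ j) *\<^sub>R f p q"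
  have DA: "ddir (coord_frame i) (A j) x = (\<Sum>q\<in>UNIV. ddir (coord_frame i) J x $ q $ j *\<^sub>R ?G q)
     + (\<Sum>q\<in>UNIV. \<Sum>p\<in>UNIV. (J x $ q $ j * J x $ p $ i) *\<^sub>R ddir (coord_frame p) (g.\<Gamma> q) (F x))" for i j
  proof -
    have "ddir (coord_frame i) (A j) x = (\<Sum>q\<in>UNIV. ddir (coord_frame i) (\<lambda>x. J x $ q $ j *\<^sub>R g.\<Gamma> q (F x)) x)"
      unfolding A_def[abs_def]
      by (intro h.D_sum[OF _ x] smooth_on_scaleR smooth_on_entry smooth_J smooth_comp g.smooth_conn)
    also have "\<dots> = (\<Sum>q\<in>UNIV. ddir (coord_frame i) J x $ q $ j *\<^sub>R ?G q
        + J x $ q $ j *\<^sub>R (\<Sum>p\<in>UNIV. J x $ p $ i *\<^sub>R ddir (coord_frame p) (g.\<Gamma> q) (F x)))"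
      by (intro sum.cong refl)
        (simp only: ddir_bilinear[OF bounded_bilinear_scaleR h.differentiable[OF smooth_on_entry[OF smooth_J] x]
          h.differentiable[OF smooth_comp[OF g.smooth_conn] x]] h.D_entry[OF smooth_J x] D_comp[OF g.smooth_conn x])
    finally show ?thesis by (simp add: sum.distrib scaleR_sum_right)
  qed
  have AA: "A i x ** A j x = (\<Sum>p\<in>UNIV. \<Sum>q\<in>UNIV. (J x $ p $ i * J x $ q $ j) *\<^sub>R (?G p ** ?G q))" for i j
    unfolding A_def matrix_sum_lmult unfolding matrix_sum_rmult by (simp add: mult.commute)
  have 1: "ddir (coord_frame i) (A j) x - ddir (coord_frame j) (A i) x
     = ?s (\<lambda>p q. ddir (coord_frame p) (g.\<Gamma> q) (F x)) - ?s (\<lambda>p q. ddir (coord_frame q) (g.\<Gamma> p) (F x))"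
  proof -
    have "(\<Sum>q\<in>UNIV. \<Sum>p\<in>UNIV. (J x $ q $ j * J x $ p $ i) *\<^sub>R ddir (coord_frame p) (g.\<Gamma> q) (F x))
      = ?s (\<lambda>p q. ddir (coord_frame p) (g.\<Gamma> q) (F x))"
      by (subst sum.swap) (simp add: mult.commute)
    then show ?thesis unfolding DA by (simp add: DJ_sym[OF x, of i _ j])
  qed
  have 2: "A j x ** A i x = ?s (\<lambda>p q. ?G q ** ?G p)"
    unfolding AA by (subst sum.swap) (simp add: mult.commute)
  have "conn_curv coord_frame A i j x = ?s (\<lambda>p q. ddir (coord_frame p) (g.\<Gamma> q) (F x))
     - ?s (\<lambda>p q. ddir (coord_frame q) (g.\<Gamma> p) (F x)) + ?s (\<lambda>p q. ?G p ** ?G q) - ?s (\<lambda>p q. ?G q ** ?G p)"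
    unfolding conn_curv_def[of _ A] 1 2 by (simp only: AA)
  also have "\<dots> = ?s (\<lambda>p q. g.R p q (F x))"
    by (simp add: conn_curv_def scaleR_diff_right scaleR_add_right sum.distrib sum_subtractf)
  finally show ?thesis .
qed

lemma ric_pullback:
  assumes x: "x \<in> U"
  shows "ric coord_frame h x = transpose (J x) ** ric coord_frame g (F x) ** J x"
proof -
  have JJ: "J x ** matrix_inv (J x) = mat 1" "matrix_inv (J x) ** J x = mat 1"
    using matrix_inv_mult[OF inv_J[OF x]] by auto
  have "matrix_inv (J x) ** (J x ** h.R i j x) = matrix_inv (J x) ** (conn_curv coord_frame A i j x ** J x)" for i j
    by (subst h.gauge_curvature[OF smooth_J h.smooth_conn smooth_A conn_pullback x]) auto
  then have Rh: "h.R i j x = matrix_inv (J x) ** conn_curv coord_frame A i j x ** J x" for i j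
    by (simp add: matrix_mul_assoc JJ)
  have "ric coord_frame h x $ j $ k = (transpose (J x) ** ric coord_frame g (F x) ** J x) $ j $ k" for j k
  proof -
    have "ric coord_frame h x $ j $ k
      = (\<Sum>i\<in>UNIV. \<Sum>p\<in>UNIV. \<Sum>q\<in>UNIV. (J x $ p $ i * J x $ q $ j) * (matrix_inv (J x) ** (g.R p q (F x) ** J x)) $ i $ k)"
      unfolding ric_def[of _ h] Rh curv_A[OF x] matrix_sum_lmult matrix_sum_rmult
      by (simp add: matrix_mul_assoc)
    also have "\<dots> = (\<Sum>p\<in>UNIV. \<Sum>i\<in>UNIV. \<Sum>q\<in>UNIV. (J x $ p $ i * J x $ q $ j) * (matrix_inv (J x) ** (g.R p q (F x) ** J x)) $ i $ k)"
      by (rule sum.swap)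
    also have "\<dots> = (\<Sum>p\<in>UNIV. \<Sum>q\<in>UNIV. \<Sum>i\<in>UNIV. (J x $ p $ i * J x $ q $ j) * (matrix_inv (J x) ** (g.R p q (F x) ** J x)) $ i $ k)"
      by (intro sum.cong refl sum.swap)
    also have "\<dots> = (\<Sum>p\<in>UNIV. \<Sum>q\<in>UNIV. J x $ q $ j * (J x ** (matrix_inv (J x) ** (g.R p q (F x) ** J x))) $ p $ k)"
      by (simp add: matrix_matrix_mult_def[of "J x"] sum_distrib_left mult_ac)
    also have "\<dots> = (\<Sum>p\<in>UNIV. \<Sum>q\<in>UNIV. J x $ q $ j * (g.R p q (F x) ** J x) $ p $ k)"
      by (simp add: matrix_mul_assoc JJ)
    also have "\<dots> = (\<Sum>q\<in>UNIV. J x $ q $ j * (\<Sum>p\<in>UNIV. (g.R p q (F x) ** J x) $ p $ k))"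
      by (subst sum.swap) (simp add: sum_distrib_left)
    also have "\<dots> = (\<Sum>q\<in>UNIV. J x $ q $ j * (ric coord_frame g (F x) ** J x) $ q $ k)"
    proof -
      have "(\<Sum>p\<in>UNIV. (g.R p q (F x) ** J x) $ p $ k) = (ric coord_frame g (F x) ** J x) $ q $ k" for q
        unfolding matrix_matrix_mult_def ric_def vec_lambda_beta sum_distrib_right by (rule sum.swap)
      then show ?thesis by simp
    qed
    also have "\<dots> = (transpose (J x) ** (ric coord_frame g (F x) ** J x)) $ j $ k"
      unfolding matrix_matrix_mult_def[of "transpose (J x)"] by (simp add: transpose_def)
    finally show ?thesis by (simp add: matrix_mul_assoc)
  qed
  then show ?thesis by (simp add: vec_eq_iff)
qed

lemma scal_pullback:
  assumes x: "x \<in> U"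
  shows "scal coord_frame h x = scal coord_frame g (F x)"
proof -
  let ?K = "matrix_inv (J x)" and ?gi = "matrix_inv (g (F x))"
  have JJ: "J x ** ?K = mat 1" "?K ** J x = mat 1"
    using matrix_inv_mult[OF inv_J[OF x]] by auto
  have KT: "transpose ?K ** transpose (J x) = mat 1"
    using arg_cong[OF JJ(1), of transpose] by (simp add: matrix_transpose_mul transpose_mat)
  have hi: "matrix_inv (h x) = ?K ** ?gi ** transpose ?K"
  proof (rule matrix_inv_unique)
    have "?K ** ?gi ** transpose ?K ** h x = ?K ** (?gi ** ((transpose ?K ** transpose (J x)) ** g (F x))) ** J x"
      by (simp add: h_eq[OF x] matrix_mul_assoc)
    then show "?K ** ?gi ** transpose ?K ** h x = mat 1"
      by (simp add: KT g.HG[OF F_in[OF x]] JJ)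
  qed
  have "scal coord_frame h x = trace (transpose (J x) ** (ric coord_frame g (F x) ** (J x ** ?K) ** ?gi ** transpose ?K))"
    unfolding scal_def ric_pullback[OF x] hi by (simp add: matrix_mul_assoc)
  also have "\<dots> = trace (ric coord_frame g (F x) ** (J x ** ?K) ** ?gi ** (transpose ?K ** transpose (J x)))"
    by (subst trace_mul_sym) (simp add: matrix_mul_assoc)
  finally show ?thesis by (simp add: JJ KT scal_def)
qed

end

section \<open>Comparison with the coordinate formulas\<close>

text \<open>The coordinate formula for the Ricci tensor only sees \<open>G\<close> along an affine slice \<open>\<iota>\<close> whose directions
are the vectors \<open>e i\<close>: the identity for a single metric, a time slice for a flow.\<close>

lemma (in metric_frame) ricci_restrict:
  fixes \<iota> :: "real^'n \<Rightarrow> 'z"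
  assumes \<iota>: "\<And>y. (\<iota> has_derivative L) (at y)" and L: "\<And>i. L (axis i 1) = e i" and x: "\<iota> x \<in> W"
  shows "ricci (\<lambda>y. G (\<iota> y)) x = ric e G (\<iota> x)"
proof -
  let ?V = "\<iota> -` W"
  have cont: "continuous_on UNIV \<iota>"
    by (rule has_derivative_continuous_on[where f' = "\<lambda>_. L"]) (simp add: \<iota>)
  have V: "open ?V" by (rule open_vimage[OF open_W cont])
  have par: "partial i (\<lambda>y. f (\<iota> y)) y = ddir (e i) f (\<iota> y)"
    if "smooth_on W f" "y \<in> ?V" for i y and f :: "'z \<Rightarrow> real"
  proof -
    have "partial i (\<lambda>y. f (\<iota> y)) y = ddir (axis i 1) (\<lambda>y. f (\<iota> y)) y"
      by (simp add: partial_def ddir_def)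
    also have "\<dots> = ddir (ddir (axis i 1) \<iota> y) f (\<iota> y)"
    proof (rule ddir_compose)
      show "\<iota> differentiable (at y)" using \<iota>[of y] by (rule differentiableI)
      show "f differentiable (at (\<iota> y))" using that by (intro differentiable) auto
    qed
    finally show ?thesis by (simp add: ddir_eqI[OF \<iota>] L)
  qed
  have pe: "partial a (\<lambda>y. f (\<iota> y) $ b $ c) y = ddir (e a) f (\<iota> y) $ b $ c"
    if "smooth_on W f" "y \<in> ?V" for a b c y and f :: "'z \<Rightarrow> real^'n^'n"
    using par[OF smooth_on_entry[OF that(1)] that(2)] D_entry[OF that(1)] that(2) by simp
  have chr: "christoffel (\<lambda>y. G (\<iota> y)) k i j y = \<Gamma> i (\<iota> y) $ k $ j" if y: "y \<in> ?V" for k i j y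
    by (simp add: pe[OF smooth_G y] christoffel_def conn_def conn_lower_def matrix_matrix_mult_def sum_divide_distrib)
  have dchr: "partial m (christoffel (\<lambda>y. G (\<iota> y)) k i j) x = ddir (e m) (\<Gamma> i) (\<iota> x) $ k $ j" for m k i j
  proof -
    have "partial m (christoffel (\<lambda>y. G (\<iota> y)) k i j) x = partial m (\<lambda>y. \<Gamma> i (\<iota> y) $ k $ j) x"
      using ddir_cong[OF V, of x "christoffel (\<lambda>y. G (\<iota> y)) k i j" "\<lambda>y. \<Gamma> i (\<iota> y) $ k $ j"] chr x
      by (simp add: partial_def ddir_def)
    also have "\<dots> = ddir (e m) (\<Gamma> i) (\<iota> x) $ k $ j"
      using x by (intro pe smooth_conn) simp
    finally show ?thesis .
  qed
  show ?thesis
    by (simp add: chr[of x, simplified, OF x] vec_eq_iff ricci_def ric_def riemann_curv_def conn_curv_def dchr matrix_matrix_mult_def sum_subtractf sum.distrib)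
qed

lemma ricci_eq_ric:
  assumes "metric_frame V h" "x \<in> V"
  shows "ricci h x = ric coord_frame h x"
  using metric_frame.ricci_restrict[OF assms(1), of "\<lambda>y. y" "\<lambda>v. v" coord_frame x] assms(2) by simp

section \<open>Charts\<close>

abbreviation pt :: "('a, 'n::finite) chart \<Rightarrow> real^'n \<Rightarrow> 'a" where
  "pt c \<equiv> inv_into (fst c) (snd c)"

lemma coord_image_eq: "coord_image c = snd c ` fst c"
  by (simp add: coord_image_def case_prod_beta)

lemma coord_rep_eq: "coord_rep c d F x = snd d (F (pt c x))"
  by (simp add: coord_rep_def case_prod_beta)

lemma pt_in: "x \<in> coord_image c \<Longrightarrow> pt c x \<in> fst c"
  by (simp add: coord_image_eq inv_into_into)

lemma crd_pt: "x \<in> coord_image c \<Longrightarrow> snd c (pt c x) = x"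
  by (simp add: coord_image_eq f_inv_into_f)

lemma crd_in: "p \<in> fst c \<Longrightarrow> snd c p \<in> coord_image c"
  by (simp add: coord_image_eq)

locale manifold =
  fixes M :: "'a topology" and A :: "('a, 'n::finite) chart set"
  assumes man: "smooth_manifold M A"
begin

lemma atlas: "smooth_atlas M A" using man by (simp add: smooth_manifold_def)

lemma
  assumes c: "c \<in> A"
  shows open_dom: "openin M (fst c)" and open_coord_image: "open (coord_image c)"
    and homeo: "homeomorphic_map (subtopology M (fst c)) (top_of_set (coord_image c)) (snd c)"
  using atlas c by (auto simp: smooth_atlas_def chart_on_def coord_image_eq case_prod_beta)

lemma dom_sub: "c \<in> A \<Longrightarrow> fst c \<subseteq> topspace M"
  using open_dom openin_subset by blast

lemma charts_cover:
  assumes "p \<in> topspace M" obtains c where "c \<in> A" "p \<in> fst c"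
  using atlas assms unfolding smooth_atlas_def by blast

lemma inj_crd:
  assumes c: "c \<in> A" shows "inj_on (snd c) (fst c)"
  using homeo[OF c] dom_sub[OF c] by (simp add: homeomorphic_eq_everything_map Int_absorb1)

lemma pt_crd: "c \<in> A \<Longrightarrow> p \<in> fst c \<Longrightarrow> pt c (snd c p) = p"
  using inj_crd by simp

lemma rep_dom_iff:
  assumes c: "c \<in> A"
  shows "x \<in> coord_rep_dom c d F \<longleftrightarrow> x \<in> coord_image c \<and> F (pt c x) \<in> fst d"
  unfolding coord_rep_dom_def coord_image_eq case_prod_beta using pt_crd[OF c] by force

lemma open_crd:
  assumes c: "c \<in> A" and Q: "openin M Q"
  shows "open (snd c ` (fst c \<inter> Q))"
proof -
  have "openin (subtopology M (fst c)) (fst c \<inter> Q)"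
    using Q by (metis inf_commute openin_subtopology_Int)
  then have "openin (top_of_set (coord_image c)) (snd c ` (fst c \<inter> Q))"
    using homeo[OF c] homeomorphic_imp_open_map open_map_def by blast
  then show ?thesis using open_coord_image[OF c] openin_open_eq by blast
qed

lemma open_rep_dom:
  assumes c: "c \<in> A" and d: "d \<in> A" and F: "continuous_map M M F"
  shows "open (coord_rep_dom c d F)"
proof -
  have "openin M {p \<in> topspace M. F p \<in> fst d}"
    using openin_continuous_map_preimage[OF F open_dom[OF d]] .
  moreover have "fst c \<inter> {p \<in> topspace M. F p \<in> fst d} = {p \<in> fst c. F p \<in> fst d}"
    using dom_sub[OF c] by auto
  ultimately show ?thesis
    using open_crd[OF c, of "{p \<in> topspace M. F p \<in> fst d}"]
    by (simp add: coord_rep_dom_def case_prod_beta)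
qed

lemma open_pt:
  assumes c: "c \<in> A" and Q: "open Q" "Q \<subseteq> coord_image c"
  shows "openin M (pt c ` Q)"
proof -
  have "continuous_map (subtopology M (fst c)) (top_of_set (coord_image c)) (snd c)"
    using homeo[OF c] homeomorphic_imp_continuous_map by blast
  moreover have "openin (top_of_set (coord_image c)) Q"
    using Q by (metis inf.absorb_iff2 openin_open)
  ultimately have "openin (subtopology M (fst c)) {p \<in> topspace (subtopology M (fst c)). snd c p \<in> Q}"
    by (rule openin_continuous_map_preimage)
  moreover have "{p \<in> topspace (subtopology M (fst c)). snd c p \<in> Q} = pt c ` Q"
  proof
    show "{p \<in> topspace (subtopology M (fst c)). snd c p \<in> Q} \<subseteq> pt c ` Q"
      using pt_crd[OF c] by (force simp: image_iff)
    show "pt c ` Q \<subseteq> {p \<in> topspace (subtopology M (fst c)). snd c p \<in> Q}"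
      using Q pt_in[of _ c] crd_pt[of _ c] dom_sub[OF c] by (auto simp: subset_iff)
  qed
  ultimately show ?thesis
    using open_dom[OF c] by (metis openin_trans_full)
qed

lemma smooth_map_id: "smooth_map M A id"
  using atlas by (auto simp: smooth_map_def smooth_atlas_def)

lemma rep_id_dom:
  assumes "c \<in> A" "x \<in> coord_image c" "pt c x \<in> fst d"
  shows "x \<in> coord_rep_dom c d id" "coord_rep c d id x = snd d (pt c x)"
  using assms by (auto simp: rep_dom_iff coord_rep_eq)

lemma riemannian_frame:
  assumes g: "riemannian_metric A g" and c: "c \<in> A"
  shows "metric_frame (coord_image c) (g c)"
proof
  show "open (coord_image c)" by (rule open_coord_image[OF c])
  show "smooth_on (coord_image c) (g c)" using g c by (simp add: riemannian_metric_def)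
  show "pos_def (g c z)" if "z \<in> coord_image c" for z
    using g c that by (simp add: riemannian_metric_def pos_def_def)
qed

lemma pullback_frame:
  assumes S: "riemannian_metric A S" and T: "riemannian_metric A T"
    and F: "smooth_map M A F" and p: "is_pullback A F T S" and c: "c \<in> A" and d: "d \<in> A"
  shows "metric_pullback (coord_rep_dom c d F) (coord_image d) (S c) (T d) (coord_rep c d F)"
proof -
  interpret T: metric_frame "coord_image d" coord_frame "T d" using riemannian_frame[OF T d] .
  interpret S: metric_frame "coord_image c" coord_frame "S c" using riemannian_frame[OF S c] .
  have sub: "coord_rep_dom c d F \<subseteq> coord_image c" using rep_dom_iff[OF c] by blast
  have F': "continuous_map M M F" using F by (simp add: smooth_map_def)
  show ?thesis
  proof
    show "open (coord_rep_dom c d F)" by (rule open_rep_dom[OF c d F'])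
    show "smooth_on (coord_rep_dom c d F) (S c)" by (rule smooth_on_subset[OF S.smooth_G sub])
    show "pos_def (S c z)" if "z \<in> coord_rep_dom c d F" for z using S.pos_G sub that by blast
    show "smooth_on (coord_rep_dom c d F) (coord_rep c d F)" using F c d by (simp add: smooth_map_def)
    show "coord_rep c d F ` coord_rep_dom c d F \<subseteq> coord_image d"
      by (auto simp: rep_dom_iff[OF c] coord_rep_eq intro: crd_in)
    show "S c x = transpose (jacobian (coord_rep c d F) (at x)) ** T d (coord_rep c d F x) ** jacobian (coord_rep c d F) (at x)"
      if "x \<in> coord_rep_dom c d F" for x
      using p c d that by (simp add: is_pullback_def Let_def)
  qed
qed

text \<open>A function on the manifold, given by its coordinate expressions in all charts.\<close>

definition chart_invariant :: "(('a, 'n) chart \<Rightarrow> real^'n \<Rightarrow> 'b) \<Rightarrow> bool" where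
  "chart_invariant u \<longleftrightarrow> (\<forall>c\<in>A. \<forall>d\<in>A. \<forall>x\<in>coord_rep_dom c d id. u c x = u d (coord_rep c d id x))"

lemma scal_invariant:
  assumes g: "riemannian_metric A g"
  shows "chart_invariant (\<lambda>c x. scal coord_frame (g c) x)"
  unfolding chart_invariant_def
proof (intro ballI)
  fix c d x assume cd: "c \<in> A" "d \<in> A" and x: "x \<in> coord_rep_dom c d id"
  have "is_pullback A id g g" using g by (simp add: riemannian_metric_def tensor_field_def)
  from metric_pullback.scal_pullback[OF pullback_frame[OF g g smooth_map_id this cd] x]
  show "scal coord_frame (g c) x = scal coord_frame (g d) (coord_rep c d id x)" .
qed

end

section \<open>Compactness\<close>

locale closed_manifold = manifold M A
  for M :: "'a topology" and A :: "('a, 'n::finite) chart set" +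
  assumes compact: "compact_space M"
begin

lemma finite_ball_cover:
  obtains K :: "(('a, 'n) chart \<times> (real^'n) \<times> real) set" where "finite K"
    "\<And>c x r. (c, x, r) \<in> K \<Longrightarrow> c \<in> A \<and> 0 < r \<and> cball x r \<subseteq> coord_image c"
    "\<And>p. p \<in> topspace M \<Longrightarrow> \<exists>c x r. (c, x, r) \<in> K \<and> p \<in> fst c \<and> snd c p \<in> ball x r"
proof -
  define B where "B = {(c, x, r). c \<in> A \<and> 0 < r \<and> cball x r \<subseteq> coord_image c}"
  define N where "N = (\<lambda>(c, x :: real^'n, r). pt c ` ball x r :: 'a set)"
  have "\<exists>b\<in>B. p \<in> N b" if p: "p \<in> topspace M" for p
  proof -
    obtain c where c: "c \<in> A" "p \<in> fst c" using charts_cover[OF p] .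
    obtain r where r: "r > 0" "cball (snd c p) r \<subseteq> coord_image c"
      using open_coord_image[OF c(1)] crd_in[OF c(2)] open_contains_cball by blast
    have "p \<in> pt c ` ball (snd c p) r" using pt_crd[OF c] r(1) by (metis centre_in_ball image_eqI)
    then show ?thesis using c r by (intro bexI[of _ "(c, snd c p, r)"]) (auto simp: B_def N_def)
  qed
  then have cov: "topspace M \<subseteq> \<Union> (N ` B)" by blast
  have ballB: "c \<in> A" "ball x r \<subseteq> coord_image c" if "(c, x, r) \<in> B" for c x r
    using that ball_subset_cball[of x r] by (auto simp: B_def)
  have op: "openin M U" if U: "U \<in> N ` B" for U
  proof -
    obtain c x r where k: "(c, x, r) \<in> B" "U = N (c, x, r)" using U by (metis imageE prod_cases3)
    show ?thesis unfolding k(2) N_def using open_pt[OF ballB(1)[OF k(1)] open_ball ballB(2)[OF k(1)]] by simp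
  qed
  obtain \<F> where F: "finite \<F>" "\<F> \<subseteq> N ` B" "topspace M \<subseteq> \<Union>\<F>"
    using compact[unfolded compact_space_alt, rule_format, of "N ` B"] cov op by blast
  then obtain K where K: "K \<subseteq> B" "finite K" "\<F> = N ` K"
    using finite_subset_image[OF F(1,2)] by blast
  show ?thesis
  proof (rule that[OF K(2)])
    show "c \<in> A \<and> 0 < r \<and> cball x r \<subseteq> coord_image c" if "(c, x, r) \<in> K" for c x r
      using that K(1) by (auto simp: B_def)
    show "\<exists>c x r. (c, x, r) \<in> K \<and> p \<in> fst c \<and> snd c p \<in> ball x r" if p: "p \<in> topspace M" for p
    proof -
      obtain k where "k \<in> K" "p \<in> N k" using F(3) p K(3) by blast
      then obtain c x r y where k: "(c, x, r) \<in> K" "p = pt c y" "y \<in> ball x r"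
        by (cases k) (auto simp: N_def)
      then have y: "y \<in> coord_image c" using ballB(2) K(1) by blast
      show ?thesis by (intro exI[of _ c] exI[of _ x] exI[of _ r]) (simp add: k(1,2) k(3)[unfolded mem_ball] pt_in[OF y] crd_pt[OF y])
    qed
  qed
qed

text \<open>The compact manifold is covered by finitely many closed coordinate balls, on each of which the
minimum exists.\<close>

lemma attains_min:
  fixes f :: "('a, 'n) chart \<Rightarrow> real \<Rightarrow> real^'n \<Rightarrow> real"
  assumes ne: "topspace M \<noteq> {}" and ab: "a \<le> b"
    and cont: "\<And>c. c \<in> A \<Longrightarrow> continuous_on ({a..b} \<times> coord_image c) (\<lambda>(t, x). f c t x)"
    and inv: "\<And>t. t \<in> {a..b} \<Longrightarrow> chart_invariant (\<lambda>c. f c t)"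
  obtains c t x where "c \<in> A" "t \<in> {a..b}" "x \<in> coord_image c"
    "\<And>d s y. d \<in> A \<Longrightarrow> s \<in> {a..b} \<Longrightarrow> y \<in> coord_image d \<Longrightarrow> f c t x \<le> f d s y"
proof -
  obtain K :: "(('a, 'n) chart \<times> (real^'n) \<times> real) set" where K: "finite K"
    "\<And>c x r. (c, x, r) \<in> K \<Longrightarrow> c \<in> A \<and> 0 < r \<and> cball x r \<subseteq> coord_image c"
    "\<And>p. p \<in> topspace M \<Longrightarrow> \<exists>c x r. (c, x, r) \<in> K \<and> p \<in> fst c \<and> snd c p \<in> ball x r"
    by (rule finite_ball_cover) blast
  have "\<exists>z. z \<in> {a..b} \<times> cball (fst (snd k)) (snd (snd k)) \<and>
     (\<forall>w\<in>{a..b} \<times> cball (fst (snd k)) (snd (snd k)). f (fst k) (fst z) (snd z) \<le> f (fst k) (fst w) (snd w))"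
    if k: "k \<in> K" for k
  proof -
    obtain c x r where cxr: "k = (c, x, r)" by (cases k)
    have c: "c \<in> A" "0 < r" "cball x r \<subseteq> coord_image c" using K(2) k cxr by auto
    have "continuous_on ({a..b} \<times> cball x r) (\<lambda>(t, x). f c t x)"
      by (rule continuous_on_subset[OF cont[OF c(1)]]) (use c in auto)
    moreover have "compact ({a..b} \<times> cball x r)" by (intro compact_Times) auto
    moreover have "{a..b} \<times> cball x r \<noteq> {}" using ab c by auto
    ultimately obtain z where "z \<in> {a..b} \<times> cball x r"
      "\<forall>w\<in>{a..b} \<times> cball x r. (\<lambda>(t, x). f c t x) z \<le> (\<lambda>(t, x). f c t x) w"
      using continuous_attains_inf by blast
    then show ?thesis by (intro exI[of _ z]) (simp add: cxr case_prod_beta)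
  qed
  then obtain z where z: "\<And>k. k \<in> K \<Longrightarrow> z k \<in> {a..b} \<times> cball (fst (snd k)) (snd (snd k))"
    "\<And>k w. k \<in> K \<Longrightarrow> w \<in> {a..b} \<times> cball (fst (snd k)) (snd (snd k)) \<Longrightarrow>
       f (fst k) (fst (z k)) (snd (z k)) \<le> f (fst k) (fst w) (snd w)"
    by metis
  define m where "m k = f (fst k) (fst (z k)) (snd (z k))" for k
  have "K \<noteq> {}" using ne K(3) by fast
  then obtain k where k: "k \<in> K" "\<And>l. l \<in> K \<Longrightarrow> m k \<le> m l"
    using K(1) by (metis arg_min_if_finite(1) arg_min_least)
  obtain c x r where cxr: "k = (c, x, r)" by (cases k)
  have c: "c \<in> A" "0 < r" "cball x r \<subseteq> coord_image c" using K(2) k cxr by auto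
  show ?thesis
  proof (rule that[of c "fst (z k)" "snd (z k)"])
    show "c \<in> A" by fact
    show "fst (z k) \<in> {a..b}" "snd (z k) \<in> coord_image c" using z(1)[OF k(1)] cxr c by auto
    show "f c (fst (z k)) (snd (z k)) \<le> f d s y" if "d \<in> A" "s \<in> {a..b}" "y \<in> coord_image d" for d s y
    proof -
      have "pt d y \<in> topspace M" using pt_in that dom_sub by blast
      then obtain c' x' r' where k': "(c', x', r') \<in> K" "pt d y \<in> fst c'" "snd c' (pt d y) \<in> ball x' r'"
        using K(3) by blast
      have "f d s y = f c' s (snd c' (pt d y))"
        using inv[OF that(2)] K(2)[OF k'(1)] rep_id_dom[OF that(1,3) k'(2)] that
        unfolding chart_invariant_def by metis
      moreover have "m (c', x', r') \<le> f c' s (snd c' (pt d y))"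
        using z(2)[OF k'(1), of "(s, snd c' (pt d y))"] k'(3) that(2) by (auto simp: m_def)
      ultimately show ?thesis using k(2)[OF k'(1)] by (simp add: m_def cxr)
    qed
  qed
qed

end

section \<open>The maximum principle for the scalar curvature\<close>

text \<open>First and second derivative test. If the second derivative were negative, the first would be
negative just after \<open>z\<close>, and \<open>f\<close> would drop below its minimum.\<close>

lemma ddir_min_along_line:
  fixes f :: "'z::euclidean_space \<Rightarrow> real"
  assumes S: "smooth_on S f" "open S" and z: "z \<in> S" and \<delta>: "\<delta> > 0"
    and min: "\<And>h. \<bar>h\<bar> < \<delta> \<Longrightarrow> f z \<le> f (z + h *\<^sub>R v)"
  shows "ddir v f z = 0" and "0 \<le> ddir v (ddir v f) z"
proof -
  have d: "((\<lambda>h. f (z + h *\<^sub>R v)) has_real_derivative ddir v f (z + h *\<^sub>R v)) (at h)"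
    if "z + h *\<^sub>R v \<in> S" for h
    by (rule ddir_line) (rule smooth_on_differentiable[OF S that])
  have "((\<lambda>h. f (z + h *\<^sub>R v)) has_real_derivative ddir v f z) (at 0)" using d[of 0] z by simp
  from DERIV_local_min[OF this \<delta>] min show 0: "ddir v f z = 0" by auto
  show "0 \<le> ddir v (ddir v f) z"
  proof (rule ccontr)
    assume neg: "\<not> 0 \<le> ddir v (ddir v f) z"
    have "((\<lambda>h. ddir v f (z + h *\<^sub>R v)) has_real_derivative ddir v (ddir v f) (z + 0 *\<^sub>R v)) (at 0)"
      by (rule ddir_line) (use smooth_on_differentiable[OF smooth_on_ddir[OF S] S(2) z] in simp)
    then obtain d1 where d1: "d1 > 0" "\<And>h. 0 < h \<Longrightarrow> h < d1 \<Longrightarrow> ddir v f (z + h *\<^sub>R v) < 0"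
      using DERIV_neg_dec_right[of "\<lambda>h. ddir v f (z + h *\<^sub>R v)" "ddir v (ddir v f) z" 0] neg 0
      by auto
    have "open ((\<lambda>h. z + h *\<^sub>R v) -` S)"
      by (intro open_vimage S(2) continuous_intros)
    then obtain d2 where d2: "d2 > 0" "ball 0 d2 \<subseteq> (\<lambda>h. z + h *\<^sub>R v) -` S"
      using z by (elim openE) auto
    have inS: "z + h *\<^sub>R v \<in> S" if "\<bar>h\<bar> < d2" for h
      using d2(2) that by (auto simp: dist_real_def subset_iff)
    define h where "h = min d1 (min d2 \<delta>) / 2"
    have h: "0 < h" "h < d1" "h < d2" "h < \<delta>" using d1(1) d2(1) \<delta> by (auto simp: h_def)
    have "\<exists>x. 0 < x \<and> x < h \<and> f (z + h *\<^sub>R v) - f (z + 0 *\<^sub>R v) = (h - 0) * ddir v f (z + x *\<^sub>R v)"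
      by (rule MVT2[OF h(1)]) (use d inS h in auto)
    then obtain x where x: "0 < x" "x < h" "f (z + h *\<^sub>R v) - f z = h * ddir v f (z + x *\<^sub>R v)" by auto
    have "h * ddir v f (z + x *\<^sub>R v) < 0" using d1(2)[of x] x h by (simp add: mult_pos_neg)
    moreover have "f z \<le> f (z + h *\<^sub>R v)" using min h by simp
    ultimately show False using x(3) by simp
  qed
qed

text \<open>The inverse metric is \<open>B ** transpose B\<close> for an orthonormal basis \<open>B\<close>, so the trace is the sum of the
second derivatives along the basis vectors.\<close>

lemma (in metric_frame) trace_hessian_nonneg:
  fixes f :: "'z \<Rightarrow> real"
  assumes f: "smooth_on W f" and z: "z \<in> W"
    and pos: "\<And>a. 0 \<le> ddir (\<Sum>j\<in>UNIV. a j *\<^sub>R e j) (ddir (\<Sum>j\<in>UNIV. a j *\<^sub>R e j) f) z"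
  shows "0 \<le> (\<Sum>j\<in>UNIV. \<Sum>l\<in>UNIV. ddir (e j) (ddir (e l) f) z * H z $ l $ j)"
proof -
  obtain B :: "real^'n^'n" where B: "transpose B ** G z ** B = mat 1"
    using pos_def_orthonormal_basis[OF pos_G[OF z]] by blast
  define b where "b a = (\<Sum>j\<in>UNIV. B $ j $ a *\<^sub>R e j)" for a
  have lin: "ddir (b a) u y = (\<Sum>j\<in>UNIV. B $ j $ a * ddir (e j) u y)"
    if "smooth_on W u" "y \<in> W" for u :: "'z \<Rightarrow> real" and a y
  proof -
    have l: "linear (\<lambda>v. ddir v u y)" by (rule ddir_linear[OF differentiable[OF that]])
    show ?thesis unfolding b_def linear_sum[OF l] by (simp add: linear_cmul[OF l])
  qed
  have "ddir (b a) (ddir (b a) f) z = (\<Sum>j\<in>UNIV. \<Sum>l\<in>UNIV. ddir (e j) (ddir (e l) f) z * (B $ l $ a * B $ j $ a))" for a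
  proof -
    have "ddir (e j) (ddir (b a) f) z = (\<Sum>l\<in>UNIV. B $ l $ a * ddir (e j) (ddir (e l) f) z)" for j
    proof -
      have "ddir (e j) (ddir (b a) f) z = ddir (e j) (\<lambda>y. \<Sum>l\<in>UNIV. B $ l $ a * ddir (e l) f y) z"
        by (rule D_cong[OF z]) (rule lin[OF f])
      also have "\<dots> = (\<Sum>l\<in>UNIV. ddir (e j) (\<lambda>y. B $ l $ a * ddir (e l) f y) z)"
        by (intro D_sum[OF _ z] smooth_on_mult smooth_on_const smooth_ddir f)
      also have "\<dots> = (\<Sum>l\<in>UNIV. B $ l $ a * ddir (e j) (ddir (e l) f) z)"
        by (intro sum.cong refl ddir_bounded_linear bounded_linear_mult_right differentiable[OF smooth_ddir[OF f] z])
      finally show ?thesis .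
    qed
    then show ?thesis
      unfolding lin[OF smooth_ddir[OF f] z] by (simp add: sum_distrib_left mult_ac)
  qed
  then have "(\<Sum>a\<in>UNIV. ddir (b a) (ddir (b a) f) z)
     = (\<Sum>a\<in>UNIV. \<Sum>j\<in>UNIV. \<Sum>l\<in>UNIV. ddir (e j) (ddir (e l) f) z * (B $ l $ a * B $ j $ a))" by simp
  also have "\<dots> = (\<Sum>j\<in>UNIV. \<Sum>a\<in>UNIV. \<Sum>l\<in>UNIV. ddir (e j) (ddir (e l) f) z * (B $ l $ a * B $ j $ a))"
    by (rule sum.swap)
  also have "\<dots> = (\<Sum>j\<in>UNIV. \<Sum>l\<in>UNIV. \<Sum>a\<in>UNIV. ddir (e j) (ddir (e l) f) z * (B $ l $ a * B $ j $ a))"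
    by (intro sum.cong refl sum.swap)
  also have "\<dots> = (\<Sum>j\<in>UNIV. \<Sum>l\<in>UNIV. ddir (e j) (ddir (e l) f) z * H z $ l $ j)"
    unfolding orthonormal_basis_inverse(1)[OF B]
    by (simp add: matrix_matrix_mult_def transpose_def sum_distrib_left)
  finally have eq: "(\<Sum>a\<in>UNIV. ddir (b a) (ddir (b a) f) z)
     = (\<Sum>j\<in>UNIV. \<Sum>l\<in>UNIV. ddir (e j) (ddir (e l) f) z * H z $ l $ j)" .
  have "0 \<le> (\<Sum>a\<in>UNIV. ddir (b a) (ddir (b a) f) z)"
    by (intro sum_nonneg) (simp add: b_def pos)
  then show ?thesis unfolding eq .
qed

definition st_frame :: "'n::finite \<Rightarrow> real \<times> (real^'n)" where
  "st_frame i = (0, axis i 1)"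

locale closed_flow = closed_manifold M A
  for M :: "'a topology" and A :: "('a, 'n::finite) chart set" +
  fixes g :: "real \<Rightarrow> ('a, 'n) tensor2" and t1 t2 :: real
  assumes t12: "t1 < t2" and flow: "ricci_flow A t1 t2 g"
begin

abbreviation "sc t c x \<equiv> scal coord_frame (g t c) x"

lemma metric: "t \<in> {t1..t2} \<Longrightarrow> riemannian_metric A (g t)"
  using flow by (simp add: ricci_flow_def)

lemma slab_smooth: "c \<in> A \<Longrightarrow> smooth_on ({t1..t2} \<times> coord_image c) (\<lambda>(t, x). g t c x)"
  using flow by (simp add: ricci_flow_def)

lemma time_derivative:
  "c \<in> A \<Longrightarrow> x \<in> coord_image c \<Longrightarrow> t \<in> {t1..t2} \<Longrightarrow>
   ((\<lambda>s. g s c x) has_vector_derivative (-2) *\<^sub>R ricci (g t c) x) (at t within {t1..t2})"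
  using flow by (simp add: ricci_flow_def)

lemma slice_frame: "t \<in> {t1..t2} \<Longrightarrow> c \<in> A \<Longrightarrow> metric_frame (coord_image c) (g t c)"
  using riemannian_frame metric by blast

lemma ricci_eq: "t \<in> {t1..t2} \<Longrightarrow> c \<in> A \<Longrightarrow> x \<in> coord_image c \<Longrightarrow> ricci (g t c) x = ric coord_frame (g t c) x"
  using ricci_eq_ric slice_frame by blast

lemma sc_eq: "t \<in> {t1..t2} \<Longrightarrow> c \<in> A \<Longrightarrow> x \<in> coord_image c \<Longrightarrow>
   sc t c x = trace (ricci (g t c) x ** matrix_inv (g t c x))"
  by (simp add: scal_def ricci_eq)

lemma slab_invertible: "c \<in> A \<Longrightarrow> z \<in> {t1..t2} \<times> coord_image c \<Longrightarrow> invertible (case z of (t, x) \<Rightarrow> g t c x)"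
  by (cases z) (simp add: metric_frame.inv_G[OF slice_frame])

text \<open>Up to the end times this comes from the flow equation: the Ricci tensor is \<open>-1/2\<close> times the time
derivative of a map that is continuously differentiable on the closed slab.\<close>

lemma continuous_ricci:
  assumes c: "c \<in> A"
  shows "continuous_on ({t1..t2} \<times> coord_image c) (\<lambda>(t, x). ricci (g t c) x)"
proof -
  let ?S = "{t1..t2} \<times> coord_image c"
  have "Ck_on (Suc 0) ?S (\<lambda>(t, x). g t c x)" using slab_smooth[OF c] unfolding smooth_on_def by blast
  then obtain f' where f': "\<And>z. z \<in> ?S \<Longrightarrow> ((\<lambda>(t, x). g t c x) has_derivative f' z) (at z within ?S)"
    "\<And>v. continuous_on ?S (\<lambda>z. f' z v)" by (auto simp: Ck_on.simps)
  have eq: "(\<lambda>(t, x). ricci (g t c) x) z = (-1/2) *\<^sub>R f' z (1, 0)" if z: "z \<in> ?S" for z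
  proof -
    obtain t x where tx: "z = (t, x)" "t \<in> {t1..t2}" "x \<in> coord_image c" using z by auto
    have "((\<lambda>s. (s, x)) has_derivative (\<lambda>h. (h, 0))) (at t within {t1..t2})"
      by (auto intro!: derivative_eq_intros)
    moreover have "((\<lambda>(t, x). g t c x) has_derivative f' z) (at (t, x) within (\<lambda>s. (s, x)) ` {t1..t2})"
      using f'(1)[OF z] tx by (auto intro: has_derivative_subset)
    ultimately have d: "((\<lambda>s. g s c x) has_derivative (\<lambda>h. f' z (h, 0))) (at t within {t1..t2})"
      using has_derivative_in_compose[of "\<lambda>s. (s, x)" _ t "{t1..t2}" "\<lambda>(t, x). g t c x" "f' z"] by simp
    have "(\<lambda>h. f' z (h, 0)) = (\<lambda>h. h *\<^sub>R f' z (1, 0))"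
    proof
      show "f' z (h, 0) = h *\<^sub>R f' z (1, 0)" for h
        using linear_cmul[OF has_derivative_linear[OF f'(1)[OF z]], of h "(1, 0)"] by simp
    qed
    with d have "((\<lambda>s. g s c x) has_vector_derivative f' z (1, 0)) (at t within {t1..t2})"
      by (simp only: has_vector_derivative_def)
    then have "f' z (1, 0) = (-2) *\<^sub>R ricci (g t c) x"
      using vector_derivative_unique_within_closed_interval[OF t12, of t "\<lambda>s. g s c x"]
        time_derivative[OF c tx(3,2)] tx(2) by simp
    then show ?thesis by (simp add: tx(1))
  qed
  have "continuous_on ?S (\<lambda>z. (-1/2) *\<^sub>R f' z (1, 0))"
    by (intro continuous_on_scaleR continuous_on_const f'(2))
  then show ?thesis by (rule continuous_on_eq) (rule eq[symmetric])
qed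

lemma continuous_sc:
  assumes c: "c \<in> A"
  shows "continuous_on ({t1..t2} \<times> coord_image c) (\<lambda>(t, x). sc t c x)"
proof -
  let ?S = "{t1..t2} \<times> coord_image c"
  have "continuous_on ?S (\<lambda>z. matrix_inv (case z of (t, x) \<Rightarrow> g t c x))"
    by (intro smooth_on_continuous smooth_on_matrix_inv slab_smooth c slab_invertible)
  then have "continuous_on ?S (\<lambda>z. trace ((case z of (t, x) \<Rightarrow> ricci (g t c) x) ** matrix_inv (case z of (t, x) \<Rightarrow> g t c x)))"
    by (intro bounded_linear.continuous_on[OF bounded_linear_trace]
        bounded_bilinear.continuous_on[OF bounded_bilinear_matrix_mult] continuous_ricci c)
  then show ?thesis
    by (rule continuous_on_eq) (auto simp: sc_eq[OF _ c])
qed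

abbreviation "interior_slab c \<equiv> {t1<..<t2} \<times> coord_image c"
abbreviation "st_metric c \<equiv> (\<lambda>(t, x). g t c x)"

lemma st_metric_frame:
  assumes c: "c \<in> A"
  shows "metric_frame (interior_slab c) (st_metric c)"
proof
  show "open (interior_slab c)" using open_coord_image[OF c] by (intro open_Times) auto
  show "smooth_on (interior_slab c) (st_metric c)"
    by (rule smooth_on_subset[OF slab_smooth[OF c]]) auto
  show "pos_def (st_metric c z)" if "z \<in> interior_slab c" for z
    using metric_frame.pos_G[OF slice_frame[OF _ c]] that by auto
qed

lemma st_ric:
  assumes c: "c \<in> A" and t: "t \<in> {t1<..<t2}" and x: "x \<in> coord_image c"
  shows "ric st_frame (st_metric c) (t, x) = ricci (g t c) x"
proof -
  have d: "((\<lambda>y. (t, y)) has_derivative (\<lambda>v. (0, v))) (at y)" for y :: "real^'n"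
    by (auto intro!: derivative_eq_intros)
  have "ricci (\<lambda>y. st_metric c (t, y)) x = ric st_frame (st_metric c) (t, x)"
    by (rule metric_frame.ricci_restrict[OF st_metric_frame[OF c] d]) (use t x in \<open>auto simp: st_frame_def\<close>)
  then show ?thesis by simp
qed

lemma st_scal:
  assumes "c \<in> A" "t \<in> {t1<..<t2}" "x \<in> coord_image c"
  shows "scal st_frame (st_metric c) (t, x) = sc t c x"
  using assms by (simp add: scal_def st_ric ricci_eq)

lemma st_flow_frame:
  assumes c: "c \<in> A"
  shows "flow_frame (interior_slab c) st_frame (st_metric c) (1, 0)"
proof -
  interpret metric_frame "interior_slab c" st_frame "st_metric c" by (rule st_metric_frame[OF c])
  show ?thesis
  proof
    fix z assume z: "z \<in> interior_slab c"
    then obtain t x where tx: "z = (t, x)" "t \<in> {t1<..<t2}" "x \<in> coord_image c" by auto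
    have "((\<lambda>s. (s, x)) has_derivative (\<lambda>h. (h, 0))) (at t)"
      by (auto intro!: derivative_eq_intros)
    from has_derivative_compose[OF this, of "st_metric c"]
    have d: "((\<lambda>s. g s c x) has_derivative (\<lambda>h. ddir (h, 0) (st_metric c) z)) (at t)"
      using has_derivative_ddir[OF differentiable[OF smooth_G z]] tx by simp
    have "(\<lambda>h. ddir (h, 0) (st_metric c) z) = (\<lambda>h. h *\<^sub>R ddir (1, 0) (st_metric c) z)"
    proof
      show "ddir (h, 0) (st_metric c) z = h *\<^sub>R ddir (1, 0) (st_metric c) z" for h
        using linear_cmul[OF ddir_linear[OF differentiable[OF smooth_G z]], of h "(1, 0)"] by simp
    qed
    with d have "((\<lambda>s. g s c x) has_vector_derivative ddir (1, 0) (st_metric c) z) (at t)"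
      by (simp only: has_vector_derivative_def)
    moreover have "((\<lambda>s. g s c x) has_vector_derivative (-2) *\<^sub>R ricci (g t c) x) (at t)"
      using time_derivative[OF c tx(3), of t] tx(2) by (simp add: at_within_Icc_at)
    ultimately have "ddir (1, 0) (st_metric c) z = (-2) *\<^sub>R ricci (g t c) x"
      by (rule vector_derivative_unique_at)
    then show "ddir (1, 0) (st_metric c) z = (-2) *\<^sub>R ric st_frame (st_metric c) z"
      using st_ric[OF c tx(2,3)] tx(1) by simp
  qed
qed

end

context closed_flow
begin

abbreviation "st_scalar c \<equiv> scal st_frame (st_metric c)"

lemma sc_has_derivative:
  assumes c: "c \<in> A" and t: "t \<in> {t1<..<t2}" and x: "x \<in> coord_image c"
  shows "((\<lambda>s. sc s c x) has_real_derivative ddir (1, 0) (st_scalar c) (t, x)) (at t)"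
proof -
  interpret flow_frame "interior_slab c" st_frame "st_metric c" "(1, 0)" by (rule st_flow_frame[OF c])
  have "((\<lambda>s. st_scalar c ((0, x) + s *\<^sub>R (1, 0))) has_real_derivative
      ddir (1, 0) (st_scalar c) ((0, x) + t *\<^sub>R (1, 0))) (at t)"
    by (rule ddir_line) (use differentiable[OF smooth_scal, of "(t, x)"] t x in simp)
  then have "((\<lambda>s. st_scalar c (s, x)) has_real_derivative ddir (1, 0) (st_scalar c) (t, x)) (at t)"
    by simp
  then show ?thesis
    by (rule has_field_derivative_transform_within_open[of _ _ _ "{t1<..<t2}"])
      (use t x st_scal[OF c] in auto)
qed

lemma sc_evolution_at_min:
  assumes c: "c \<in> A" and t: "t \<in> {t1<..<t2}" and x: "x \<in> coord_image c"
    and min: "\<And>y. y \<in> coord_image c \<Longrightarrow> sc t c x \<le> sc t c y"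
  shows "2 * trace (ricci (g t c) x ** matrix_inv (g t c x) ** ricci (g t c) x ** matrix_inv (g t c x))
     \<le> ddir (1, 0) (st_scalar c) (t, x)"
proof -
  interpret flow_frame "interior_slab c" st_frame "st_metric c" "(1, 0)" by (rule st_flow_frame[OF c])
  have z: "(t, x) \<in> interior_slab c" using t x by auto
  have "ddir (0, v) (st_scalar c) (t, x) = 0 \<and> 0 \<le> ddir (0, v) (ddir (0, v) (st_scalar c)) (t, x)" for v
  proof -
    have "open ((\<lambda>h. x + h *\<^sub>R v) -` coord_image c)"
      by (intro open_vimage open_coord_image[OF c] continuous_intros)
    then obtain d where d: "d > 0" "ball 0 d \<subseteq> (\<lambda>h. x + h *\<^sub>R v) -` coord_image c"
      using x by (elim openE) auto
    have "st_scalar c (t, x) \<le> st_scalar c ((t, x) + h *\<^sub>R (0, v))" if "\<bar>h\<bar> < d" for h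
    proof -
      have "x + h *\<^sub>R v \<in> coord_image c" using d(2) that by (auto simp: dist_real_def subset_iff)
      then show ?thesis using min by (simp add: st_scal[OF c t] x)
    qed
    then show ?thesis using ddir_min_along_line[OF smooth_scal open_W z d(1)] by blast
  qed
  note m = this
  have crit: "ddir (st_frame l) (st_scalar c) (t, x) = 0" for l using m by (simp add: st_frame_def)
  have "(\<Sum>j\<in>UNIV. a j *\<^sub>R st_frame j) = (0, \<Sum>j\<in>UNIV. a j *\<^sub>R axis j 1)" for a :: "'n \<Rightarrow> real"
    by (simp add: st_frame_def prod_eq_iff fst_sum snd_sum)
  then have "0 \<le> ddir (\<Sum>j\<in>UNIV. a j *\<^sub>R st_frame j) (ddir (\<Sum>j\<in>UNIV. a j *\<^sub>R st_frame j) (st_scalar c)) (t, x)"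
    for a :: "'n \<Rightarrow> real"
    using m by simp
  from trace_hessian_nonneg[OF smooth_scal z this]
  show ?thesis unfolding scal_evolution_critical[OF z crit] using st_ric[OF c t x] by simp
qed

lemma pos_def_metric: "t \<in> {t1..t2} \<Longrightarrow> c \<in> A \<Longrightarrow> x \<in> coord_image c \<Longrightarrow> pos_def (g t c x)"
  using metric_frame.pos_G[OF slice_frame] .

lemma sym_ricci:
  assumes c: "c \<in> A" and t: "t \<in> {t1<..<t2}" and x: "x \<in> coord_image c"
  shows "transpose (ricci (g t c) x) = ricci (g t c) x"
  using flow_frame.sym_Ric[OF st_flow_frame[OF c], of "(t, x)"] st_ric[OF c t x] t x by simp

lemma sc_square_le:
  assumes c: "c \<in> A" and t: "t \<in> {t1<..<t2}" and x: "x \<in> coord_image c"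
  defines "T \<equiv> trace (ricci (g t c) x ** matrix_inv (g t c x) ** ricci (g t c) x ** matrix_inv (g t c x))"
  shows "(sc t c x)\<^sup>2 / CARD('n) \<le> T"
    and "T \<le> (sc t c x)\<^sup>2 / CARD('n) \<Longrightarrow> ricci (g t c) x = (sc t c x / CARD('n)) *\<^sub>R g t c x"
proof -
  have t': "t \<in> {t1..t2}" using t by auto
  note q = trace_square_ge[OF pos_def_metric[OF t' c x] sym_ricci[OF c t x], folded sc_eq[OF t' c x] T_def]
  show 1: "(sc t c x)\<^sup>2 / CARD('n) \<le> T" by (rule q(1))
  show "ricci (g t c) x = (sc t c x / CARD('n)) *\<^sub>R g t c x" if "T \<le> (sc t c x)\<^sup>2 / CARD('n)"
    using q(2) 1 that by simp
qed

text \<open>The solution of \<open>s' = (2/n) s\<^sup>2\<close> with \<open>s t1 = s0\<close>, which exists for all later times when \<open>s0 \<le> 0\<close>.\<close>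

definition barrier :: "real \<Rightarrow> real \<Rightarrow> real" where
  "barrier s0 t = s0 / (1 - 2 / CARD('n) * s0 * (t - t1))"

lemma barrier_denom: "s0 \<le> 0 \<Longrightarrow> t1 \<le> t \<Longrightarrow> 1 \<le> 1 - 2 / CARD('n) * s0 * (t - t1)"
  by (simp add: mult_nonpos_nonneg divide_nonpos_nonneg)

lemma barrier_nonpos: "s0 \<le> 0 \<Longrightarrow> t1 \<le> t \<Longrightarrow> barrier s0 t \<le> 0"
  unfolding barrier_def by (rule divide_nonpos_pos) (use barrier_denom[of s0 t] in linarith)+

lemma barrier_ode:
  assumes "s0 \<le> 0" "t1 \<le> t"
  shows "(barrier s0 has_real_derivative 2 / CARD('n) * (barrier s0 t)\<^sup>2) (at t)"
proof -
  have "1 - 2 / CARD('n) * s0 * (t - t1) \<noteq> 0" using barrier_denom[OF assms] by linarith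
  then show ?thesis unfolding barrier_def[abs_def]
    by (auto intro!: derivative_eq_intros simp: power2_eq_square)
qed

lemma continuous_sc_time:
  assumes c: "c \<in> A" and x: "x \<in> coord_image c"
  shows "continuous_on {t1..t2} (\<lambda>s. sc s c x)"
proof -
  have "continuous_on {t1..t2} (\<lambda>s. (s, x))"
    by (intro continuous_on_Pair continuous_on_id continuous_on_const)
  moreover have "(\<lambda>s. (s, x)) ` {t1..t2} \<subseteq> {t1..t2} \<times> coord_image c" using x by auto
  ultimately show ?thesis using continuous_on_compose2[OF continuous_sc[OF c]] by fastforce
qed

text \<open>Maximum principle. Suppose that the minimum of \<open>R - s\<close> over space and time is negative. It is attained
after \<open>t1\<close>, so there \<open>R - s\<close> does not increase in time, while \<open>R < s \<le> 0\<close> and the evolution equation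
make its time derivative at least \<open>(2/n) (R\<^sup>2 - s\<^sup>2) > 0\<close>.\<close>

lemma sc_ge_barrier:
  assumes s0: "s0 \<le> 0" and init: "\<And>c x. c \<in> A \<Longrightarrow> x \<in> coord_image c \<Longrightarrow> s0 \<le> sc t1 c x"
    and t: "t \<in> {t1..t2}" and c: "c \<in> A" and x: "x \<in> coord_image c"
  shows "barrier s0 t \<le> sc t c x"
proof -
  let ?w = "\<lambda>c t x. sc t c x - barrier s0 t"
  have cont_barrier: "continuous_on {t1..t2} (barrier s0)"
    using barrier_ode[OF s0] by (intro DERIV_continuous_on) (auto intro: has_field_derivative_at_within)
  have ne: "topspace M \<noteq> {}" using pt_in[OF x] dom_sub[OF c] by auto
  \<comment> \<open>Before \<open>t2\<close> the evolution equation holds on an open slab; the time \<open>t2\<close> is reached by continuity.\<close>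
  have early: "0 \<le> ?w d s y" if b: "b \<in> {t1..<t2}" and s: "s \<in> {t1..b}" and d: "d \<in> A" "y \<in> coord_image d" for b s d y
  proof -
    have cont: "continuous_on ({t1..b} \<times> coord_image c) (\<lambda>(t, x). ?w c t x)" if c: "c \<in> A" for c
    proof -
      have "continuous_on ({t1..b} \<times> coord_image c) (\<lambda>(t, x). sc t c x)"
        by (rule continuous_on_subset[OF continuous_sc[OF c]]) (use b in auto)
      moreover have "continuous_on ({t1..b} \<times> coord_image c) (\<lambda>z. barrier s0 (fst z))"
        by (rule continuous_on_compose2[OF cont_barrier continuous_on_fst[OF continuous_on_id]]) (use b in auto)
      ultimately show ?thesis using continuous_on_diff by (fastforce simp: case_prod_beta)
    qed
    have inv: "chart_invariant (\<lambda>c. ?w c t)" if "t \<in> {t1..b}" for t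
      using scal_invariant[OF metric[of t]] that b by (auto simp: chart_invariant_def)
    have "t1 \<le> b" using b by simp
    then obtain c0 t0 x0 where m: "c0 \<in> A" "t0 \<in> {t1..b}" "x0 \<in> coord_image c0"
      "\<And>d s y. d \<in> A \<Longrightarrow> s \<in> {t1..b} \<Longrightarrow> y \<in> coord_image d \<Longrightarrow> ?w c0 t0 x0 \<le> ?w d s y"
      by (rule attains_min[OF ne _ cont inv]) (assumption | blast)+
    have "0 \<le> ?w c0 t0 x0"
    proof (rule ccontr)
      assume neg: "\<not> 0 \<le> ?w c0 t0 x0"
      have "t0 \<noteq> t1" using neg init[OF m(1,3)] by (auto simp: barrier_def)
      then have t0: "t0 \<in> {t1<..<t2}" "t1 < t0" using m(2) b by auto
      let ?D = "ddir (1, 0) (st_scalar c0) (t0, x0)"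
      have "sc t0 c0 x0 \<le> sc t0 c0 y" if "y \<in> coord_image c0" for y
        using m(4)[OF m(1,2) that] by simp
      from sc_evolution_at_min[OF m(1) t0(1) m(3) this] sc_square_le(1)[OF m(1) t0(1) m(3)]
      have D: "2 / CARD('n) * (sc t0 c0 x0)\<^sup>2 \<le> ?D" by simp
      have bar: "barrier s0 t0 \<le> 0" using barrier_nonpos[OF s0] t0 by simp
      \<comment> \<open>Both numbers are nonpositive, so squaring reverses their order.\<close>
      have "(barrier s0 t0)\<^sup>2 < (sc t0 c0 x0)\<^sup>2"
        using neg bar abs_less_iff power2_less_imp_less[of "- barrier s0 t0" "- sc t0 c0 x0"]
          power_strict_mono[of "- barrier s0 t0" "- sc t0 c0 x0" 2] by simp
      then have "2 / CARD('n) * (barrier s0 t0)\<^sup>2 < ?D"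
        using D by (smt (verit) divide_pos_pos mult_strict_left_mono of_nat_0_less_iff zero_less_card_finite)
      then have pos: "0 < ?D - 2 / CARD('n) * (barrier s0 t0)\<^sup>2" by simp
      have "((\<lambda>s. ?w c0 s x0) has_real_derivative ?D - 2 / CARD('n) * (barrier s0 t0)\<^sup>2) (at t0)"
        by (intro DERIV_diff sc_has_derivative m t0 barrier_ode s0) (use t0 in simp)
      from DERIV_pos_inc_left[OF this pos] obtain d where d: "d > 0"
        "\<And>h. 0 < h \<Longrightarrow> h < d \<Longrightarrow> ?w c0 (t0 - h) x0 < ?w c0 t0 x0" by blast
      define h where "h = min (d / 2) (t0 - t1)"
      have h: "0 < h" "h < d" "t0 - h \<in> {t1..b}" using d(1) t0 m(2) by (auto simp: h_def)
      show False using d(2)[OF h(1,2)] m(4)[OF m(1) h(3) m(3)] by simp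
    qed
    then show ?thesis using m(4)[OF d(1) s d(2)] by simp
  qed
  have "continuous_on {t1..t2} (\<lambda>s. sc s c x)" by (rule continuous_sc_time[OF c x])
  then have "continuous_on (closure {t1..<t2}) (\<lambda>s. ?w c s x)"
    using t12 cont_barrier by (auto intro: continuous_on_diff)
  from continuous_ge_on_closure[OF this, of t 0] early[of _ _ c x] c x t t12
  show ?thesis by auto
qed

section \<open>Growth of the volume element\<close>

lemma ln_det_derivative:
  assumes c: "c \<in> A" and t: "t \<in> {t1..t2}" and x: "x \<in> coord_image c"
  shows "((\<lambda>s. ln (det (g s c x))) has_real_derivative - 2 * sc t c x) (at t within {t1..t2})"
proof -
  let ?I = "matrix_inv (g t c x)"
  have d: "det (g t c x) > 0" using pos_def_det_pos pos_def_metric[OF t c x] by blast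
  have inv: "invertible (g t c x)" using pos_def_invertible pos_def_metric[OF t c x] by blast
  have "((\<lambda>s. g s c x) has_derivative (\<lambda>h. h *\<^sub>R ((-2) *\<^sub>R ricci (g t c) x))) (at t within {t1..t2})"
    using time_derivative[OF c x t] unfolding has_vector_derivative_def .
  from has_derivative_compose[OF this det_has_derivative[OF inv]]
  have "((\<lambda>s. det (g s c x)) has_derivative
      (\<lambda>h. det (g t c x) * trace (?I ** (h *\<^sub>R ((-2) *\<^sub>R ricci (g t c) x))))) (at t within {t1..t2})" .
  moreover have "(\<lambda>h. det (g t c x) * trace (?I ** (h *\<^sub>R ((-2) *\<^sub>R ricci (g t c) x))))
      = (*) (det (g t c x) * (- 2 * sc t c x))"
    using trace_mul_sym[of ?I "ricci (g t c) x"] by (intro ext) (simp add: sc_eq[OF t c x] mult_ac)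
  ultimately have "((\<lambda>s. det (g s c x)) has_real_derivative (det (g t c x) * (- 2 * sc t c x))) (at t within {t1..t2})"
    by (simp only: has_field_derivative_def)
  from DERIV_chain2[OF DERIV_ln_divide[OF d] this] d show ?thesis by (simp add: field_simps)
qed

text \<open>\<open>log det g - n log (1 - (2/n) s0 (t - t1))\<close> has time derivative \<open>2 (s - R) \<le> 0\<close>. If it takes the same
value at both ends it is constant, and then \<open>R = s\<close> throughout.\<close>

lemma det_growth:
  assumes s0: "s0 \<le> 0" and init: "\<And>c x. c \<in> A \<Longrightarrow> x \<in> coord_image c \<Longrightarrow> s0 \<le> sc t1 c x"
    and c: "c \<in> A" and x: "x \<in> coord_image c"
  defines "q \<equiv> 1 - 2 / CARD('n) * s0 * (t2 - t1)"
  shows "det (g t2 c x) \<le> q ^ CARD('n) * det (g t1 c x)"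
    and "det (g t2 c x) = q ^ CARD('n) * det (g t1 c x) \<Longrightarrow> t \<in> {t1<..<t2} \<Longrightarrow> sc t c x = barrier s0 t"
proof -
  let ?n = "real CARD('n)"
  let ?q = "\<lambda>t. 1 - 2 / ?n * s0 * (t - t1)"
  define \<phi> where "\<phi> t = ln (det (g t c x)) - ?n * ln (?q t)" for t
  have q1: "1 \<le> ?q t" if "t1 \<le> t" for t using barrier_denom[OF s0 that] .
  have det: "det (g t c x) > 0" if "t \<in> {t1..t2}" for t using pos_def_det_pos pos_def_metric[OF that c x] by blast
  have der: "(\<phi> has_real_derivative 2 * (barrier s0 t - sc t c x)) (at t within {t1..t2})" if t: "t \<in> {t1..t2}" for t
  proof -
    have "((\<lambda>t. ?n * ln (?q t)) has_real_derivative - 2 * barrier s0 t) (at t within {t1..t2})"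
    proof -
      have "(?q has_real_derivative - (2 / ?n * s0)) (at t within {t1..t2})"
        by (auto intro!: derivative_eq_intros)
      moreover have "0 < ?q t" by (rule less_le_trans[OF zero_less_one q1]) (use t in simp)
      ultimately have "((\<lambda>t. ln (?q t)) has_real_derivative 1 / ?q t * - (2 / ?n * s0)) (at t within {t1..t2})"
        by (intro DERIV_chain2[OF DERIV_ln_divide])
      from DERIV_cmult[OF this, of ?n] show ?thesis by (simp add: barrier_def)
    qed
    from DERIV_diff[OF ln_det_derivative[OF c t x] this] show ?thesis
      unfolding \<phi>_def[abs_def] by (simp add: algebra_simps)
  qed
  have der': "(\<phi> has_real_derivative 2 * (barrier s0 t - sc t c x)) (at t)" if t: "t \<in> {t1<..<t2}" for t
    using der[of t] t by (simp add: at_within_Icc_at)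
  have cont: "continuous_on {t1..t2} \<phi>" using der by (rule DERIV_continuous_on)
  have mono: "\<phi> b \<le> \<phi> a" if "t1 \<le> a" "a \<le> b" "b \<le> t2" for a b
  proof (rule DERIV_nonpos_imp_decreasing_open[OF that(2)])
    show "\<exists>y. (\<phi> has_real_derivative y) (at t) \<and> y \<le> 0" if "a < t" "t < b" for t
      using der'[of t] sc_ge_barrier[OF s0 init _ c x, of t] that \<open>t1 \<le> a\<close> \<open>b \<le> t2\<close> by force
    show "continuous_on {a..b} \<phi>" by (rule continuous_on_subset[OF cont]) (use that in auto)
  qed
  have \<phi>1: "\<phi> t1 = ln (det (g t1 c x))" by (simp add: \<phi>_def)
  have qpos: "q > 0" unfolding q_def by (rule less_le_trans[OF zero_less_one q1]) (use t12 in simp)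
  have prod: "ln (q ^ CARD('n) * det (g t1 c x)) = ?n * ln q + ln (det (g t1 c x))"
    using qpos det[of t1] t12 by (simp add: ln_mult ln_realpow)
  have \<phi>2: "\<phi> t2 = ln (det (g t2 c x)) - ?n * ln q" by (simp add: \<phi>_def q_def)
  have pos: "q ^ CARD('n) * det (g t1 c x) > 0" using qpos det[of t1] t12 by simp
  have "ln (det (g t2 c x)) \<le> ln (q ^ CARD('n) * det (g t1 c x))"
    using mono[of t1 t2] t12 unfolding prod \<phi>1 \<phi>2 by simp
  then show "det (g t2 c x) \<le> q ^ CARD('n) * det (g t1 c x)"
    using pos det[of t2] t12 by simp
  assume eq: "det (g t2 c x) = q ^ CARD('n) * det (g t1 c x)" and t: "t \<in> {t1<..<t2}"
  have "\<phi> t2 = \<phi> t1" unfolding \<phi>1 \<phi>2 eq prod by simp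
  then have const: "\<phi> s = \<phi> t1" if "s \<in> {t1<..<t2}" for s
    using mono[of t1 s] mono[of s t2] that by simp
  have "((\<lambda>_. \<phi> t1) has_real_derivative 2 * (barrier s0 t - sc t c x)) (at t)"
    by (rule has_field_derivative_transform_within_open[OF der'[OF t], of "{t1<..<t2}"]) (use t const in auto)
  then have "2 * (barrier s0 t - sc t c x) = 0" using DERIV_unique DERIV_const by blast
  then show "sc t c x = barrier s0 t" by simp
qed

end

section \<open>Change of variables\<close>

text \<open>The change of variables formula for integrals is stated for spaces whose index type is
well-ordered. Every finite type has a copy with such an order, and permuting coordinates preserves
both Lebesgue measure and determinants, so the formula holds for every finite index type.\<close>

typedef 'a ordered_copy = "UNIV :: 'a set" by simp

lemma bij_Rep_ordered_copy: "bij Rep_ordered_copy"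
  by (metis Abs_ordered_copy_inverse Rep_ordered_copy_inverse UNIV_I bijI')

instance ordered_copy :: (finite) finite
proof
  have "inj (Rep_ordered_copy :: 'a ordered_copy \<Rightarrow> 'a)" by (rule bij_is_inj[OF bij_Rep_ordered_copy])
  then show "finite (UNIV :: 'a ordered_copy set)"
    by (rule finite_imageD[OF finite])
qed

definition copy_index :: "'a::finite ordered_copy \<Rightarrow> nat" where
  "copy_index = (SOME f. inj f)"

lemma inj_copy_index: "inj (copy_index :: 'a::finite ordered_copy \<Rightarrow> nat)"
proof -
  have "\<exists>f :: 'a ordered_copy \<Rightarrow> nat. inj f" 
    using finite_imp_inj_to_nat_seg[of "UNIV :: 'a ordered_copy set"] finite by metis
  then show ?thesis unfolding copy_index_def by (rule someI_ex)
qed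

instantiation ordered_copy :: (finite) wellorder
begin

definition less_eq_ordered_copy :: "'a ordered_copy \<Rightarrow> 'a ordered_copy \<Rightarrow> bool" where
  "x \<le> y \<longleftrightarrow> copy_index x \<le> copy_index y"

definition less_ordered_copy :: "'a ordered_copy \<Rightarrow> 'a ordered_copy \<Rightarrow> bool" where
  "x < y \<longleftrightarrow> copy_index x < copy_index y"

instance
proof
  fix x y z :: "'a ordered_copy"
  show "x < y \<longleftrightarrow> x \<le> y \<and> \<not> y \<le> x" "x \<le> x" "x \<le> y \<or> y \<le> x"
    "x \<le> y \<Longrightarrow> y \<le> z \<Longrightarrow> x \<le> z"
    by (auto simp: less_eq_ordered_copy_def less_ordered_copy_def)
  show "x \<le> y \<Longrightarrow> y \<le> x \<Longrightarrow> x = y"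
    using inj_copy_index by (auto simp: less_eq_ordered_copy_def inj_def)
next
  fix P :: "'a ordered_copy \<Rightarrow> bool" and a
  assume "\<And>x. (\<And>y. y < x \<Longrightarrow> P y) \<Longrightarrow> P x"
  then show "P a" unfolding less_ordered_copy_def by (rule measure_induct_rule[of copy_index])
qed

end

definition reindex :: "('m \<Rightarrow> 'n) \<Rightarrow> real^'n::finite \<Rightarrow> real^'m::finite" where
  "reindex \<pi> v = (\<chi> i. v $ \<pi> i)"

lemma reindex_inverse: "\<pi> \<circ> \<sigma> = id \<Longrightarrow> reindex \<sigma> (reindex \<pi> v) = v"
  by (simp add: reindex_def vec_eq_iff fun_eq_iff)

lemma bounded_linear_reindex: "bounded_linear (reindex \<pi>)"
  unfolding linear_conv_bounded_linear[symmetric]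
  by (auto intro!: linearI simp: reindex_def vec_eq_iff)

lemma measurable_reindex: "reindex \<pi> \<in> borel_measurable borel"
  by (intro borel_measurable_continuous_onI linear_continuous_on bounded_linear_reindex)

lemma prod_Basis_cart: "(\<Prod>b\<in>Basis. (v :: real^'n) \<bullet> b) = (\<Prod>i\<in>UNIV. v $ i)"
proof -
  have B: "(Basis :: (real^'n) set) = range (\<lambda>i. axis i 1)" by (auto simp: Basis_vec_def)
  have inj: "inj (\<lambda>i. axis i 1 :: real^'n)" by (auto simp: inj_def axis_eq_axis)
  show ?thesis unfolding B prod.reindex[OF inj] by (simp add: inner_axis)
qed

lemma lborel_reindex:
  fixes \<pi> :: "'m::finite \<Rightarrow> 'n::finite"
  assumes \<pi>: "bij \<pi>"
  shows "distr lborel borel (reindex \<pi>) = lborel"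
proof (rule lborel_eqI[symmetric])
  fix l u :: "real^'m" assume le: "\<And>b. b \<in> Basis \<Longrightarrow> l \<bullet> b \<le> u \<bullet> b"
  have le': "l $ i \<le> u $ i" for i using le[of "axis i 1"] by (simp add: inner_axis axis_in_Basis_iff)
  have "reindex \<pi> -` box l u = box (reindex (inv \<pi>) l) (reindex (inv \<pi>) u)"
    using \<pi> by (auto simp: mem_box_cart reindex_def bij_is_inj bij_is_surj surj_f_inv_f inv_f_f)
      (metis bij_inv_eq_iff)+
  then have "emeasure (distr lborel borel (reindex \<pi>)) (box l u)
     = emeasure lborel (box (reindex (inv \<pi>) l) (reindex (inv \<pi>) u))"
    using measurable_reindex[of \<pi>] by (simp add: emeasure_distr)
  also have "\<dots> = (\<Prod>b\<in>Basis. (reindex (inv \<pi>) u - reindex (inv \<pi>) l) \<bullet> b)"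
    by (subst emeasure_lborel_box) (auto simp: Basis_vec_def inner_axis reindex_def le')
  also have "\<dots> = ennreal (\<Prod>i\<in>UNIV. (u - l) $ (inv \<pi> i))"
    by (simp add: prod_Basis_cart reindex_def)
  also have "(\<Prod>i\<in>UNIV. (u - l) $ (inv \<pi> i)) = (\<Prod>i\<in>UNIV. (u - l) $ i)"
    using bij_betw_imp_surj_on[OF bij_imp_bij_inv[OF \<pi>]] by (intro prod.reindex_bij_betw bij_imp_bij_inv \<pi>)
  finally show "emeasure (distr lborel borel (reindex \<pi>)) (box l u) = (\<Prod>b\<in>Basis. (u - l) \<bullet> b)"
    by (simp add: prod_Basis_cart)
qed simp

lemma nn_integral_reindex:
  assumes "bij \<pi>" "f \<in> borel_measurable borel"
  shows "(\<integral>\<^sup>+x. f (reindex \<pi> x) \<partial>lborel) = (\<integral>\<^sup>+y. f y \<partial>lborel)"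
  using nn_integral_distr[of "reindex \<pi>" lborel borel f] measurable_reindex[of \<pi>] assms lborel_reindex[OF assms(1)]
  by simp

lemma det_reindex:
  fixes A :: "real^'n^'n" and \<pi> :: "'m::finite \<Rightarrow> 'n::finite"
  assumes \<pi>: "bij \<pi>"
  shows "det (\<chi> i j. A $ \<pi> i $ \<pi> j) = det A"
proof -
  have inj: "inj \<pi>" and range: "\<pi> ` UNIV = UNIV" using \<pi> by (auto simp: bij_def)
  have eq: "map_permutation UNIV \<pi> p (\<pi> i) = \<pi> (p i)" for p i
    by (rule map_permutation_apply) (use inj in auto)
  have bij: "bij_betw (map_permutation UNIV \<pi>) {p. p permutes UNIV} {p. p permutes UNIV}"
  proof (rule bij_betwI')
    fix p q assume "p \<in> {p :: 'm \<Rightarrow> 'm. p permutes UNIV}" "q \<in> {p :: 'm \<Rightarrow> 'm. p permutes UNIV}"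
    show "(map_permutation UNIV \<pi> p = map_permutation UNIV \<pi> q) = (p = q)"
      using eq inj by (metis ext injD)
  next
    fix p assume "p \<in> {p :: 'm \<Rightarrow> 'm. p permutes UNIV}"
    then show "map_permutation UNIV \<pi> p \<in> {p. p permutes UNIV}"
      using map_permutation_permutes[of \<pi> UNIV UNIV p] \<pi> by simp
  next
    fix q assume q: "q \<in> {p :: 'n \<Rightarrow> 'n. p permutes UNIV}"
    have b: "bij (inv \<pi>)" by (rule bij_imp_bij_inv[OF \<pi>])
    have "map_permutation UNIV (inv \<pi>) q permutes UNIV"
      using map_permutation_permutes[of "inv \<pi>" UNIV UNIV q] b q by simp
    moreover have "map_permutation UNIV \<pi> (map_permutation UNIV (inv \<pi>) q) = q"
      by (rule map_permutation_compose_inv) (use b q \<pi> in \<open>auto simp: bij_is_surj surj_f_inv_f\<close>)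
    ultimately show "\<exists>p\<in>{p. p permutes UNIV}. q = map_permutation UNIV \<pi> p" by force
  qed
  have "det A = (\<Sum>p | p permutes (UNIV :: 'm set).
      of_int (sign (map_permutation UNIV \<pi> p)) * (\<Prod>i\<in>UNIV. A $ i $ map_permutation UNIV \<pi> p i))"
    unfolding det_def by (rule sum.reindex_bij_betw[OF bij, symmetric])
  also have "\<dots> = (\<Sum>p | p permutes (UNIV :: 'm set). of_int (sign p) * (\<Prod>i\<in>UNIV. A $ \<pi> i $ \<pi> (p i)))"
  proof (rule sum.cong[OF refl])
    fix p assume p: "p \<in> {p. p permutes (UNIV :: 'm set)}"
    have "(\<Prod>i\<in>UNIV. A $ i $ map_permutation UNIV \<pi> p i) = (\<Prod>i\<in>UNIV. A $ \<pi> i $ map_permutation UNIV \<pi> p (\<pi> i))"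
      by (rule prod.reindex_bij_betw[OF \<pi>, symmetric])
    then show "of_int (sign (map_permutation UNIV \<pi> p)) * (\<Prod>i\<in>UNIV. A $ i $ map_permutation UNIV \<pi> p i)
      = of_int (sign p) * (\<Prod>i\<in>UNIV. A $ \<pi> i $ \<pi> (p i))"
      using sign_map_permutation[of \<pi> UNIV p] inj p by (simp add: eq)
  qed
  finally show ?thesis by (simp add: det_def)
qed

lemma nn_change_of_variables_wellorder:
  fixes F :: "real^'m::{finite,wellorder} \<Rightarrow> real^'m::_" and \<rho> :: "real^'m::_ \<Rightarrow> real"
  assumes S: "S \<in> sets borel" and der: "\<And>x. x \<in> S \<Longrightarrow> (F has_derivative F' x) (at x within S)"
    and inj: "inj_on F S" and pos: "\<And>y. 0 \<le> \<rho> y"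
    and meas: "(\<lambda>y. indicator (F ` S) y * \<rho> y) \<in> borel_measurable borel"
    and fin: "(\<integral>\<^sup>+y. ennreal (indicator (F ` S) y * \<rho> y) \<partial>lborel) < \<infinity>"
  shows "(\<integral>\<^sup>+x. ennreal (indicator S x * (\<bar>det (matrix (F' x))\<bar> * \<rho> (F x))) \<partial>lborel)
    = (\<integral>\<^sup>+y. ennreal (indicator (F ` S) y * \<rho> y) \<partial>lborel)"
proof -
  obtain I where I: "(\<integral>\<^sup>+y. ennreal (indicator (F ` S) y * \<rho> y) \<partial>lborel) = ennreal I" "0 \<le> I"
    using fin by (cases "\<integral>\<^sup>+y. ennreal (indicator (F ` S) y * \<rho> y) \<partial>lborel" rule: ennreal_cases) auto
  have "((\<lambda>y. indicator (F ` S) y * \<rho> y) has_integral I) UNIV"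
    by (rule nn_integral_has_integral[OF meas _ I]) (simp add: pos)
  moreover have "(\<lambda>y. indicator (F ` S) y * \<rho> y) = (\<lambda>y. if y \<in> F ` S then \<rho> y else 0)"
    by (auto simp: indicator_def)
  ultimately have hi: "(\<rho> has_integral I) (F ` S)" by (simp only: has_integral_restrict_UNIV)
  then have abs: "\<rho> absolutely_integrable_on (F ` S)"
    by (intro nonnegative_absolutely_integrable_1) (auto simp: pos)
  have "(\<lambda>x. \<bar>det (matrix (F' x))\<bar> *\<^sub>R (vec (\<rho> (F x)) :: real^1)) absolutely_integrable_on S \<and>
     integral S (\<lambda>x. \<bar>det (matrix (F' x))\<bar> *\<^sub>R (vec (\<rho> (F x)) :: real^1)) = vec I \<longleftrightarrow>
     (\<lambda>y. vec (\<rho> y) :: real^1) absolutely_integrable_on (F ` S) \<and> integral (F ` S) (\<lambda>y. vec (\<rho> y) :: real^1) = vec I"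
    by (rule has_absolute_integral_change_of_variables[OF _ der inj]) (use S in auto)
  then have "(\<lambda>x. \<bar>det (matrix (F' x))\<bar> * \<rho> (F x)) absolutely_integrable_on S \<and>
     integral S (\<lambda>x. \<bar>det (matrix (F' x))\<bar> * \<rho> (F x)) = I"
    using abs integral_unique[OF hi] by (simp add: absolutely_integrable_on_1_iff integral_on_1_eq)
  then have "((\<lambda>x. \<bar>det (matrix (F' x))\<bar> * \<rho> (F x)) has_integral I) S"
    by (simp add: absolutely_integrable_on_def has_integral_iff)
  from nn_integral_has_integral_lebesgue[OF _ this] show ?thesis by (simp add: I pos)
qed

text \<open>Conjugate \<open>F\<close> by the measure-preserving renaming of coordinates.\<close>

lemma nn_change_of_variables:
  fixes F :: "real^'n::finite \<Rightarrow> real^'n" and \<rho> :: "real^'n \<Rightarrow> real"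
  assumes S: "S \<in> sets borel" and der: "\<And>x. x \<in> S \<Longrightarrow> (F has_derivative F' x) (at x within S)"
    and inj: "inj_on F S" and pos: "\<And>y. 0 \<le> \<rho> y"
    and meas: "(\<lambda>y. indicator (F ` S) y * \<rho> y) \<in> borel_measurable borel"
    and meas': "(\<lambda>x. indicator S x * (\<bar>det (matrix (F' x))\<bar> * \<rho> (F x))) \<in> borel_measurable borel"
    and fin: "(\<integral>\<^sup>+y. ennreal (indicator (F ` S) y * \<rho> y) \<partial>lborel) < \<infinity>"
  shows "(\<integral>\<^sup>+x. ennreal (indicator S x * (\<bar>det (matrix (F' x))\<bar> * \<rho> (F x))) \<partial>lborel)
    = (\<integral>\<^sup>+y. ennreal (indicator (F ` S) y * \<rho> y) \<partial>lborel)"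
proof -
  define \<pi> where "\<pi> = (Rep_ordered_copy :: 'n ordered_copy \<Rightarrow> 'n)"
  define \<sigma> where "\<sigma> = inv \<pi>"
  have b: "bij \<pi>" "bij \<sigma>" using bij_Rep_ordered_copy bij_imp_bij_inv by (auto simp: \<pi>_def \<sigma>_def)
  have id: "\<pi> \<circ> \<sigma> = id" "\<sigma> \<circ> \<pi> = id"
    using surj_iff[of \<pi>] bij_is_surj[OF b(1)] inv_o_cancel[OF bij_is_inj[OF b(1)]] by (auto simp: \<sigma>_def)
  let ?C = "reindex \<pi> :: real^'n \<Rightarrow> real^'n ordered_copy" and ?D = "reindex \<sigma> :: real^'n ordered_copy \<Rightarrow> real^'n"
  have DC: "?D (?C v) = v" and CD: "?C (?D w) = w" for v w
    using reindex_inverse id by blast+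
  let ?S = "?D -` S" and ?F = "\<lambda>y. ?C (F (?D y))" and ?F' = "\<lambda>y v. ?C (F' (?D y) (?D v))"
  have FS: "?F ` ?S = ?D -` (F ` S)"
  proof
    show "?F ` ?S \<subseteq> ?D -` (F ` S)" by (auto simp: DC)
    show "?D -` (F ` S) \<subseteq> ?F ` ?S"
    proof
      fix y assume "y \<in> ?D -` (F ` S)"
      then obtain s where s: "s \<in> S" "?D y = F s" by auto
      then have "y = ?F (?C s)" using CD[of y] by (simp add: DC)
      moreover have "?C s \<in> ?S" using s by (simp add: DC)
      ultimately show "y \<in> ?F ` ?S" by (rule image_eqI)
    qed
  qed
  have ind: "indicator (?F ` ?S) y = (indicator (F ` S) (?D y) :: real)"
    "indicator ?S y = (indicator S (?D y) :: real)" for y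
    unfolding FS by (auto simp: indicator_def)
  have det: "det (matrix (?F' y)) = det (matrix (F' (?D y)))" for y
  proof -
    have "?D (axis j 1) = axis (\<pi> j) 1" for j
    proof -
      have "\<sigma> i = j \<longleftrightarrow> i = \<pi> j" for i
        using fun_cong[OF id(1), of i] fun_cong[OF id(2), of j] by auto
      then show ?thesis by (simp add: reindex_def axis_def vec_eq_iff eq_commute)
    qed
    then have "matrix (?F' y) = (\<chi> i j. matrix (F' (?D y)) $ \<pi> i $ \<pi> j)"
      by (simp add: matrix_def reindex_def)
    then show ?thesis by (simp add: det_reindex[OF b(1)])
  qed
  have meas_D: "(\<lambda>y. h (?D y)) \<in> borel_measurable borel" if "h \<in> borel_measurable borel" for h :: "real^'n \<Rightarrow> real"
    using measurable_compose[OF measurable_reindex that] .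
  have "(\<integral>\<^sup>+y. ennreal (indicator ?S y * (\<bar>det (matrix (?F' y))\<bar> * \<rho> (?D (?F y)))) \<partial>lborel)
    = (\<integral>\<^sup>+y. ennreal (indicator (?F ` ?S) y * \<rho> (?D y)) \<partial>lborel)"
  proof (rule nn_change_of_variables_wellorder)
    show "?S \<in> sets borel" using measurable_sets[OF measurable_reindex S, of \<sigma>] by simp
    show "(?F has_derivative ?F' y) (at y within ?S)" if "y \<in> ?S" for y
    proof -
      have "(?D has_derivative ?D) (at y within ?S)"
        by (rule bounded_linear_imp_has_derivative[OF bounded_linear_reindex])
      moreover have "(F has_derivative F' (?D y)) (at (?D y) within ?D ` ?S)"
        using der[of "?D y"] that by (auto intro: has_derivative_subset)
      ultimately show ?thesis
        using bounded_linear.has_derivative[OF bounded_linear_reindex] has_derivative_in_compose by blast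
    qed
    show "inj_on ?F ?S"
    proof (rule inj_onI)
      fix y z assume yz: "y \<in> ?S" "z \<in> ?S" and "?F y = ?F z"
      then have "?D (?F y) = ?D (?F z)" by simp
      then have "F (?D y) = F (?D z)" by (simp only: DC)
      then have "?D y = ?D z" using inj yz by (simp add: inj_on_def)
      then have "?C (?D y) = ?C (?D z)" by simp
      then show "y = z" by (simp only: CD)
    qed
    show "0 \<le> \<rho> (?D y)" for y by (rule pos)
    show "(\<lambda>y. indicator (?F ` ?S) y * \<rho> (?D y)) \<in> borel_measurable borel"
      unfolding ind using meas_D[OF meas] .
    have "(\<integral>\<^sup>+y. ennreal (indicator (F ` S) (?D y) * \<rho> (?D y)) \<partial>lborel)
        = (\<integral>\<^sup>+y. ennreal (indicator (F ` S) y * \<rho> y) \<partial>lborel)"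
      by (rule nn_integral_reindex[OF b(2)]) (use meas in simp)
    with fin show "(\<integral>\<^sup>+y. ennreal (indicator (?F ` ?S) y * \<rho> (?D y)) \<partial>lborel) < \<infinity>"
      unfolding ind by simp
  qed
  moreover have "(\<integral>\<^sup>+y. ennreal (indicator (F ` S) (?D y) * \<rho> (?D y)) \<partial>lborel)
      = (\<integral>\<^sup>+y. ennreal (indicator (F ` S) y * \<rho> y) \<partial>lborel)"
    by (rule nn_integral_reindex[OF b(2)]) (use meas in simp)
  moreover have "(\<integral>\<^sup>+y. ennreal (indicator S (?D y) * (\<bar>det (matrix (F' (?D y)))\<bar> * \<rho> (F (?D y)))) \<partial>lborel)
      = (\<integral>\<^sup>+x. ennreal (indicator S x * (\<bar>det (matrix (F' x))\<bar> * \<rho> (F x))) \<partial>lborel)"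
    by (rule nn_integral_reindex[OF b(2)]) (use meas' in simp)
  ultimately show ?thesis unfolding ind det DC by simp
qed

section \<open>Volume\<close>

context closed_manifold
begin

text \<open>A class of Borel sets that contains the pieces below and is stable under intersections and under
preimages by continuous maps. Charts map such sets to Borel sets, being injective and open.\<close>

definition open_diff :: "'a set \<Rightarrow> bool" where
  "open_diff S \<longleftrightarrow> (\<exists>U V. openin M U \<and> openin M V \<and> S = U - V)"

lemma open_diff_Int: "open_diff S \<Longrightarrow> open_diff T \<Longrightarrow> open_diff (S \<inter> T)"
proof -
  assume "open_diff S" "open_diff T"
  then obtain U V U' V' where "openin M U" "openin M V" "openin M U'" "openin M V'" "S = U - V" "T = U' - V'"
    unfolding open_diff_def by metis
  then have "openin M (U \<inter> U')" "openin M (V \<union> V')" "S \<inter> T = (U \<inter> U') - (V \<union> V')" by auto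
  then show ?thesis unfolding open_diff_def by blast
qed

lemma open_diff_preimage:
  assumes F: "continuous_map M M F" and S: "open_diff S"
  shows "open_diff {p \<in> topspace M. F p \<in> S}"
proof -
  obtain U V where UV: "openin M U" "openin M V" "S = U - V" using S unfolding open_diff_def by metis
  have "{p \<in> topspace M. F p \<in> S} = {p \<in> topspace M. F p \<in> U} - {p \<in> topspace M. F p \<in> V}"
    using UV by auto
  then show ?thesis unfolding open_diff_def
    using openin_continuous_map_preimage[OF F] UV by blast
qed

lemma open_diff_borel:
  assumes c: "c \<in> A" and S: "open_diff S" "S \<subseteq> fst c"
  shows "snd c ` S \<in> sets borel"
proof -
  obtain U V where UV: "openin M U" "openin M V" "S = U - V" using S unfolding open_diff_def by metis
  have "S = (fst c \<inter> U) - (fst c \<inter> V)" using S(2) UV(3) by auto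
  then have "snd c ` S = snd c ` (fst c \<inter> U) - snd c ` (fst c \<inter> V)"
    using inj_on_image_set_diff[OF inj_crd[OF c], of "fst c \<inter> U" "fst c \<inter> V"] by auto
  then show ?thesis using open_crd[OF c UV(1)] open_crd[OF c UV(2)] by (auto intro: borel_open)
qed

text \<open>A finite decomposition of the manifold into disjoint sets \<open>B k\<close>, each in the domain of one chart
\<open>c k\<close> and with relatively compact coordinate image, so that continuous densities have finite integral.\<close>

definition pieces :: "nat \<Rightarrow> (nat \<Rightarrow> ('a, 'n) chart) \<Rightarrow> (nat \<Rightarrow> 'a set) \<Rightarrow> bool" where
  "pieces N c B \<longleftrightarrow> (\<forall>k<N. c k \<in> A \<and> open_diff (B k) \<and> B k \<subseteq> fst (c k) \<and>
      (\<exists>K. compact K \<and> K \<subseteq> coord_image (c k) \<and> snd (c k) ` B k \<subseteq> K)) \<and>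
    disjoint_family_on B {..<N} \<and> (\<Union>k<N. B k) = topspace M"

text \<open>Make a finite cover by coordinate balls disjoint by removing from each ball the earlier ones. The
ball that comes first is left untouched, and it can be taken around a given point in a given chart.\<close>

lemma exists_pieces:
  assumes c0: "c0 \<in> A" and p: "p \<in> fst c0"
  obtains N c B where "pieces N c B" "0 < N" "c 0 = c0" "p \<in> B 0" "openin M (B 0)"
proof -
  obtain K :: "(('a, 'n) chart \<times> (real^'n) \<times> real) set" where K: "finite K"
    "\<And>c x r. (c, x, r) \<in> K \<Longrightarrow> c \<in> A \<and> 0 < r \<and> cball x r \<subseteq> coord_image c"
    "\<And>p. p \<in> topspace M \<Longrightarrow> \<exists>c x r. (c, x, r) \<in> K \<and> p \<in> fst c \<and> snd c p \<in> ball x r"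
    by (rule finite_ball_cover) blast
  obtain r0 where r0: "r0 > 0" "cball (snd c0 p) r0 \<subseteq> coord_image c0"
    using open_coord_image[OF c0] crd_in[OF p] open_contains_cball by blast
  obtain ks where ks: "set ks = K" using finite_list[OF K(1)] by blast
  define xs where "xs = (c0, snd c0 p, r0) # ks"
  define N where "N = length xs"
  define c where "c k = fst (xs ! k)" for k
  define x where "x k = fst (snd (xs ! k))" for k
  define r where "r k = snd (snd (xs ! k))" for k
  have tr: "(c k, x k, r k) = xs ! k" for k by (simp add: c_def x_def r_def)
  have good: "c k \<in> A" "0 < r k" "cball (x k) (r k) \<subseteq> coord_image (c k)" if "k < N" for k
  proof -
    have "(c k, x k, r k) \<in> set xs" unfolding tr using that by (simp add: N_def)
    then have "(c k, x k, r k) = (c0, snd c0 p, r0) \<or> (c k, x k, r k) \<in> K" by (simp add: xs_def ks)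
    then show "c k \<in> A" "0 < r k" "cball (x k) (r k) \<subseteq> coord_image (c k)"
      using K(2)[of "c k" "x k" "r k"] c0 r0 by auto
  qed
  have sub: "ball (x k) (r k) \<subseteq> coord_image (c k)" if "k < N" for k
    using good(3)[OF that] ball_subset_cball by blast
  define Q where "Q k = pt (c k) ` ball (x k) (r k)" for k
  have Qopen: "openin M (Q k)" if "k < N" for k
    unfolding Q_def by (rule open_pt[OF good(1)[OF that] open_ball sub[OF that]])
  have Qdom: "Q k \<subseteq> fst (c k)" if "k < N" for k
    unfolding Q_def by (intro image_subsetI pt_in) (use sub[OF that] in blast)
  have Qball: "snd (c k) ` Q k \<subseteq> cball (x k) (r k)" if "k < N" for k
  proof
    fix y assume "y \<in> snd (c k) ` Q k"
    then obtain z where z: "z \<in> ball (x k) (r k)" "y = snd (c k) (pt (c k) z)" by (auto simp: Q_def)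
    then show "y \<in> cball (x k) (r k)" using crd_pt[of z "c k"] sub[OF that] by auto
  qed
  define B where "B k = Q k - (\<Union>j<k. Q j)" for k
  have cover: "\<exists>k<N. q \<in> Q k" if q: "q \<in> topspace M" for q
  proof -
    obtain c' x' r' where k': "(c', x', r') \<in> K" "q \<in> fst c'" "snd c' q \<in> ball x' r'" using K(3)[OF q] by blast
    then obtain k where k: "k < N" "xs ! k = (c', x', r')"
      unfolding N_def by (metis in_set_conv_nth ks list.set_intros(2) xs_def)
    then have "c k = c'" "x k = x'" "r k = r'" by (auto simp: c_def x_def r_def)
    then have "q \<in> Q k" unfolding Q_def using k' pt_crd[of c' q] K(2)[OF k'(1)] by (intro image_eqI[of _ _ "snd c' q"]) auto
    with k show ?thesis by blast
  qed
  have "pieces N c B"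
    unfolding pieces_def
  proof (intro conjI allI impI)
    fix k assume k: "k < N"
    show "c k \<in> A" by (rule good(1)[OF k])
    have "openin M (\<Union>j<k. Q j)" using Qopen k by (intro openin_Union) auto
    then show "open_diff (B k)" unfolding open_diff_def B_def using Qopen[OF k] by blast
    show "B k \<subseteq> fst (c k)" using Qdom[OF k] by (auto simp: B_def)
    show "\<exists>K. compact K \<and> K \<subseteq> coord_image (c k) \<and> snd (c k) ` B k \<subseteq> K"
      using Qball[OF k] good(3)[OF k] by (intro exI[of _ "cball (x k) (r k)"]) (auto simp: B_def)
  next
    show "disjoint_family_on B {..<N}"
      unfolding disjoint_family_on_def
    proof (intro ballI impI)
      fix m n :: nat assume "m \<noteq> n"
      then consider "m < n" | "n < m" by linarith
      then show "B m \<inter> B n = {}" by cases (auto simp: B_def)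
    qed
    show "(\<Union>k<N. B k) = topspace M"
    proof
      show "(\<Union>k<N. B k) \<subseteq> topspace M" using Qopen openin_subset unfolding B_def by blast
      show "topspace M \<subseteq> (\<Union>k<N. B k)"
      proof
        fix q assume "q \<in> topspace M"
        from cover[OF this] obtain k where k: "k < N" "q \<in> Q k" by blast
        define m where "m = (LEAST k. q \<in> Q k)"
        have m: "q \<in> Q m" "m \<le> k" "\<And>j. j < m \<Longrightarrow> q \<notin> Q j"
          using k(2) LeastI[of "\<lambda>k. q \<in> Q k"] Least_le[of "\<lambda>k. q \<in> Q k"] not_less_Least by (auto simp: m_def)
        then show "q \<in> (\<Union>k<N. B k)" using k(1) by (auto simp: B_def intro!: bexI[of _ m])
      qed
    qed
  qed
  moreover have "0 < N" by (simp add: N_def xs_def)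
  moreover have "c 0 = c0" "B 0 = pt c0 ` ball (snd c0 p) r0"
    by (auto simp: c_def B_def Q_def x_def r_def xs_def)
  moreover have "p \<in> pt c0 ` ball (snd c0 p) r0"
    using pt_crd[OF c0 p] r0(1) by (metis centre_in_ball image_eqI)
  moreover have "openin M (B 0)" using Qopen[of 0] \<open>0 < N\<close> by (simp add: B_def)
  ultimately show ?thesis using that by metis
qed

definition vol :: "(('a, 'n) chart \<Rightarrow> real^'n \<Rightarrow> real) \<Rightarrow> ('a, 'n) chart \<Rightarrow> 'a set \<Rightarrow> ennreal" where
  "vol \<rho> c S = (\<integral>\<^sup>+x. ennreal (indicator (snd c ` S) x * \<rho> c x) \<partial>lborel)"

definition chart_density :: "(('a, 'n) chart \<Rightarrow> real^'n \<Rightarrow> real) \<Rightarrow> bool" where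
  "chart_density \<rho> \<longleftrightarrow> (\<forall>c x. 0 \<le> \<rho> c x) \<and> (\<forall>c\<in>A. continuous_on (coord_image c) (\<rho> c))"

lemma density_nonneg: "chart_density \<rho> \<Longrightarrow> 0 \<le> \<rho> c x"
  unfolding chart_density_def by blast

lemma density_continuous: "chart_density \<rho> \<Longrightarrow> c \<in> A \<Longrightarrow> S \<subseteq> coord_image c \<Longrightarrow> continuous_on S (\<rho> c)"
  unfolding chart_density_def by (blast intro: continuous_on_subset)

lemma density_measurable:
  assumes \<rho>: "chart_density \<rho>" and c: "c \<in> A" and S: "open_diff S" "S \<subseteq> fst c"
  shows "(\<lambda>x. indicator (snd c ` S) x * \<rho> c x) \<in> borel_measurable borel"
proof -
  have "continuous_on (snd c ` S) (\<rho> c)"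
    by (rule density_continuous[OF \<rho> c]) (use S(2) in \<open>auto simp: coord_image_eq\<close>)
  from borel_measurable_continuous_on_indicator[OF open_diff_borel[OF c S] this] show ?thesis by simp
qed

lemma vol_finite:
  assumes \<rho>: "chart_density \<rho>" and c: "c \<in> A"
    and K: "compact K" "K \<subseteq> coord_image c" "snd c ` S \<subseteq> K"
  shows "vol \<rho> c S < \<infinity>"
proof -
  have "continuous_on K (\<rho> c)" by (rule density_continuous[OF \<rho> c K(2)])
  then have "bounded (\<rho> c ` K)" using compact_continuous_image[of K "\<rho> c"] K(1) compact_imp_bounded by blast
  then obtain m where m: "\<And>x. x \<in> K \<Longrightarrow> \<bar>\<rho> c x\<bar> \<le> m" unfolding bounded_iff by auto
  have "vol \<rho> c S \<le> (\<integral>\<^sup>+x. ennreal \<bar>m\<bar> * indicator K x \<partial>lborel)"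
    unfolding vol_def
  proof (rule nn_integral_mono)
    show "ennreal (indicator (snd c ` S) x * \<rho> c x) \<le> ennreal \<bar>m\<bar> * indicator K x" for x
      using m[of x] K(3) by (auto simp: indicator_def intro!: ennreal_leI)
  qed
  also have "\<dots> = ennreal \<bar>m\<bar> * emeasure lborel K"
    using K(1) by (intro nn_integral_cmult_indicator) (auto intro: borel_compact)
  also have "\<dots> < \<infinity>" using emeasure_compact_finite[OF K(1)] by (simp add: ennreal_mult_less_top)
  finally show ?thesis .
qed

lemma vol_split:
  fixes N :: nat
  assumes \<rho>: "chart_density \<rho>" and c: "c \<in> A" and S: "open_diff S" "S \<subseteq> fst c"
    and T: "\<And>k. k < N \<Longrightarrow> open_diff (T k)" "disjoint_family_on T {..<N}" "S \<subseteq> (\<Union>k<N. T k)"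
  shows "vol \<rho> c S = (\<Sum>k<N. vol \<rho> c (S \<inter> T k))"
proof -
  have ind: "indicator (snd c ` S) x = (\<Sum>k<N. indicator (snd c ` (S \<inter> T k)) x :: real)" for x
  proof (cases "x \<in> snd c ` S")
    case True
    then obtain p where p: "p \<in> S" "x = snd c p" by auto
    then obtain k where k: "k < N" "p \<in> T k" using T(3) by auto
    have "x \<in> snd c ` (S \<inter> T j) \<longleftrightarrow> j = k" if "j < N" for j
    proof
      assume "x \<in> snd c ` (S \<inter> T j)"
      then obtain q where q: "q \<in> S" "q \<in> T j" "x = snd c q" by auto
      then have "q = p" using inj_crd[OF c] S(2) p by (auto dest: inj_onD)
      then show "j = k" using T(2) k q that unfolding disjoint_family_on_def by fastforce
    next
      assume "j = k"
      then show "x \<in> snd c ` (S \<inter> T j)" using p k by auto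
    qed
    then have "(\<Sum>j<N. indicator (snd c ` (S \<inter> T j)) x :: real) = (\<Sum>j<N. if j = k then 1 else 0)"
      by (intro sum.cong) (auto simp: indicator_def)
    also have "\<dots> = 1" using k by (subst sum.delta) auto
    finally show ?thesis using True by simp
  next
    case False
    then have "\<And>k. x \<notin> snd c ` (S \<inter> T k)" by blast
    then show ?thesis using False by simp
  qed
  have pos: "0 \<le> \<rho> c x" for x by (rule density_nonneg[OF \<rho>])
  have "vol \<rho> c S = (\<integral>\<^sup>+x. (\<Sum>k<N. ennreal (indicator (snd c ` (S \<inter> T k)) x * \<rho> c x)) \<partial>lborel)"
    unfolding vol_def by (intro nn_integral_cong) (simp add: ind sum_distrib_right sum_ennreal pos)
  also have "\<dots> = (\<Sum>k<N. \<integral>\<^sup>+x. ennreal (indicator (snd c ` (S \<inter> T k)) x * \<rho> c x) \<partial>lborel)"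
  proof (rule nn_integral_sum)
    fix k assume "k \<in> {..<N}"
    then have "open_diff (S \<inter> T k)" using open_diff_Int S(1) T(1) by blast
    then have "(\<lambda>x. indicator (snd c ` (S \<inter> T k)) x * \<rho> c x) \<in> borel_measurable borel"
      by (rule density_measurable[OF \<rho> c]) (use S(2) in blast)
    then show "(\<lambda>x. ennreal (indicator (snd c ` (S \<inter> T k)) x * \<rho> c x)) \<in> borel_measurable lborel"
      by (intro measurable_compose[OF _ measurable_ennreal]) simp
  qed
  finally show ?thesis by (simp add: vol_def)
qed

text \<open>The coordinate expression of the density \<open>F\<^sup>* \<rho>\<close>.\<close>

definition vol_factor :: "('a \<Rightarrow> 'a) \<Rightarrow> (('a, 'n) chart \<Rightarrow> real^'n \<Rightarrow> real) \<Rightarrow> ('a, 'n) chart \<Rightarrow> ('a, 'n) chart \<Rightarrow> real^'n \<Rightarrow> real" where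
  "vol_factor F \<rho> c d x = \<bar>det (jacobian (coord_rep c d F) (at x))\<bar> * \<rho> d (coord_rep c d F x)"

lemma continuous_vol_factor:
  assumes \<rho>: "chart_density \<rho>" and F: "smooth_map M A F" and c: "c \<in> A" and d: "d \<in> A"
  shows "continuous_on (coord_rep_dom c d F) (vol_factor F \<rho> c d)"
proof -
  let ?F = "coord_rep c d F" and ?D = "coord_rep_dom c d F"
  have F': "continuous_map M M F" and sm: "smooth_on ?D ?F" using F c d by (auto simp: smooth_map_def)
  note op = open_rep_dom[OF c d F']
  have "jacobian ?F (at x) = (\<chi> m k. ddir (coord_frame k) ?F x $ m)" for x
    by (simp add: vec_eq_iff jacobian_entry)
  moreover have "smooth_on ?D (\<lambda>x. \<chi> m k. ddir (coord_frame k) ?F x $ m)"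
    by (intro smooth_on_matrixI smooth_on_bounded_linear[OF bounded_linear_vec_nth] smooth_on_ddir sm op)
  ultimately have J: "smooth_on ?D (\<lambda>x. jacobian ?F (at x))" by simp
  have "continuous_on ?D (\<lambda>x. \<rho> d (?F x))"
  proof (rule continuous_on_compose2[OF _ smooth_on_continuous[OF sm]])
    show "continuous_on (coord_image d) (\<rho> d)" by (rule density_continuous[OF \<rho> d order_refl])
    show "?F ` ?D \<subseteq> coord_image d" by (auto simp: rep_dom_iff[OF c] coord_rep_eq intro: crd_in)
  qed
  then show ?thesis unfolding vol_factor_def[abs_def]
    by (intro continuous_on_mult continuous_on_rabs smooth_on_continuous[OF smooth_on_det[OF J]])
qed

lemma vol_image:
  assumes \<rho>: "chart_density \<rho>" and F: "smooth_map M A F" and FG: "homeomorphic_maps M M F G"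
    and c: "c \<in> A" and d: "d \<in> A" and S: "open_diff S" "S \<subseteq> fst c" "F ` S \<subseteq> fst d" "open_diff (F ` S)"
    and fin: "vol \<rho> d (F ` S) < \<infinity>"
  shows "(\<integral>\<^sup>+x. ennreal (indicator (snd c ` S) x * vol_factor F \<rho> c d x) \<partial>lborel) = vol \<rho> d (F ` S)"
proof -
  let ?F = "coord_rep c d F" and ?D = "coord_rep_dom c d F" and ?S = "snd c ` S"
  have F': "continuous_map M M F" and sm: "smooth_on ?D ?F" using F c d by (auto simp: smooth_map_def)
  note op = open_rep_dom[OF c d F']
  have rep: "?F (snd c p) = snd d (F p)" if "p \<in> S" for p
    using pt_crd[OF c, of p] that S(2) by (auto simp: coord_rep_eq)
  have SD: "?S \<subseteq> ?D" using S(2,3) pt_crd[OF c] by (auto simp: rep_dom_iff[OF c] crd_in subset_iff)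
  have img: "?F ` ?S = snd d ` (F ` S)" using rep by (force simp: image_iff)
  have injF: "F p = F q \<Longrightarrow> p = q" if "p \<in> S" "q \<in> S" for p q
    using FG that S(2) dom_sub[OF c] unfolding homeomorphic_maps_def by (metis subsetD)
  have inj: "inj_on ?F ?S"
  proof (rule inj_onI, clarify)
    fix p q assume pq: "p \<in> S" "q \<in> S" "?F (snd c p) = ?F (snd c q)"
    then have "snd d (F p) = snd d (F q)" using rep by simp
    then have "F p = F q" using inj_crd[OF d] S(3) pq(1,2) by (auto dest: inj_onD)
    then show "snd c p = snd c q" using injF pq by metis
  qed
  have S_borel: "?S \<in> sets borel" by (rule open_diff_borel[OF c S(1,2)])
  have pos: "0 \<le> \<rho> d y" for y by (rule density_nonneg[OF \<rho>])
  have eq: "(\<integral>\<^sup>+x. ennreal (indicator ?S x * (\<bar>det (matrix (frechet_derivative ?F (at x)))\<bar> * \<rho> d (?F x))) \<partial>lborel)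
    = (\<integral>\<^sup>+y. ennreal (indicator (?F ` ?S) y * \<rho> d y) \<partial>lborel)"
  proof (rule nn_change_of_variables[OF S_borel _ inj pos])
    show "(?F has_derivative frechet_derivative ?F (at x)) (at x within ?S)" if "x \<in> ?S" for x
      by (rule has_derivative_at_withinI, rule frechet_derivative_works[THEN iffD1], rule smooth_on_differentiable[OF sm op])
        (use that SD in blast)
    show "(\<lambda>y. indicator (?F ` ?S) y * \<rho> d y) \<in> borel_measurable borel"
      unfolding img by (rule density_measurable[OF \<rho> d S(4,3)])
    have "(\<lambda>x. indicator ?S x *\<^sub>R vol_factor F \<rho> c d x) \<in> borel_measurable borel"
      by (rule borel_measurable_continuous_on_indicator[OF S_borel
            continuous_on_subset[OF continuous_vol_factor[OF \<rho> F c d] SD]])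
    then show "(\<lambda>x. indicator ?S x * (\<bar>det (matrix (frechet_derivative ?F (at x)))\<bar> * \<rho> d (?F x))) \<in> borel_measurable borel"
      by (simp add: vol_factor_def jacobian_def)
    show "(\<integral>\<^sup>+y. ennreal (indicator (?F ` ?S) y * \<rho> d y) \<partial>lborel) < \<infinity>"
      unfolding img using fin by (simp add: vol_def)
  qed
  then show ?thesis unfolding img by (simp add: vol_factor_def jacobian_def vol_def)
qed

end

context closed_manifold
begin

lemma piecesD:
  assumes "pieces N c B" "k < N"
  shows "c k \<in> A" "open_diff (B k)" "B k \<subseteq> fst (c k)"
    "\<exists>K. compact K \<and> K \<subseteq> coord_image (c k) \<and> snd (c k) ` B k \<subseteq> K"
  using assms unfolding pieces_def by blast+

lemma pieces_total:
  assumes "pieces N c B"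
  shows "disjoint_family_on B {..<N}" "(\<Union>k<N. B k) = topspace M"
  using assms unfolding pieces_def by blast+

lemma vol_piece_finite:
  assumes \<rho>: "chart_density \<rho>" and p: "pieces N c B" "k < N" and S: "S \<subseteq> B k"
  shows "vol \<rho> (c k) S < \<infinity>"
proof -
  obtain K where K: "compact K" "K \<subseteq> coord_image (c k)" "snd (c k) ` B k \<subseteq> K" using piecesD(4)[OF p] by blast
  show ?thesis by (rule vol_finite[OF \<rho> piecesD(1)[OF p] K(1,2)]) (use K(3) S in blast)
qed

text \<open>Cut the pieces \<open>B k\<close> by the preimages of the pieces \<open>B' l\<close>. By the change of variables formula the
density \<open>F\<^sup>* \<rho>\<close> has integral \<open>vol \<rho>\<close> of the image over each small piece, and the images reassemble to
the pieces \<open>B' l\<close>. The last sum is the volume that \<open>F\<close> loses.\<close>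

lemma vol_comparison:
  fixes N N' :: nat
  assumes \<rho>: "chart_density \<rho>" and F: "smooth_map M A F" and FG: "homeomorphic_maps M M F G"
    and le: "\<And>c d x. c \<in> A \<Longrightarrow> d \<in> A \<Longrightarrow> x \<in> coord_rep_dom c d F \<Longrightarrow> vol_factor F \<rho> c d x \<le> \<rho> c x"
    and p: "pieces N c B" and p': "pieces N' d B'"
  defines "S k l \<equiv> B k \<inter> {p \<in> topspace M. F p \<in> B' l}"
  shows "(\<Sum>k<N. vol \<rho> (c k) (B k)) = (\<Sum>l<N'. vol \<rho> (d l) (B' l)) +
    (\<Sum>k<N. \<Sum>l<N'. \<integral>\<^sup>+x. ennreal (indicator (snd (c k) ` S k l) x * (\<rho> (c k) x - vol_factor F \<rho> (c k) (d l) x)) \<partial>lborel)"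
proof -
  let ?\<delta> = "\<lambda>k l. \<integral>\<^sup>+x. ennreal (indicator (snd (c k) ` S k l) x * (\<rho> (c k) x - vol_factor F \<rho> (c k) (d l) x)) \<partial>lborel"
  have contF: "continuous_map M M F" and contG: "continuous_map M M G"
    and GF: "\<And>p. p \<in> topspace M \<Longrightarrow> G (F p) = p" and FG': "\<And>p. p \<in> topspace M \<Longrightarrow> F (G p) = p"
    using FG unfolding homeomorphic_maps_def by auto
  have mapF: "F p \<in> topspace M" if "p \<in> topspace M" for p
    using contF that by (metis continuous_map_image_subset_topspace image_subset_iff)
  have mapG: "G p \<in> topspace M" if "p \<in> topspace M" for p
    using contG that by (metis continuous_map_image_subset_topspace image_subset_iff)
  have S_diff: "open_diff (S k l)" if "k < N" "l < N'" for k l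
    unfolding S_def using piecesD(2)[OF p that(1)] open_diff_preimage[OF contF piecesD(2)[OF p' that(2)]]
    by (rule open_diff_Int)
  have B_top: "B k \<subseteq> topspace M" if "k < N" for k using pieces_total(2)[OF p] that by blast
  have B'_top: "B' l \<subseteq> topspace M" if "l < N'" for l using pieces_total(2)[OF p'] that by blast
  have FS: "F ` S k l = B' l \<inter> {q \<in> topspace M. G q \<in> B k}" if "k < N" "l < N'" for k l
  proof
    show "F ` S k l \<subseteq> B' l \<inter> {q \<in> topspace M. G q \<in> B k}" using GF mapF by (auto simp: S_def)
    show "B' l \<inter> {q \<in> topspace M. G q \<in> B k} \<subseteq> F ` S k l"
    proof
      fix q assume q: "q \<in> B' l \<inter> {q \<in> topspace M. G q \<in> B k}"
      then have "q = F (G q)" "G q \<in> S k l" using FG' mapG by (auto simp: S_def)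
      then show "q \<in> F ` S k l" by (rule image_eqI)
    qed
  qed
  have FS_diff: "open_diff (F ` S k l)" if "k < N" "l < N'" for k l
    unfolding FS[OF that] using piecesD(2)[OF p' that(2)] open_diff_preimage[OF contG piecesD(2)[OF p that(1)]]
    by (rule open_diff_Int)
  have split: "vol \<rho> (c k) (B k) = (\<Sum>l<N'. vol \<rho> (c k) (S k l))" if k: "k < N" for k
    unfolding S_def
  proof (rule vol_split[OF \<rho> piecesD(1-3)[OF p k]])
    show "open_diff {p \<in> topspace M. F p \<in> B' l}" if "l < N'" for l
      by (rule open_diff_preimage[OF contF piecesD(2)[OF p' that]])
    show "disjoint_family_on (\<lambda>l. {p \<in> topspace M. F p \<in> B' l}) {..<N'}"
      using pieces_total(1)[OF p'] unfolding disjoint_family_on_def by blast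
    show "B k \<subseteq> (\<Union>l<N'. {p \<in> topspace M. F p \<in> B' l})"
      using B_top[OF k] mapF pieces_total(2)[OF p'] by blast
  qed
  have split': "vol \<rho> (d l) (B' l) = (\<Sum>k<N. vol \<rho> (d l) (F ` S k l))" if l: "l < N'" for l
  proof -
    have "vol \<rho> (d l) (B' l) = (\<Sum>k<N. vol \<rho> (d l) (B' l \<inter> {q \<in> topspace M. G q \<in> B k}))"
    proof (rule vol_split[OF \<rho> piecesD(1-3)[OF p' l]])
      show "open_diff {q \<in> topspace M. G q \<in> B k}" if "k < N" for k
        by (rule open_diff_preimage[OF contG piecesD(2)[OF p that]])
      show "disjoint_family_on (\<lambda>k. {q \<in> topspace M. G q \<in> B k}) {..<N}"
        using pieces_total(1)[OF p] unfolding disjoint_family_on_def by blast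
      show "B' l \<subseteq> (\<Union>k<N. {q \<in> topspace M. G q \<in> B k})"
        using B'_top[OF l] mapG pieces_total(2)[OF p] by blast
    qed
    then show ?thesis using FS l by simp
  qed
  have piece: "vol \<rho> (c k) (S k l) = vol \<rho> (d l) (F ` S k l) + ?\<delta> k l" if kl: "k < N" "l < N'" for k l
  proof -
    let ?X = "snd (c k) ` S k l" and ?f = "vol_factor F \<rho> (c k) (d l)"
    note ck = piecesD[OF p kl(1)] and dl = piecesD[OF p' kl(2)]
    have Sc: "S k l \<subseteq> fst (c k)" using ck(3) by (auto simp: S_def)
    have FSd: "F ` S k l \<subseteq> fst (d l)" using dl(3) by (auto simp: S_def)
    have X: "?X \<subseteq> coord_rep_dom (c k) (d l) F"
      using Sc FSd pt_crd[OF ck(1)] by (auto simp: rep_dom_iff[OF ck(1)] crd_in subset_iff)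
    have Xb: "?X \<in> sets borel" by (rule open_diff_borel[OF ck(1) S_diff[OF kl] Sc])
    have m1: "(\<lambda>x. indicator ?X x * ?f x) \<in> borel_measurable borel"
      using borel_measurable_continuous_on_indicator[OF Xb continuous_on_subset[OF continuous_vol_factor[OF \<rho> F ck(1) dl(1)] X]]
      by simp
    have m2: "(\<lambda>x. indicator ?X x * \<rho> (c k) x) \<in> borel_measurable borel"
      by (rule density_measurable[OF \<rho> ck(1) S_diff[OF kl] Sc])
    have m3: "(\<lambda>x. indicator ?X x * (\<rho> (c k) x - ?f x)) \<in> borel_measurable borel"
      using borel_measurable_diff[OF m2 m1] by (simp add: right_diff_distrib)
    have f0: "0 \<le> ?f x" for x using density_nonneg[OF \<rho>] by (simp add: vol_factor_def)
    have g0: "0 \<le> indicator ?X x * (\<rho> (c k) x - ?f x)" for x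
      using le[OF ck(1) dl(1)] X by (auto simp: indicator_def)
    have "vol \<rho> (c k) (S k l) = (\<integral>\<^sup>+x. ennreal (indicator ?X x * ?f x) + ennreal (indicator ?X x * (\<rho> (c k) x - ?f x)) \<partial>lborel)"
      unfolding vol_def using f0 g0
      by (intro nn_integral_cong) (simp add: ennreal_plus[symmetric] algebra_simps del: ennreal_plus)
    also have "\<dots> = (\<integral>\<^sup>+x. ennreal (indicator ?X x * ?f x) \<partial>lborel) + ?\<delta> k l"
      using m1 m3 by (intro nn_integral_add measurable_compose[OF _ measurable_ennreal]) simp_all
    also have "(\<integral>\<^sup>+x. ennreal (indicator ?X x * ?f x) \<partial>lborel) = vol \<rho> (d l) (F ` S k l)"
    proof (rule vol_image[OF \<rho> F FG ck(1) dl(1) S_diff[OF kl] Sc FSd FS_diff[OF kl]])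
      show "vol \<rho> (d l) (F ` S k l) < \<infinity>"
        by (rule vol_piece_finite[OF \<rho> p' kl(2)]) (auto simp: S_def)
    qed
    finally show ?thesis .
  qed
  have "(\<Sum>k<N. vol \<rho> (c k) (B k)) = (\<Sum>k<N. \<Sum>l<N'. vol \<rho> (d l) (F ` S k l)) + (\<Sum>k<N. \<Sum>l<N'. ?\<delta> k l)"
    by (simp add: split piece sum.distrib)
  also have "(\<Sum>k<N. \<Sum>l<N'. vol \<rho> (d l) (F ` S k l)) = (\<Sum>l<N'. \<Sum>k<N. vol \<rho> (d l) (F ` S k l))"
    by (rule sum.swap)
  also have "\<dots> = (\<Sum>l<N'. vol \<rho> (d l) (B' l))" by (simp add: split')
  finally show ?thesis .
qed

text \<open>For \<open>F = id\<close> the comparison shows that the total volume does not depend on the decomposition. For a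
general bijection the lost volume is therefore zero, as the total is finite. Decompositions that
start with neighbourhoods of a point and of its image then force equality at this point by continuity.\<close>

lemma volume_rigidity:
  assumes \<rho>: "chart_density \<rho>"
    and inv: "\<And>c d x. c \<in> A \<Longrightarrow> d \<in> A \<Longrightarrow> x \<in> coord_rep_dom c d id \<Longrightarrow> vol_factor id \<rho> c d x = \<rho> c x"
    and F: "smooth_map M A F" and FG: "homeomorphic_maps M M F G"
    and le: "\<And>c d x. c \<in> A \<Longrightarrow> d \<in> A \<Longrightarrow> x \<in> coord_rep_dom c d F \<Longrightarrow> vol_factor F \<rho> c d x \<le> \<rho> c x"
    and c0: "c0 \<in> A" and d0: "d0 \<in> A" and x: "x \<in> coord_rep_dom c0 d0 F"
  shows "vol_factor F \<rho> c0 d0 x = \<rho> c0 x"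
proof -
  define p where "p = pt c0 x"
  have x': "x \<in> coord_image c0" and pd: "F p \<in> fst d0" using x by (auto simp: rep_dom_iff[OF c0] p_def)
  have p0: "p \<in> fst c0" using pt_in[OF x'] by (simp add: p_def)
  obtain N c B where B: "pieces N c B" "0 < N" "c 0 = c0" "p \<in> B 0" "openin M (B 0)"
    by (rule exists_pieces[OF c0 p0])
  obtain N' d B' where B': "pieces N' d B'" "0 < N'" "d 0 = d0" "F p \<in> B' 0" "openin M (B' 0)"
    by (rule exists_pieces[OF d0 pd])
  let ?S = "\<lambda>F k l. B k \<inter> {p \<in> topspace M. F p \<in> B' l}"
  let ?\<delta> = "\<lambda>F k l. \<integral>\<^sup>+x. ennreal (indicator (snd (c k) ` ?S F k l) x * (\<rho> (c k) x - vol_factor F \<rho> (c k) (d l) x)) \<partial>lborel"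
  let ?V' = "\<Sum>l<N'. vol \<rho> (d l) (B' l)"
  have "homeomorphic_maps M M id id" by (simp add: homeomorphic_maps_def)
  then have "(\<Sum>k<N. vol \<rho> (c k) (B k)) = ?V' + (\<Sum>k<N. \<Sum>l<N'. ?\<delta> id k l)"
    by (rule vol_comparison[OF \<rho> smooth_map_id _ _ B(1) B'(1)]) (simp add: inv)
  moreover have "?\<delta> id k l = 0" if "k < N" "l < N'" for k l
  proof -
    have ck: "c k \<in> A" "B k \<subseteq> fst (c k)" and dl: "d l \<in> A" "B' l \<subseteq> fst (d l)"
      using piecesD[OF B(1) that(1)] piecesD[OF B'(1) that(2)] by auto
    have "vol_factor id \<rho> (c k) (d l) x = \<rho> (c k) x" if "x \<in> snd (c k) ` ?S id k l" for x
      using that ck dl by (intro inv) (auto simp: rep_dom_iff pt_crd crd_in subset_iff)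
    then have "ennreal (indicator (snd (c k) ` ?S id k l) x * (\<rho> (c k) x - vol_factor id \<rho> (c k) (d l) x)) = 0" for x
      by (cases "x \<in> snd (c k) ` ?S id k l") (simp_all del: image_eqI)
    then show ?thesis by (simp only: nn_integral_const) simp
  qed
  moreover have "(\<Sum>k<N. vol \<rho> (c k) (B k)) = ?V' + (\<Sum>k<N. \<Sum>l<N'. ?\<delta> F k l)"
    by (rule vol_comparison[OF \<rho> F FG le B(1) B'(1)])
  ultimately have "?V' + (\<Sum>k<N. \<Sum>l<N'. ?\<delta> F k l) = ?V' + 0" by simp
  then have "?V' = \<infinity> \<or> (\<Sum>k<N. \<Sum>l<N'. ?\<delta> F k l) = 0"
    unfolding ennreal_add_left_cancel by (simp only: infinity_ennreal_def)
  moreover have "?V' < \<infinity>"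
    using vol_piece_finite[OF \<rho> B'(1)] by (simp add: less_top)
  then have "?V' \<noteq> \<infinity>" by (rule less_imp_neq)
  ultimately have "(\<Sum>k<N. \<Sum>l<N'. ?\<delta> F k l) = 0" by blast
  then have \<delta>0: "?\<delta> F 0 0 = 0" using B(2) B'(2) by (simp add: sum_eq_0_iff)
  have contF: "continuous_map M M F" using F by (simp add: smooth_map_def)
  let ?X = "snd c0 ` ?S F 0 0" and ?h = "\<lambda>x. \<rho> c0 x - vol_factor F \<rho> c0 d0 x"
  have Sc: "?S F 0 0 \<subseteq> fst c0" and Sd: "B' 0 \<subseteq> fst d0"
    using piecesD(3)[OF B(1,2)] piecesD(3)[OF B'(1,2)] B(3) B'(3) by auto
  have X_dom: "?X \<subseteq> coord_rep_dom c0 d0 F"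
    using Sc Sd pt_crd[OF c0] by (auto simp: rep_dom_iff[OF c0] crd_in subset_iff)
  have "openin M (?S F 0 0)"
    using openin_Int[OF B(5) openin_continuous_map_preimage[OF contF B'(5)]] .
  from open_crd[OF c0 this] have X_open: "open ?X" using Sc by (simp add: Int_absorb1)
  have xX: "x \<in> ?X" using B(4) B'(4) crd_pt[OF x'] p0 dom_sub[OF c0] by (force simp: p_def image_iff)
  have h_cont: "continuous_on ?X ?h"
    by (rule continuous_on_diff[OF density_continuous[OF \<rho> c0] continuous_on_subset[OF continuous_vol_factor[OF \<rho> F c0 d0] X_dom]])
      (use X_dom in \<open>auto simp: rep_dom_iff[OF c0] subset_iff\<close>)
  have h_nonneg: "0 \<le> ?h y" if "y \<in> ?X" for y using le[OF c0 d0, of y] X_dom that by auto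
  show ?thesis
  proof (rule ccontr)
    assume ne: "vol_factor F \<rho> c0 d0 x \<noteq> \<rho> c0 x"
    define P where "P = ?X \<inter> ?h -` (- {0})"
    have P_open: "open P"
      unfolding P_def using continuous_open_preimage[OF h_cont X_open, of "- {0}"] by auto
    have "x \<in> P" using xX ne by (simp add: P_def)
    have "(\<lambda>y. indicator ?X y * ?h y) \<in> borel_measurable borel"
      using borel_measurable_continuous_on_indicator[OF borel_open[OF X_open] h_cont] by simp
    then have "(\<lambda>y. ennreal (indicator ?X y * ?h y)) \<in> borel_measurable lborel"
      by (intro measurable_compose[OF _ measurable_ennreal]) simp
    from nn_integral_0_iff_AE[OF this] \<delta>0 B(3) B'(3)
    have "AE y in lborel. ennreal (indicator ?X y * ?h y) = 0" by simp
    then have "AE y in lborel. y \<notin> P"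
    proof eventually_elim
      case (elim y)
      show ?case
      proof
        assume y: "y \<in> P"
        then have "0 < ?h y" using h_nonneg[of y] by (auto simp: P_def less_le)
        then show False using elim y by (simp add: P_def)
      qed
    qed
    then have "P \<in> null_sets lborel"
      using P_open by (subst (asm) AE_iff_null_sets[symmetric]) (auto intro: borel_open)
    then have "negligible P" using null_sets_completionI negligible_iff_null_sets by blast
    then show False using open_not_negligible[OF P_open] \<open>x \<in> P\<close> by blast
  qed
qed

end

section \<open>Expanding breathers\<close>

lemma det_scaleR: "det (c *\<^sub>R A :: real^'n^'n) = c ^ CARD('n) * det A"
  by (simp add: det_def prod.distrib sum_distrib_left mult_ac)

lemma (in manifold) scaled_metric:
  assumes g: "riemannian_metric A g" and a: "a > 0"
  shows "riemannian_metric A (\<lambda>c x. a *\<^sub>R g c x)"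
proof -
  have "is_pullback A id (\<lambda>c x. a *\<^sub>R g c x) (\<lambda>c x. a *\<^sub>R g c x)"
    using g by (simp add: riemannian_metric_def tensor_field_def is_pullback_def Let_def)
  moreover have "smooth_on (coord_image c) (\<lambda>x. a *\<^sub>R g c x)" if "c \<in> A" for c
    using g that by (intro smooth_on_scaleR smooth_on_const) (simp add: riemannian_metric_def)
  ultimately show ?thesis
    using g a by (simp add: riemannian_metric_def tensor_field_def scaleR_matrix_vector_assoc[symmetric])
qed

definition (in manifold) metric_density :: "('a, 'n) tensor2 \<Rightarrow> ('a, 'n) chart \<Rightarrow> real^'n \<Rightarrow> real" where
  "metric_density g c x = sqrt \<bar>det (g c x)\<bar>"

lemma (in closed_manifold) chart_density_metric:
  assumes g: "riemannian_metric A g"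
  shows "chart_density (metric_density g)"
  unfolding chart_density_def metric_density_def
proof (intro conjI allI ballI)
  fix c assume "c \<in> A"
  then have "smooth_on (coord_image c) (\<lambda>x. det (g c x))"
    using g by (intro smooth_on_det) (simp add: riemannian_metric_def)
  then show "continuous_on (coord_image c) (\<lambda>x. sqrt \<bar>det (g c x)\<bar>)"
    by (intro continuous_on_real_sqrt continuous_on_rabs smooth_on_continuous)
qed simp

lemma (in closed_manifold) metric_density_pullback:
  assumes "is_pullback A F T S" "c \<in> A" "d \<in> A" "x \<in> coord_rep_dom c d F"
  shows "vol_factor F (metric_density T) c d x = metric_density S c x"
proof -
  let ?J = "jacobian (coord_rep c d F) (at x)"
  have "S c x = transpose ?J ** T d (coord_rep c d F x) ** ?J"
    using assms by (simp add: is_pullback_def Let_def)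
  then have "det (S c x) = (det ?J)\<^sup>2 * det (T d (coord_rep c d F x))"
    by (simp add: det_mul det_transpose power2_eq_square mult_ac)
  then show ?thesis
    by (simp add: vol_factor_def metric_density_def abs_mult real_sqrt_mult)
qed

context closed_flow
begin

lemma initial_min:
  assumes "topspace M \<noteq> {}"
  obtains c x where "c \<in> A" "x \<in> coord_image c"
    "\<And>d y. d \<in> A \<Longrightarrow> y \<in> coord_image d \<Longrightarrow> sc t1 c x \<le> sc t1 d y"
proof -
  have cont: "continuous_on ({t1..t1} \<times> coord_image c) (\<lambda>(t, x). sc t c x)" if "c \<in> A" for c
    by (rule continuous_on_subset[OF continuous_sc[OF that]]) (use t12 in auto)
  have inv: "chart_invariant (\<lambda>c. sc t c)" if "t \<in> {t1..t1}" for t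
    using scal_invariant[OF metric[of t]] that t12 by auto
  obtain c t x where "c \<in> A" "t \<in> {t1..t1}" "x \<in> coord_image c"
    "\<And>d s y. d \<in> A \<Longrightarrow> s \<in> {t1..t1} \<Longrightarrow> y \<in> coord_image d \<Longrightarrow> sc t c x \<le> sc s d y"
    by (rule attains_min[OF assms order_refl cont inv]) (assumption | blast)+
  then show ?thesis using that by auto
qed

text \<open>If \<open>R = s\<close>, every point is a spatial minimum of \<open>R\<close>, and \<open>s' = (2/n) s\<^sup>2\<close> leaves no room in
\<open>\<partial>\<^sub>t R \<ge> 2 |Ric|\<^sup>2 \<ge> (2/n) R\<^sup>2\<close>. This uses the evolution equation at interior times only; the end times
follow by continuity.\<close>

lemma einstein_if_barrier:
  assumes s0: "s0 \<le> 0"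
    and eq: "\<And>c x t. c \<in> A \<Longrightarrow> x \<in> coord_image c \<Longrightarrow> t \<in> {t1<..<t2} \<Longrightarrow> sc t c x = barrier s0 t"
    and t: "t \<in> {t1..t2}"
  shows "einstein_metric A (g t)"
  unfolding einstein_metric_def
proof (intro conjI exI[of _ "barrier s0 t / CARD('n)"] ballI)
  show "riemannian_metric A (g t)" by (rule metric[OF t])
  fix c x assume c: "c \<in> A" and x: "x \<in> coord_image c"
  let ?E = "\<lambda>t. ricci (g t c) x - (barrier s0 t / CARD('n)) *\<^sub>R g t c x"
  have interior: "?E s = 0" if s: "s \<in> {t1<..<t2}" for s
  proof -
    have "((\<lambda>r. sc r c x) has_real_derivative 2 / CARD('n) * (barrier s0 s)\<^sup>2) (at s)"
    proof (rule has_field_derivative_transform_within_open[of "barrier s0" _ _ "{t1<..<t2}"])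
      show "(barrier s0 has_real_derivative 2 / CARD('n) * (barrier s0 s)\<^sup>2) (at s)"
        by (rule barrier_ode[OF s0]) (use s in simp)
    qed (use s eq[OF c x] in auto)
    then have "ddir (1, 0) (st_scalar c) (s, x) = 2 / CARD('n) * (sc s c x)\<^sup>2"
      using DERIV_unique[OF sc_has_derivative[OF c s x]] eq[OF c x s] by simp
    moreover have "sc s c x \<le> sc s c y" if "y \<in> coord_image c" for y
      using eq[OF c _ s] x that by simp
    note sc_evolution_at_min[OF c s x this]
    ultimately have "ricci (g s c) x = (sc s c x / CARD('n)) *\<^sub>R g s c x"
      by (intro sc_square_le(2)[OF c s x]) simp_all
    then show ?thesis using eq[OF c x s] by simp
  qed
  have cx: "continuous_on {t1..t2} (\<lambda>s. (s, x))"
    by (intro continuous_on_Pair continuous_on_id continuous_on_const)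
  have sub: "(\<lambda>s. (s, x)) ` {t1..t2} \<subseteq> {t1..t2} \<times> coord_image c" using x by auto
  have "continuous_on {t1..t2} (\<lambda>s. ricci (g s c) x)"
    using continuous_on_compose2[OF continuous_ricci[OF c] cx sub] by simp
  moreover have "continuous_on {t1..t2} (\<lambda>s. g s c x)"
    using continuous_on_compose2[OF smooth_on_continuous[OF slab_smooth[OF c]] cx sub] by simp
  moreover have "continuous_on {t1..t2} (barrier s0)"
    using barrier_ode[OF s0] by (intro DERIV_continuous_on) (auto intro: has_field_derivative_at_within)
  ultimately have "continuous_on (closure {t1<..<t2}) ?E"
    using t12 by (auto intro!: continuous_on_diff continuous_on_scaleR continuous_on_divide continuous_on_const)
  from continuous_constant_on_closure[OF this, of 0 t] interior t t12
  show "ricci (g t c) x = (barrier s0 t / CARD('n)) *\<^sub>R g t c x" by simp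
qed

text \<open>The inequalities \<open>q \<le> \<alpha>\<close> and \<open>det g(t2) \<le> q\<^sup>n det g(t1)\<close> make \<open>\<Phi>\<close> volume non-increasing for \<open>g(t1)\<close>.
Rigidity turns them into equalities, so that \<open>R\<close> is equal to the barrier.\<close>

theorem expanding_breather_einstein:
  assumes \<alpha>: "\<alpha> > 1" and \<Phi>: "diffeomorphism M A \<Phi>"
    and breather: "is_pullback A \<Phi> (\<lambda>c x. \<alpha> *\<^sub>R g t1 c x) (g t2)"
    and t: "t \<in> {t1..t2}"
  shows "einstein_metric A (g t)"
proof (cases "topspace M = {}")
  case True
  then have "coord_image c = {}" if "c \<in> A" for c using dom_sub[OF that] by (auto simp: coord_image_eq)
  then show ?thesis using metric[OF t] by (simp add: einstein_metric_def)
next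
  case False
  let ?n = "CARD('n)"
  obtain \<Psi> where hom: "homeomorphic_maps M M \<Phi> \<Psi>" and sm: "smooth_map M A \<Phi>"
    using \<Phi> unfolding diffeomorphism_def by blast
  have cont: "continuous_map M M \<Phi>" "continuous_map M M \<Psi>" and inv: "\<And>p. p \<in> topspace M \<Longrightarrow> \<Phi> (\<Psi> p) = p"
    using hom unfolding homeomorphic_maps_def by auto
  have g1: "riemannian_metric A (g t1)" and g2: "riemannian_metric A (g t2)" using metric t12 by auto
  have \<alpha>0: "\<alpha> > 0" using \<alpha> by simp
  note ag1 = scaled_metric[OF g1 \<alpha>0]
  have sc2: "sc t2 c x = sc t1 d (coord_rep c d \<Phi> x) / \<alpha>"
    if c: "c \<in> A" and d: "d \<in> A" and x: "x \<in> coord_rep_dom c d \<Phi>" for c d x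
  proof -
    have y: "coord_rep c d \<Phi> x \<in> coord_image d"
      using x by (auto simp: rep_dom_iff[OF c] coord_rep_eq intro: crd_in)
    show ?thesis
      using metric_pullback.scal_pullback[OF pullback_frame[OF g2 ag1 sm breather c d] x]
        metric_frame.scal_scaled[OF riemannian_frame[OF g1 d] \<alpha>0 y] by simp
  qed
  obtain c0 x0 where m: "c0 \<in> A" "x0 \<in> coord_image c0"
    "\<And>d y. d \<in> A \<Longrightarrow> y \<in> coord_image d \<Longrightarrow> sc t1 c0 x0 \<le> sc t1 d y"
    by (rule initial_min[OF False]) blast
  \<comment> \<open>Cutting off at \<open>0\<close> keeps the barrier defined for all times; if \<open>R \<ge> 0\<close> at \<open>t1\<close> it is the constant \<open>0\<close>.\<close>
  define s0 where "s0 = min (sc t1 c0 x0) 0"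
  have s0: "s0 \<le> 0" by (simp add: s0_def)
  have init: "s0 \<le> sc t1 c x" if "c \<in> A" "x \<in> coord_image c" for c x
    using m(3)[OF that] by (simp add: s0_def)
  define q where "q = 1 - 2 / ?n * s0 * (t2 - t1)"
  have q1: "1 \<le> q" using barrier_denom[OF s0, of t2] t12 by (simp add: q_def)
  have q_le: "q \<le> \<alpha>"
  proof (cases "s0 = 0")
    case True
    then show ?thesis using \<alpha> by (simp add: q_def)
  next
    case False
    then have s0': "s0 = sc t1 c0 x0" "s0 < 0" by (auto simp: s0_def min_def split: if_splits)
    \<comment> \<open>Evaluate the lower bound at time \<open>t2\<close> at the point that \<open>\<Phi>\<close> sends to the initial minimum.\<close>
    define p where "p = \<Psi> (pt c0 x0)"
    have pt0: "pt c0 x0 \<in> topspace M" using pt_in[OF m(2)] dom_sub[OF m(1)] by blast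
    then have p: "p \<in> topspace M" "\<Phi> p = pt c0 x0"
      using inv continuous_map_image_subset_topspace[OF cont(2)] by (auto simp: p_def)
    obtain c1 where c1: "c1 \<in> A" "p \<in> fst c1" using charts_cover[OF p(1)] .
    have x1: "snd c1 p \<in> coord_rep_dom c1 c0 \<Phi>" "coord_rep c1 c0 \<Phi> (snd c1 p) = x0"
      using c1 p(2) pt_in[OF m(2)] crd_pt[OF m(2)] crd_in[OF c1(2)]
      by (auto simp: rep_dom_iff[OF c1(1)] coord_rep_eq pt_crd)
    have "barrier s0 t2 \<le> sc t2 c1 (snd c1 p)"
      by (rule sc_ge_barrier[OF s0 init _ c1(1) crd_in[OF c1(2)]]) (use t12 in auto)
    also have "\<dots> = s0 / \<alpha>" using sc2[OF c1(1) m(1) x1(1)] x1(2) s0' by simp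
    finally have "s0 / q \<le> s0 / \<alpha>" by (simp add: barrier_def q_def)
    then show ?thesis using s0'(2) q1 \<alpha>0 by (simp add: field_simps)
  qed
  let ?\<rho> = "metric_density (g t1)"
  have det1: "0 < det (g t1 c x)" if "c \<in> A" "x \<in> coord_image c" for c x
    by (rule pos_def_det_pos, rule pos_def_metric) (use that t12 in simp_all)
  have det2: "det (g t2 c x) = \<alpha> ^ ?n * (vol_factor \<Phi> ?\<rho> c d x)\<^sup>2"
    if c: "c \<in> A" and d: "d \<in> A" and x: "x \<in> coord_rep_dom c d \<Phi>" for c d x
  proof -
    let ?J = "jacobian (coord_rep c d \<Phi>) (at x)" and ?y = "coord_rep c d \<Phi> x"
    have y: "?y \<in> coord_image d"
      using x by (auto simp: rep_dom_iff[OF c] coord_rep_eq intro: crd_in)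
    have "g t2 c x = transpose ?J ** (\<alpha> *\<^sub>R g t1 d ?y) ** ?J"
      using breather c d x by (simp add: is_pullback_def Let_def)
    then have "det (g t2 c x) = \<alpha> ^ ?n * ((det ?J)\<^sup>2 * det (g t1 d ?y))"
      by (simp add: det_mul det_transpose det_scaleR power2_eq_square mult_ac)
    then show ?thesis using det1[OF d y] by (simp add: vol_factor_def metric_density_def power_mult_distrib)
  qed
  have \<rho>2: "(?\<rho> c x)\<^sup>2 = det (g t1 c x)" if "c \<in> A" "x \<in> coord_image c" for c x
    using det1[OF that] by (simp add: metric_density_def)
  have dom: "x \<in> coord_image c" if "c \<in> A" "x \<in> coord_rep_dom c d \<Phi>" for c d x
    using that rep_dom_iff by blast
  have le: "vol_factor \<Phi> ?\<rho> c d x \<le> ?\<rho> c x"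
    if c: "c \<in> A" and d: "d \<in> A" and x: "x \<in> coord_rep_dom c d \<Phi>" for c d x
  proof (rule power2_le_imp_le)
    show "0 \<le> ?\<rho> c x" by (simp add: metric_density_def)
    have "\<alpha> ^ ?n * (vol_factor \<Phi> ?\<rho> c d x)\<^sup>2 \<le> q ^ ?n * det (g t1 c x)"
      using det_growth(1)[OF s0 init c dom[OF c x]] det2[OF c d x] by (simp add: q_def)
    also have "\<dots> \<le> \<alpha> ^ ?n * det (g t1 c x)"
      using q1 q_le det1[OF c dom[OF c x]] by (intro mult_right_mono power_mono) auto
    finally show "(vol_factor \<Phi> ?\<rho> c d x)\<^sup>2 \<le> (?\<rho> c x)\<^sup>2"
      using \<alpha>0 \<rho>2[OF c dom[OF c x]] by simp
  qed
  have "tensor_field A (g t1)" using g1 by (simp add: riemannian_metric_def)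
  then have inv_id: "vol_factor id ?\<rho> c d x = ?\<rho> c x" if "c \<in> A" "d \<in> A" "x \<in> coord_rep_dom c d id" for c d x
    using metric_density_pullback that unfolding tensor_field_def by blast
  have rigid: "vol_factor \<Phi> ?\<rho> c d x = ?\<rho> c x"
    if "c \<in> A" "d \<in> A" "x \<in> coord_rep_dom c d \<Phi>" for c d x
    by (rule volume_rigidity[OF chart_density_metric[OF g1] _ sm hom])
      (assumption | rule inv_id le that)+
  have eq: "sc s c x = barrier s0 s" if c: "c \<in> A" and x: "x \<in> coord_image c" and s: "s \<in> {t1<..<t2}" for c x s
  proof -
    have "\<Phi> (pt c x) \<in> topspace M"
      using pt_in[OF x] dom_sub[OF c] continuous_map_image_subset_topspace[OF cont(1)] by blast
    then obtain d where d: "d \<in> A" "\<Phi> (pt c x) \<in> fst d" by (rule charts_cover)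
    have xd: "x \<in> coord_rep_dom c d \<Phi>" using x d(2) by (simp add: rep_dom_iff[OF c])
    have g2_eq: "det (g t2 c x) = \<alpha> ^ ?n * det (g t1 c x)"
      using det2[OF c d(1) xd] rigid[OF c d(1) xd] \<rho>2[OF c x] by simp
    then have "\<alpha> ^ ?n * det (g t1 c x) \<le> q ^ ?n * det (g t1 c x)"
      using det_growth(1)[OF s0 init c x] by (simp add: q_def)
    then have "\<alpha> ^ ?n \<le> q ^ ?n" using det1[OF c x] by simp
    then have "\<alpha> \<le> q" using q1 \<alpha>0 by (simp add: power_mono_iff)
    then have "\<alpha> = q" using q_le by simp
    then show ?thesis using det_growth(2)[OF s0 init c x _ s] g2_eq by (simp add: q_def)
  qed
  show ?thesis by (rule einstein_if_barrier[OF s0 eq t])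
qed

end

theorem corollary8p1:
  fixes M :: "'a topology"
    and A :: "('a, 'n::finite) chart set"
    and g :: "real \<Rightarrow> ('a, 'n) tensor2"
    and \<Phi> :: "'a \<Rightarrow> 'a"
    and t1 t2 \<alpha> :: real
  assumes "smooth_manifold M A" and "compact_space M" and "connected_space M"
    and "t1 < t2" and "ricci_flow A t1 t2 g"
    and "\<alpha> > 1" and "diffeomorphism M A \<Phi>"
    and "is_pullback A \<Phi> (\<lambda>c x. \<alpha> *\<^sub>R g t1 c x) (g t2)"
  shows "\<forall>t\<in>{t1..t2}. einstein_metric A (g t)"
proof
  interpret closed_flow M A g t1 t2
    using assms(1,2,4,5) by unfold_locales
  show "einstein_metric A (g t)" if "t \<in> {t1..t2}" for t
    by (rule expanding_breather_einstein[OF assms(6-8) that])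
qed

end
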